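(* Let $b>0$ and $a=c=-b$ (and $d=b$) in the Boussinesq system $\eta_t+u_x+(\eta u)_x+a u_{xxx}-b\eta_{xxt}=0$, $u_t+\eta_x+u u_x+c\eta_{xxx}-b u_{xxt}=0$ on the real line. For a real number $\eta_0$ and a choice of sign $\pm$ (the same sign being used in $\psi$ and in $w$), consider the traveling wave solution $(\varphi(x-wt),\psi(x-wt))$ with $$\varphi(y)=\eta_0\,\mathrm{sech}^2\Big(\frac{y}{2\sqrt b}\Big),\qquad \psi(y)=\pm\,\eta_0\sqrt{\frac{3}{\eta_0+3}}\;\mathrm{sech}^2\Big(\frac{y}{2\sqrt b}\Big),\qquad w=\pm\frac{3+2\eta_0}{\sqrt{3(3+\eta_0)}} .$$ Then this traveling wave is (spectrally) stable for all $\eta_0\in(-\tfrac94,0)$. Equivalently, all waves of this family (with $\eta_0>-3$, $\eta_0\neq 0$) whose speed satisfies $|w|<1$ are stable.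
   Context: Linearization: for a traveling wave $(\varphi,\psi)$ with speed $w$, define $$L=\begin{pmatrix}1+c\,\partial_x^2 & bw\,\partial_x^2+\psi-w\\ bw\,\partial_x^2+\psi-w & 1+a\,\partial_x^2+\varphi\end{pmatrix},\qquad J=-\partial_x(1-b\,\partial_x^2)^{-1}\begin{pmatrix}0&1\\1&0\end{pmatrix},$$ where $\varphi=\varphi(x)$, $\psi=\psi(x)$ act by multiplication and $L$ is self-adjoint on $L^2(\mathbb R)\times L^2(\mathbb R)$ with domain $D(L)=H^2(\mathbb R)\times H^2(\mathbb R)$. The linearized problem about the wave, in the frame moving with speed $w$, is $\mathbf u_t=JL\mathbf u$. Definition of stability: the wave is called unstable if there are a nonzero $\mathbf f\in H^2(\mathbb R)\times H^2(\mathbb R)$ (complex valued) and $\lambda\in\mathbb C$ with $\Re\lambda>0$ such that $JL\mathbf f=\lambda\mathbf f$. Otherwise the wave is called (spectrally) stable. *)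

theory Defs
  imports "HOL-Analysis.Analysis"
begin

definition partial_x :: "(real \<Rightarrow> real \<Rightarrow> real) \<Rightarrow> real \<Rightarrow> real \<Rightarrow> real" where
  "partial_x f x t = deriv (\<lambda>y. f y t) x"

definition partial_t :: "(real \<Rightarrow> real \<Rightarrow> real) \<Rightarrow> real \<Rightarrow> real \<Rightarrow> real" where
  "partial_t f x t = deriv (\<lambda>s. f x s) t"

definition x_differentiable :: "(real \<Rightarrow> real \<Rightarrow> real) \<Rightarrow> bool" where
  "x_differentiable f \<longleftrightarrow> (\<forall>x t. (\<lambda>y. f y t) field_differentiable at x)"

definition t_differentiable :: "(real \<Rightarrow> real \<Rightarrow> real) \<Rightarrow> bool" where
  "t_differentiable f \<longleftrightarrow> (\<forall>x t. (\<lambda>s. f x s) field_differentiable at t)"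

text \<open>The partial derivatives that occur in the system must exist; without this requirement
  the total function \<^const>\<open>deriv\<close> could take unspecified values.\<close>

definition boussinesq_regular :: "(real \<Rightarrow> real \<Rightarrow> real) \<Rightarrow> bool" where
  "boussinesq_regular f \<longleftrightarrow>
     t_differentiable f \<and> x_differentiable f \<and> x_differentiable (partial_x f) \<and>
     x_differentiable (partial_x (partial_x f)) \<and> t_differentiable (partial_x (partial_x f))"

text \<open>Classical solutions \<open>(\<eta>, u)\<close>, as functions of \<open>x\<close> and \<open>t\<close>, with the same coefficient \<open>b\<close>
  in front of both mixed derivatives.\<close>

definition boussinesq_solution ::
  "real \<Rightarrow> real \<Rightarrow> real \<Rightarrow> (real \<Rightarrow> real \<Rightarrow> real) \<Rightarrow> (real \<Rightarrow> real \<Rightarrow> real) \<Rightarrow> bool" where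
  "boussinesq_solution a b c \<eta> u \<longleftrightarrow>
     boussinesq_regular \<eta> \<and> boussinesq_regular u \<and>
     (\<forall>x t. partial_t \<eta> x t + partial_x u x t + partial_x (\<lambda>y s. \<eta> y s * u y s) x t
             + a * partial_x (partial_x (partial_x u)) x t
             - b * partial_t (partial_x (partial_x \<eta>)) x t = 0) \<and>
     (\<forall>x t. partial_t u x t + partial_x \<eta> x t + u x t * partial_x u x t
             + c * partial_x (partial_x (partial_x \<eta>)) x t
             - b * partial_t (partial_x (partial_x u)) x t = 0)"

definition traveling_wave_solution ::
  "real \<Rightarrow> real \<Rightarrow> real \<Rightarrow> (real \<Rightarrow> real) \<Rightarrow> (real \<Rightarrow> real) \<Rightarrow> real \<Rightarrow> bool" where
  "traveling_wave_solution a b c \<phi> \<psi> w \<longleftrightarrow>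
     boussinesq_solution a b c (\<lambda>x t. \<phi> (x - w * t)) (\<lambda>x t. \<psi> (x - w * t))"

definition sech :: "real \<Rightarrow> real" where
  "sech y = 1 / cosh y"

definition wave_phi :: "real \<Rightarrow> real \<Rightarrow> real \<Rightarrow> real" where
  "wave_phi b \<eta>\<^sub>0 y = \<eta>\<^sub>0 * (sech (y / (2 * sqrt b)))\<^sup>2"

text \<open>The parameter \<open>\<sigma>\<close> is the sign, equal to \<open>1\<close> or \<open>-1\<close>.\<close>

definition wave_psi :: "real \<Rightarrow> real \<Rightarrow> real \<Rightarrow> real \<Rightarrow> real" where
  "wave_psi \<sigma> b \<eta>\<^sub>0 y = \<sigma> * \<eta>\<^sub>0 * sqrt (3 / (\<eta>\<^sub>0 + 3)) * (sech (y / (2 * sqrt b)))\<^sup>2"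

definition wave_speed :: "real \<Rightarrow> real \<Rightarrow> real" where
  "wave_speed \<sigma> \<eta>\<^sub>0 = \<sigma> * ((3 + 2 * \<eta>\<^sub>0) / sqrt (3 * (3 + \<eta>\<^sub>0)))"

text \<open>Elements of \<open>L\<^sup>2(\<real>)\<close> are represented by Borel functions; two functions represent the same
  element iff they agree almost everywhere. All notions below respect this identification.\<close>

definition L2 :: "(real \<Rightarrow> complex) set" where
  "L2 = {f. f \<in> borel_measurable borel \<and> integrable lborel (\<lambda>x. (cmod (f x))\<^sup>2)}"

definition test_function :: "(real \<Rightarrow> real) \<Rightarrow> bool" where
  "test_function \<theta> \<longleftrightarrow>
     (\<forall>n x. (deriv ^^ n) \<theta> field_differentiable at x) \<and> compact (closure {x. \<theta> x \<noteq> 0})"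

text \<open>Unbounded operators are represented by their graphs. The operator \<open>\<partial>\<^sub>x\<close> on \<open>L\<^sup>2(\<real>)\<close>, with
  domain \<open>H\<^sup>1(\<real>)\<close>, is the weak derivative.\<close>

definition ddx :: "((real \<Rightarrow> complex) \<times> (real \<Rightarrow> complex)) set" where
  "ddx = {(f, g). f \<in> L2 \<and> g \<in> L2 \<and>
     (\<forall>\<theta>. test_function \<theta> \<longrightarrow>
        (LINT x|lborel. complex_of_real (deriv \<theta> x) * f x) =
        - (LINT x|lborel. complex_of_real (\<theta> x) * g x))}"

abbreviation ddx2 :: "((real \<Rightarrow> complex) \<times> (real \<Rightarrow> complex)) set" where
  "ddx2 \<equiv> ddx O ddx"

definition H2 :: "(real \<Rightarrow> complex) set" where
  "H2 = Domain ddx2"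

text \<open>The operator \<open>1 - b \<partial>\<^sub>x\<^sup>2\<close> with domain \<open>H\<^sup>2(\<real>)\<close>. The graph of its inverse is the converse.\<close>

definition helmholtz :: "real \<Rightarrow> ((real \<Rightarrow> complex) \<times> (real \<Rightarrow> complex)) set" where
  "helmholtz b = {(v, g). g \<in> L2 \<and>
     (\<exists>v2. (v, v2) \<in> ddx2 \<and> (AE x in lborel. g x = v x - of_real b * v2 x))}"

type_synonym state = "(real \<Rightarrow> complex) \<times> (real \<Rightarrow> complex)"

definition op_L ::
  "real \<Rightarrow> real \<Rightarrow> real \<Rightarrow> (real \<Rightarrow> real) \<Rightarrow> (real \<Rightarrow> real) \<Rightarrow> real \<Rightarrow> (state \<times> state) set" where
  "op_L a b c \<phi> \<psi> w = {((f1, f2), (g1, g2)). g1 \<in> L2 \<and> g2 \<in> L2 \<and>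
     (\<exists>f1xx f2xx. (f1, f1xx) \<in> ddx2 \<and> (f2, f2xx) \<in> ddx2 \<and>
        (AE x in lborel.
           g1 x = (f1 x + of_real c * f1xx x)
                + (of_real (b * w) * f2xx x + of_real (\<psi> x) * f2 x - of_real w * f2 x)) \<and>
        (AE x in lborel.
           g2 x = (of_real (b * w) * f1xx x + of_real (\<psi> x) * f1 x - of_real w * f1 x)
                + (f2 x + of_real a * f2xx x + of_real (\<phi> x) * f2 x)))}"

text \<open>\<open>J (g1, g2) = (- \<partial>\<^sub>x (1 - b \<partial>\<^sub>x\<^sup>2)\<^sup>-\<^sup>1 g2, - \<partial>\<^sub>x (1 - b \<partial>\<^sub>x\<^sup>2)\<^sup>-\<^sup>1 g1)\<close>; note that \<open>O\<close> composes from
  left to right.\<close>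

definition op_J :: "real \<Rightarrow> (state \<times> state) set" where
  "op_J b = {((g1, g2), (h1, h2)).
     (g2, \<lambda>x. - h1 x) \<in> (helmholtz b)\<inverse> O ddx \<and>
     (g1, \<lambda>x. - h2 x) \<in> (helmholtz b)\<inverse> O ddx}"

definition spectrally_unstable ::
  "real \<Rightarrow> real \<Rightarrow> real \<Rightarrow> (real \<Rightarrow> real) \<Rightarrow> (real \<Rightarrow> real) \<Rightarrow> real \<Rightarrow> bool" where
  "spectrally_unstable a b c \<phi> \<psi> w \<longleftrightarrow>
     (\<exists>f1 f2 \<mu>. f1 \<in> H2 \<and> f2 \<in> H2 \<and> \<not> (AE x in lborel. f1 x = 0 \<and> f2 x = 0) \<and> Re \<mu> > 0 \<and>
        ((f1, f2), (\<lambda>x. \<mu> * f1 x, \<lambda>x. \<mu> * f2 x)) \<in> op_L a b c \<phi> \<psi> w O op_J b)"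

definition spectrally_stable ::
  "real \<Rightarrow> real \<Rightarrow> real \<Rightarrow> (real \<Rightarrow> real) \<Rightarrow> (real \<Rightarrow> real) \<Rightarrow> real \<Rightarrow> bool" where
  "spectrally_stable a b c \<phi> \<psi> w \<longleftrightarrow> \<not> spectrally_unstable a b c \<phi> \<psi> w"

end

theory Submission
  imports Defs "HOL-Computational_Algebra.Polynomial"
begin

text \<open>Write \<open>T = 1 - b \<partial>\<^sup>2\<close> and \<open>S(x) = sech\<^sup>2(x / (2 \<surd>b))\<close>, so that \<open>T S = 3/2 S\<^sup>2\<close>. For \<open>a = c = -b\<close> the
  operator \<open>L\<close> is a constant \<open>2 \<times> 2\<close> matrix times \<open>T\<close> plus a constant matrix times \<open>S\<close>. Diagonalizing both
  at once decouples \<open>L\<close> into positive multiples of \<open>T + \<gamma> S\<close> with \<open>\<gamma> > 0\<close>, and of \<open>T - 3 S\<close>, whose kernel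
  is spanned by \<open>S'\<close>. An eigenfunction \<open>f\<close> of \<open>J L\<close> with \<open>\<Re> \<mu> > 0\<close> satisfies \<open>\<langle>L f, f\<rangle> = 0\<close>, because \<open>J\<close> is
  skew, and is orthogonal to \<open>J\<^sup>-\<^sup>1\<close> of the translation mode, which in the decoupled variables reads
  \<open>\<integral> (u1 + 2 u2) S\<^sup>2 = 0\<close>. On this hyperplane the form of \<open>L\<close> is nonnegative: the form of \<open>T - 3 S\<close> is
  nonnegative on functions vanishing at the origin, the only zero of \<open>S'\<close>, and the remaining direction
  \<open>S\<close> is handled explicitly. Hence \<open>f\<close> is in the kernel of \<open>L\<close>, and \<open>\<mu> f = J L f = 0\<close>.\<close>

subsection \<open>Smooth cutoff functions\<close>

text \<open>With \<open>a = \<sigma> sqrt (3 / (\<eta> + 3))\<close> and \<open>q = 1 / a\<close>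
  the data of the wave become polynomial: the amplitudes are \<open>3 (q^2 - 1)\<close> and
  \<open>3 (q - a)\<close>, the speed is \<open>2 q - a\<close>. Then
  \<open>1 - w^2 = (a^2 - 1) (4 - a^2) / a^2\<close>, so the range of stability is exactly
  \<open>1 < a^2 < 4\<close>, and the two factors are, up to a factor 3, the weights of the
  decoupled operators. \<open>T - 3 S\<close> has one negative direction, since its zero mode
  changes sign once; positivity must therefore come from one linear constraint. \<open>S\<close> can
  stand in for the negative eigenfunction because \<open>T S\<close> is a multiple of the weight
  \<open>S^2\<close> of that constraint, so no spectral theory enters. The decoupling concerns
  \<open>L\<close> only: \<open>J\<close> still mixes the two components, which is why the
  potentials \<open>T^(-1) L f\<close> are carried along. The operators are graphs on classes of
  functions, with derivatives defined by testing. Hence an unstable mode is first turned into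
  classical functions with square integrable derivatives, where every integration by parts is
  elementary.\<close>

definition smooth :: "(real \<Rightarrow> real) \<Rightarrow> bool" where
  "smooth f \<longleftrightarrow> (\<forall>n x. (deriv ^^ n) f field_differentiable at x)"

text \<open>The recursion peels off the innermost derivative, so that the sum and product rules go
  through by induction with the functions generalized. The index counts from zero: \<open>n\<close>
  stands for \<open>n + 1\<close> derivatives.\<close>

primrec differentiable_times :: "nat \<Rightarrow> (real \<Rightarrow> real) \<Rightarrow> bool" where
  "differentiable_times 0 f \<longleftrightarrow> (\<forall>x. f field_differentiable at x)"
| "differentiable_times (Suc n) f \<longleftrightarrow>
     (\<forall>x. f field_differentiable at x) \<and> differentiable_times n (deriv f)"

lemma differentiable_times_iff:
  "differentiable_times n f \<longleftrightarrow> (\<forall>m\<le>n. \<forall>x. (deriv ^^ m) f field_differentiable at x)"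
proof (induction n arbitrary: f)
  case (Suc n)
  have "(\<forall>m\<le>Suc n. \<forall>x. (deriv ^^ m) f field_differentiable at x) \<longleftrightarrow>
      (\<forall>x. f field_differentiable at x) \<and>
      (\<forall>m\<le>n. \<forall>x. (deriv ^^ Suc m) f field_differentiable at x)"
    by (metis (no_types, lifting) Suc_le_mono eq_id_iff funpow_0 le0 not0_implies_Suc)
  then show ?case
    using Suc by (simp add: funpow_Suc_right del: funpow.simps)
qed simp

lemma smooth_iff_differentiable_times: "smooth f \<longleftrightarrow> (\<forall>n. differentiable_times n f)"
  unfolding smooth_def differentiable_times_iff by blast

lemma smooth_rec: "smooth f \<longleftrightarrow> (\<forall>x. f field_differentiable at x) \<and> smooth (deriv f)"
  unfolding smooth_iff_differentiable_times by (metis differentiable_times.simps not0_implies_Suc)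

lemma smooth_has_derivative: "smooth f \<Longrightarrow> (f has_real_derivative deriv f x) (at x)"
  using smooth_rec field_differentiable_derivI by blast

lemma smooth_continuous: "smooth f \<Longrightarrow> continuous_on A f"
  by (meson DERIV_isCont continuous_at_imp_continuous_on smooth_has_derivative)

text \<open>Smoothness as a greatest fixed point. The classes used for \<open>P\<close> are the
  constants, the rescaled smooth functions and the flat exponentials.\<close>

lemma smooth_coinduct:
  assumes "P f" and "\<And>g x. P g \<Longrightarrow> g field_differentiable at x" and "\<And>g. P g \<Longrightarrow> P (deriv g)"
  shows "smooth f"
proof -
  have "P ((deriv ^^ n) f)" for n by (induction n) (use assms in auto)
  then show ?thesis using assms(2) smooth_def by blast
qed

lemma differentiable_times_Suc_imp: "differentiable_times (Suc n) f \<Longrightarrow> differentiable_times n f"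
  unfolding differentiable_times_iff by auto

lemma differentiable_times_add:
  "differentiable_times n f \<Longrightarrow> differentiable_times n g \<Longrightarrow> differentiable_times n (\<lambda>x. f x + g x)"
proof (induction n arbitrary: f g)
  case (Suc n)
  have "deriv (\<lambda>x. f x + g x) = (\<lambda>x. deriv f x + deriv g x)"
    using Suc.prems by (auto intro!: deriv_add)
  with Suc show ?case by (auto intro: field_differentiable_add)
qed (auto intro: field_differentiable_add)

lemma differentiable_times_mult:
  "differentiable_times n f \<Longrightarrow> differentiable_times n g \<Longrightarrow> differentiable_times n (\<lambda>x. f x * g x)"
proof (induction n arbitrary: f g)
  case (Suc n)
  have "deriv (\<lambda>x. f x * g x) = (\<lambda>x. f x * deriv g x + deriv f x * g x)"
    using Suc.prems by (auto intro!: deriv_mult)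
  moreover have "differentiable_times n f" "differentiable_times n g"
    using Suc.prems differentiable_times_Suc_imp by blast+
  ultimately show ?case
    using Suc by (auto intro!: differentiable_times_add field_differentiable_mult)
qed (auto intro: field_differentiable_mult)

lemma smooth_add: "smooth f \<Longrightarrow> smooth g \<Longrightarrow> smooth (\<lambda>x. f x + g x)"
  by (simp add: smooth_iff_differentiable_times differentiable_times_add)

lemma smooth_mult: "smooth f \<Longrightarrow> smooth g \<Longrightarrow> smooth (\<lambda>x. f x * g x)"
  by (simp add: smooth_iff_differentiable_times differentiable_times_mult)

lemma smooth_const: "smooth (\<lambda>x. c)"
  by (rule smooth_coinduct[where P = "\<lambda>f. \<exists>c. f = (\<lambda>x. c)"]) auto

lemma smooth_affine:
  assumes "smooth f"
  shows "smooth (\<lambda>x. f (c * x + d))"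
\<comment> \<open>The factor \<open>e\<close> collects the powers of \<open>c\<close> that the chain
  rule produces, which closes the class under \<open>deriv\<close>.\<close>
proof (rule smooth_coinduct[where P = "\<lambda>f. \<exists>e g. smooth g \<and> f = (\<lambda>x. e * g (c * x + d))"])
  show "\<exists>e g. smooth g \<and> (\<lambda>x. f (c * x + d)) = (\<lambda>x. e * g (c * x + d))"
    using assms by (intro exI[of _ 1]) auto
next
  fix f x assume "\<exists>e g. smooth g \<and> f = (\<lambda>x. e * g (c * x + d))"
  then obtain e g where g: "smooth g" "f = (\<lambda>x. e * g (c * x + d))" by blast
  have D: "(f has_real_derivative e * (deriv g (c * x + d) * c)) (at x)" for x
    unfolding g(2) by (auto intro!: derivative_eq_intros DERIV_chain2[OF smooth_has_derivative[OF g(1)]])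
  then show "f field_differentiable at x"
    using field_differentiable_def by blast
  have "deriv f = (\<lambda>x. (e * c) * deriv g (c * x + d))"
    by (rule ext) (use D DERIV_imp_deriv in \<open>fastforce simp: mult_ac\<close>)
  then show "\<exists>e g. smooth g \<and> deriv f = (\<lambda>x. e * g (c * x + d))"
    using g(1) smooth_rec by blast
qed

section \<open>Flat exponentials and smooth approximations of intervals\<close>

definition exp_inverse :: "real poly \<Rightarrow> real \<Rightarrow> real" where
  "exp_inverse p x = (if x > 0 then poly p (1 / x) * exp (- 1 / x) else 0)"

lemma poly_times_exp_tendsto_0: "((\<lambda>y. poly p y * exp (- y)) \<longlongrightarrow> (0::real)) at_top"
proof -
  have "((\<lambda>y. \<Sum>i\<le>degree p. coeff p i * (y ^ i / exp y)) \<longlongrightarrow> (\<Sum>i\<le>degree p. coeff p i * 0)) at_top"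
    by (intro tendsto_sum tendsto_mult tendsto_const tendsto_power_div_exp_0)
  then show ?thesis
    by (simp add: poly_altdef exp_minus field_simps sum_divide_distrib)
qed

text \<open>For \<open>x > 0\<close> the chain rule gives
  \<open>x^(-2) (p - p') (1/x) exp (-1/x)\<close>, a function of the same kind with the polynomial
  \<open>X^2 (p - p')\<close>; this is why the family is indexed by all polynomials. At the origin
  the right difference quotient is \<open>X p\<close> at \<open>1/h\<close> times
  \<open>exp (-1/h)\<close>, and the exponential wins.\<close>

lemma exp_inverse_has_derivative:
  "(exp_inverse p has_real_derivative exp_inverse ([:0, 0, 1:] * (p - pderiv p)) x) (at x)"
proof -
  consider "x > 0" | "x < 0" | "x = 0" by linarith
  then show ?thesis
  proof cases
    case 1
    have "((\<lambda>x. poly p (1 / x) * exp (- 1 / x)) has_real_derivative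
        exp_inverse ([:0, 0, 1:] * (p - pderiv p)) x) (at x)"
      unfolding exp_inverse_def using 1
      by (auto intro!: derivative_eq_intros DERIV_chain2[OF poly_DERIV] simp: field_simps power2_eq_square)
    then show ?thesis
      by (rule has_field_derivative_transform_within_open[where S = "{0<..}"])
        (use 1 in \<open>auto simp: exp_inverse_def\<close>)
  next
    case 2
    have "((\<lambda>x. 0) has_real_derivative exp_inverse ([:0, 0, 1:] * (p - pderiv p)) x) (at x)"
      using 2 by (simp add: exp_inverse_def)
    then show ?thesis
      by (rule has_field_derivative_transform_within_open[where S = "{..<0}"])
        (use 2 in \<open>auto simp: exp_inverse_def\<close>)
  next
    case 3
    have "((\<lambda>h. exp_inverse p h / h) \<longlongrightarrow> 0) (at_right 0)"
    proof -
      have "((\<lambda>h. poly ([:0,1:] * p) (inverse h) * exp (- inverse h)) \<longlongrightarrow> 0) (at_right (0::real))"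
        using filterlim_compose[OF poly_times_exp_tendsto_0 filterlim_inverse_at_top_right] .
      then show ?thesis
        by (rule Lim_transform_eventually)
          (auto simp: exp_inverse_def eventually_at_filter field_simps)
    qed
    moreover have "((\<lambda>h. exp_inverse p h / h) \<longlongrightarrow> 0) (at_left 0)"
      by (rule tendsto_eventually) (auto simp: eventually_at_filter exp_inverse_def)
    ultimately have "((\<lambda>h. exp_inverse p h / h) \<longlongrightarrow> 0) (at 0)"
      by (simp add: filterlim_split_at)
    then show ?thesis
      using 3 by (simp add: DERIV_def exp_inverse_def)
  qed
qed

lemma smooth_exp_inverse: "smooth (exp_inverse p)"
proof (rule smooth_coinduct[where P = "\<lambda>f. \<exists>p. f = exp_inverse p"])
  fix f x assume "\<exists>p. f = exp_inverse p"
  then obtain p where p: "f = exp_inverse p" by blast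
  show "f field_differentiable at x"
    using exp_inverse_has_derivative field_differentiable_def p by blast
  have "deriv f = exp_inverse ([:0, 0, 1:] * (p - pderiv p))"
    unfolding p using DERIV_imp_deriv[OF exp_inverse_has_derivative] by blast
  then show "\<exists>p. deriv f = exp_inverse p" by blast
qed auto

text \<open>For \<open>n > 0\<close> this is positive exactly between \<open>a\<close> and
  \<open>b\<close>. Scaling by \<open>n\<close> inside the exponentials pushes the values there
  towards 1, so the indicator of the open interval is approximated from below.\<close>

definition plateau :: "real \<Rightarrow> real \<Rightarrow> nat \<Rightarrow> real \<Rightarrow> real" where
  "plateau a b n x = exp_inverse 1 (real n * (x - a)) * exp_inverse 1 (real n * (b - x))"

lemma smooth_plateau: "smooth (plateau a b n)"
proof -
  have "smooth (\<lambda>x. exp_inverse 1 (real n * x + real n * - a) * exp_inverse 1 (- real n * x + real n * b))"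
    by (intro smooth_mult smooth_affine smooth_exp_inverse)
  moreover have "plateau a b n = \<dots>"
    by (simp add: plateau_def fun_eq_iff algebra_simps)
  ultimately show ?thesis by simp
qed

lemma plateau_bounds: "0 \<le> plateau a b n x" "plateau a b n x \<le> indicator {a..b} x"
  by (auto simp: plateau_def exp_inverse_def indicator_def zero_less_mult_iff intro!: mult_le_one)

lemma plateau_tendsto: "(\<lambda>n. plateau a b n x) \<longlonglongrightarrow> indicator {a<..<b} x"
proof -
  have E: "(\<lambda>n. exp_inverse 1 (real n * y)) \<longlonglongrightarrow> (if y > 0 then 1 else 0)" for y
  proof (cases "y > 0")
    case True
    have "(\<lambda>n. exp (- (1 / y) * (1 / real n))) \<longlonglongrightarrow> exp (- (1 / y) * 0)"
      by (intro tendsto_intros lim_1_over_n)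
    then have "(\<lambda>n. exp (- (1 / y) * (1 / real n))) \<longlonglongrightarrow> 1"
      by simp
    \<comment> \<open>At \<open>n = 0\<close> the function is 0 by its case distinction, while the
      formula gives \<open>exp 0\<close> because of division by zero; the two agree from
      \<open>n = 1\<close> on.\<close>
    then have "(\<lambda>n. exp_inverse 1 (real n * y)) \<longlonglongrightarrow> 1"
      by (rule Lim_transform_eventually[OF _ eventually_mono[OF eventually_gt_at_top[of 0]]])
        (use True in \<open>auto simp: exp_inverse_def\<close>)
    with True show ?thesis by simp
  next
    case False
    then show ?thesis
      by (auto simp: exp_inverse_def zero_less_mult_iff)
  qed
  have "(\<lambda>n. plateau a b n x) \<longlonglongrightarrow> (if x - a > 0 then 1 else 0) * (if b - x > 0 then 1 else 0)"
    unfolding plateau_def by (intro tendsto_mult E)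
  then show ?thesis by (simp add: indicator_def split: if_splits)
qed

lemma test_function_iff: "test_function \<theta> \<longleftrightarrow> smooth \<theta> \<and> (\<exists>R. \<forall>x. \<bar>x\<bar> > R \<longrightarrow> \<theta> x = 0)"
proof -
  have "compact (closure {x. \<theta> x \<noteq> 0}) \<longleftrightarrow> bounded {x. \<theta> x \<noteq> 0}"
    by simp
  also have "\<dots> \<longleftrightarrow> (\<exists>R. \<forall>x. \<bar>x\<bar> > R \<longrightarrow> \<theta> x = 0)"
    unfolding bounded_iff by (auto simp: not_less) (metis linorder_not_le)+
  finally show ?thesis
    by (simp add: test_function_def smooth_def)
qed

lemma test_function_plateau: "test_function (plateau a b n)"
  unfolding test_function_iff
proof (intro conjI exI allI impI smooth_plateau)
  fix x assume "max \<bar>a\<bar> \<bar>b\<bar> < \<bar>x\<bar>"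
  then have "x \<notin> {a..b}" by auto
  then show "plateau a b n x = 0"
    using plateau_bounds[of a b n x] by simp
qed

subsection \<open>Weak derivatives on the line\<close>

text \<open>Dynkin's argument: half lines are an intersection-stable generator of the Borel sets,
  and the sets over which \<open>h\<close> has integral zero are closed under complements and
  countable disjoint unions. Complements need the integral over the whole line, a limit of half
  lines.\<close>

lemma AE_zero_if_initial_integrals_zero:
  fixes h :: "real \<Rightarrow> 'a :: {second_countable_topology, banach}"
  assumes h: "integrable lborel h" and 0: "\<And>a. (LINT x:{..<a}|lborel. h x) = 0"
  shows "AE x in lborel. h x = 0"
proof (rule sigma_finite_measure.density_zero[OF lborel.sigma_finite_measure_axioms h])
  have int: "set_integrable lborel A h" if "A \<in> sets borel" for A
    using that h by (simp add: set_integrable_def integrable_mult_indicator)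
  have all: "(LINT x:UNIV|lborel. h x) = 0"
  proof -
    have "(\<lambda>i. LINT x:{..<real i}|lborel. h x) \<longlonglongrightarrow> (LINT x:(\<Union>i. {..<real i})|lborel. h x)"
      by (rule set_integral_cont_up) (auto simp: incseq_def intro!: int)
    moreover have "(\<Union>i. {..<real i}) = UNIV"
      using reals_Archimedean2 by auto
    ultimately show ?thesis
      using 0 by (simp add: LIMSEQ_const_iff)
  qed
  fix A :: "real set" assume "A \<in> sets lborel"
  then have A: "A \<in> sigma_sets UNIV (range lessThan)"
    by (simp add: borel_Iio)
  have Int: "{..<a} \<inter> {..<b} = {..<min a b}" for a b :: real
    by auto
  have IS: "Int_stable (range lessThan :: real set set)"
    by (auto simp: Int_stable_def Int)
  have "range lessThan \<subseteq> Pow (UNIV :: real set)"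
    by simp
  with IS show "(LINT x:A|lborel. h x) = 0"
    using A
  proof (induction rule: sigma_sets_induct_disjoint)
    case (compl A)
    then have A: "A \<in> sets borel" by (simp add: borel_Iio)
    have "(LINT x:UNIV|lborel. h x) = (LINT x:(A \<union> (UNIV - A))|lborel. h x)"
      by (simp add: Un_absorb2)
    also have "\<dots> = (LINT x:A|lborel. h x) + (LINT x:(UNIV - A)|lborel. h x)"
      using A by (intro set_integral_Un int) auto
    finally show ?case using compl all by simp
  next
    case (union A)
    then have A: "A i \<in> sets borel" for i by (auto simp: borel_Iio)
    have "(LINT x:(\<Union>i. A i)|lborel. h x) = (\<Sum>i. LINT x:A i|lborel. h x)"
      using union.hyps A
      by (intro lebesgue_integral_countable_add int) (auto simp: disjoint_family_on_def)
    then show ?case using union by simp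
  qed (use 0 in \<open>auto simp: set_lebesgue_integral_def\<close>)
qed

definition locally_integrable :: "(real \<Rightarrow> 'a :: {second_countable_topology, banach}) \<Rightarrow> bool" where
  "locally_integrable h \<longleftrightarrow> h \<in> borel_measurable borel \<and> (\<forall>a b. set_integrable lborel {a..b} h)"

lemma locally_integrable_subset:
  assumes "locally_integrable h" "A \<in> sets borel" "A \<subseteq> {a..b}"
  shows "set_integrable lborel A h"
  using assms set_integrable_subset[of lborel "{a..b}" h A] by (auto simp: locally_integrable_def)

text \<open>Testing with plateaus and passing to the limit by dominated convergence shows that
  \<open>h\<close> has integral zero over bounded open intervals. Since \<open>h\<close> need not be
  integrable on the line, the generator argument is applied to its truncations.\<close>

lemma fundamental_lemma:
  fixes h :: "real \<Rightarrow> complex"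
  assumes h: "locally_integrable h"
    and 0: "\<And>\<theta>. test_function \<theta> \<Longrightarrow> (LINT x|lborel. complex_of_real (\<theta> x) * h x) = 0"
  shows "AE x in lborel. h x = 0"
proof -
  have [measurable]: "h \<in> borel_measurable borel"
    using h by (simp add: locally_integrable_def)
  have I: "(LINT x:{a<..<b}|lborel. h x) = 0" for a b
  proof -
    have "(\<lambda>n. LINT x|lborel. complex_of_real (plateau a b n x) * h x) \<longlonglongrightarrow> (LINT x:{a<..<b}|lborel. h x)"
      unfolding set_lebesgue_integral_def
    proof (rule integral_dominated_convergence[where w = "\<lambda>x. norm (indicator {a..b} x *\<^sub>R h x)"])
      show "integrable lborel (\<lambda>x. norm (indicator {a..b} x *\<^sub>R h x))"
        using h unfolding locally_integrable_def set_integrable_def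
        by (intro Bochner_Integration.integrable_norm) blast
      show "AE x in lborel. (\<lambda>n. complex_of_real (plateau a b n x) * h x) \<longlonglongrightarrow> indicat_real {a<..<b} x *\<^sub>R h x"
        unfolding scaleR_conv_of_real by (intro AE_I2 tendsto_intros plateau_tendsto)
      show "AE x in lborel. norm (complex_of_real (plateau a b n x) * h x) \<le> norm (indicat_real {a..b} x *\<^sub>R h x)" for n
        using plateau_bounds[of a b n] by (auto intro!: AE_I2 mult_right_mono simp: norm_mult)
      show "(\<lambda>x. complex_of_real (plateau a b n x) * h x) \<in> borel_measurable lborel" for n
        using borel_measurable_continuous_onI[OF smooth_continuous[OF smooth_plateau]] by measurable
    qed auto
    then show ?thesis
      using 0[OF test_function_plateau] by (simp add: LIMSEQ_const_iff)
  qed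
  have "AE x in lborel. indicat_real {-real n<..<real n} x *\<^sub>R h x = 0" for n
  proof (rule AE_zero_if_initial_integrals_zero)
    show "integrable lborel (\<lambda>x. indicat_real {- real n<..<real n} x *\<^sub>R h x)"
      using locally_integrable_subset[OF h, of "{- real n<..<real n}" "-real n" "real n"]
        greaterThanLessThan_subseteq_atLeastAtMost_iff[of "- real n" "real n" "- real n" "real n"]
      unfolding set_integrable_def by (metis borel_open open_greaterThanLessThan order_refl)
    show "(LINT x:{..<a}|lborel. indicat_real {- real n<..<real n} x *\<^sub>R h x) = 0" for a
    proof -
      have "(LINT x:{..<a}|lborel. indicat_real {- real n<..<real n} x *\<^sub>R h x) =
          (LINT x:{- real n<..<min a (real n)}|lborel. h x)"
        unfolding set_lebesgue_integral_def
        by (intro Bochner_Integration.integral_cong) (auto simp: indicator_def)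
      then show ?thesis using I by simp
    qed
  qed
  then have "AE x in lborel. \<forall>n. indicat_real {-real n<..<real n} x *\<^sub>R h x = 0"
    unfolding AE_all_countable by blast
  then show ?thesis
  proof eventually_elim
    case (elim x)
    obtain n where "\<bar>x\<bar> < real n" using reals_Archimedean2 by blast
    then show ?case using elim[rule_format, of n] by (auto simp: indicator_def)
  qed
qed

lemma L2_locally_integrable:
  assumes "f \<in> L2"
  shows "locally_integrable f"
proof -
  have f [measurable]: "f \<in> borel_measurable borel" and i: "integrable lborel (\<lambda>x. (cmod (f x))\<^sup>2)"
    using assms by (auto simp: L2_def)
  have "set_integrable lborel {a..b} f" for a b
  proof (rule set_integrable_bound[where f = "\<lambda>x. 1 + (cmod (f x))\<^sup>2"])
    have "set_integrable lborel {a..b} (\<lambda>x. (cmod (f x))\<^sup>2)"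
      unfolding set_integrable_def using i by (intro integrable_mult_indicator) auto
    then show "set_integrable lborel {a..b} (\<lambda>x. 1 + (cmod (f x))\<^sup>2)"
      by (intro set_integral_add) (auto intro!: borel_integrable_atLeastAtMost')
    show "AE x in lborel. x \<in> {a..b} \<longrightarrow> cmod (f x) \<le> norm (1 + (cmod (f x))\<^sup>2)"
    proof (intro AE_I2 impI)
      fix x
      have "0 \<le> (cmod (f x) - 1/2)\<^sup>2" by simp
      then show "cmod (f x) \<le> norm (1 + (cmod (f x))\<^sup>2)"
        by (simp add: power2_eq_square algebra_simps)
    qed
    show "set_borel_measurable lborel {a..b} f"
      unfolding set_borel_measurable_def by measurable
  qed
  then show ?thesis by (simp add: locally_integrable_def)
qed

lemma locally_integrable_continuous:
  "continuous_on UNIV h \<Longrightarrow> locally_integrable h"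
  unfolding locally_integrable_def
  by (auto intro!: borel_measurable_continuous_onI borel_integrable_atLeastAtMost' elim: continuous_on_subset)

lemma locally_integrable_diff:
  "locally_integrable h \<Longrightarrow> locally_integrable k \<Longrightarrow> locally_integrable (\<lambda>x. h x - k x)"
  unfolding locally_integrable_def by auto

lemma test_function_integrable:
  fixes h :: "real \<Rightarrow> complex"
  assumes \<theta>: "test_function \<theta>" and h: "locally_integrable h"
  shows "integrable lborel (\<lambda>x. complex_of_real (\<theta> x) * h x)"
proof -
  have [measurable]: "h \<in> borel_measurable borel"
    using h by (simp add: locally_integrable_def)
  obtain R where R: "\<And>x. \<bar>x\<bar> > R \<Longrightarrow> \<theta> x = 0" and s: "smooth \<theta>"
    using \<theta> test_function_iff by blast
  have [measurable]: "\<theta> \<in> borel_measurable borel"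
    using s smooth_continuous borel_measurable_continuous_onI by blast
  have "compact (\<theta> ` {-R..R})"
    using s by (intro compact_continuous_image smooth_continuous) auto
  then obtain B where B: "\<And>x. x \<in> {-R..R} \<Longrightarrow> \<bar>\<theta> x\<bar> \<le> B"
    by (metis compact_imp_bounded bounded_iff imageI real_norm_def)
  have "integrable lborel (\<lambda>x. of_real B * (indicator {-R..R} x *\<^sub>R h x))"
    using h unfolding locally_integrable_def set_integrable_def
    by (intro Bochner_Integration.integrable_mult_right) blast
  then show ?thesis
  proof (rule Bochner_Integration.integrable_bound)
    show "AE x in lborel. norm (complex_of_real (\<theta> x) * h x) \<le> norm (of_real B * (indicat_real {- R..R} x *\<^sub>R h x))"
    proof (rule AE_I2)
      fix x
      show "norm (complex_of_real (\<theta> x) * h x) \<le> norm (of_real B * (indicat_real {- R..R} x *\<^sub>R h x))"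
      proof (cases "x \<in> {-R..R}")
        case True
        then have "\<bar>\<theta> x\<bar> \<le> \<bar>B\<bar>" using B[OF True] by linarith
        then show ?thesis using True by (simp add: norm_mult mult_right_mono)
      next
        case False
        then have "\<theta> x = 0" by (intro R) auto
        then show ?thesis by simp
      qed
    qed
  qed measurable
qed

lemma test_function_deriv:
  assumes "test_function \<theta>"
  shows "test_function (deriv \<theta>)"
proof -
  obtain R where R: "\<And>x. \<bar>x\<bar> > R \<Longrightarrow> \<theta> x = 0" and s: "smooth \<theta>"
    using assms test_function_iff by blast
  have "deriv \<theta> x = 0" if "\<bar>x\<bar> > R" for x
  proof -
    have "((\<lambda>x. 0) has_real_derivative 0) (at x)" by simp
    then have "(\<theta> has_real_derivative 0) (at x)"
    proof (rule has_field_derivative_transform_within_open)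
      show "open {x. \<bar>x\<bar> > R}" by (intro open_Collect_less continuous_intros)
    qed (use that R in auto)
    then show ?thesis by (rule DERIV_imp_deriv)
  qed
  then show ?thesis using s smooth_rec test_function_iff by blast
qed

section \<open>Primitives and their weak derivatives\<close>

lemma integral_deriv_test_function_ge:
  assumes "test_function \<theta>"
  shows "(LINT x|lborel. indicator {s..} x * deriv \<theta> x) = - \<theta> s"
proof -
  obtain R where R: "\<And>x. \<bar>x\<bar> > R \<Longrightarrow> \<theta> x = 0" and s: "smooth \<theta>"
    using assms test_function_iff by blast
  obtain R' where R': "\<And>x. \<bar>x\<bar> > R' \<Longrightarrow> deriv \<theta> x = 0"
    using test_function_deriv[OF assms] test_function_iff by blast
  define M where "M = \<bar>s\<bar> + \<bar>R\<bar> + \<bar>R'\<bar> + 1"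
  have "(LINT x|lborel. indicator {s..} x * deriv \<theta> x) = (LINT x|lborel. indicator {s..M} x *\<^sub>R deriv \<theta> x)"
    by (intro Bochner_Integration.integral_cong) (auto simp: indicator_def M_def intro!: R')
  also have "\<dots> = \<theta> M - \<theta> s"
  proof (rule integral_FTC_atLeastAtMost)
    show "(\<theta> has_vector_derivative deriv \<theta> x) (at x within {s..M})" for x
      using smooth_has_derivative[OF s, of x]
      by (simp add: has_real_derivative_iff_has_vector_derivative has_vector_derivative_at_within)
    show "continuous_on {s..M} (deriv \<theta>)"
      using s smooth_rec smooth_continuous by blast
  qed (simp add: M_def)
  also have "\<theta> M = 0" by (rule R) (simp add: M_def)
  finally show ?thesis by simp
qed

lemma integral_deriv_test_function:
  assumes "test_function \<theta>"
  shows "(LINT x|lborel. deriv \<theta> x) = 0"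
proof -
  obtain R where R: "\<And>x. \<bar>x\<bar> > R \<Longrightarrow> \<theta> x = 0"
    using assms test_function_iff by blast
  obtain R' where R': "\<And>x. \<bar>x\<bar> > R' \<Longrightarrow> deriv \<theta> x = 0"
    using test_function_deriv[OF assms] test_function_iff by blast
  define M where "M = \<bar>R\<bar> + \<bar>R'\<bar> + 1"
  have "(LINT x|lborel. deriv \<theta> x) = (LINT x|lborel. indicator {-M..} x * deriv \<theta> x)"
    by (intro Bochner_Integration.integral_cong) (auto simp: indicator_def M_def intro!: R')
  also have "\<dots> = - \<theta> (-M)" by (rule integral_deriv_test_function_ge[OF assms])
  also have "\<theta> (-M) = 0" by (rule R) (simp add: M_def)
  finally show ?thesis by simp
qed

text \<open>Fubini on the half plane \<open>s <= x\<close>: integrating over \<open>s\<close> first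
  produces the primitive, integrating over \<open>x\<close> first produces
  \<open>- \<theta> s\<close>, because \<open>\<theta>\<close> vanishes far to the right.\<close>

lemma weak_derivative_primitive:
  fixes g :: "real \<Rightarrow> complex"
  assumes g: "integrable lborel g" and \<theta>: "test_function \<theta>"
  shows "(LINT x|lborel. complex_of_real (deriv \<theta> x) * (LINT s:{..x}|lborel. g s)) =
    - (LINT s|lborel. complex_of_real (\<theta> s) * g s)"
proof -
  have \<theta>': "test_function (deriv \<theta>)" by (rule test_function_deriv[OF \<theta>])
  have 1: "locally_integrable (\<lambda>x. 1 :: complex)"
    by (intro locally_integrable_continuous continuous_intros)
  have [measurable]: "g \<in> borel_measurable borel"
    using g by auto
  have [measurable]: "deriv \<theta> \<in> borel_measurable borel"
    using \<theta>' test_function_iff smooth_continuous borel_measurable_continuous_onI by blast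
  have d: "integrable lborel (deriv \<theta>)"
    using test_function_integrable[OF \<theta>' 1] by (simp add: complex_of_real_integrable_eq)
  define k where "k = (\<lambda>x s. complex_of_real (deriv \<theta> x) * (indicator {..x} s *\<^sub>R g s))"
  have k_meas: "case_prod k \<in> borel_measurable (lborel \<Otimes>\<^sub>M lborel)"
  proof -
    have "case_prod k = (\<lambda>p. complex_of_real (deriv \<theta> (fst p)) *
        ((if snd p \<le> fst p then 1 else 0) *\<^sub>R g (snd p)))"
      by (auto simp: k_def indicator_def fun_eq_iff)
    then show ?thesis by simp
  qed
  have int: "integrable lborel (\<lambda>s. indicator {..x} s *\<^sub>R g s)" for x
    using g by (intro integrable_mult_indicator) auto
  have "integrable (lborel \<Otimes>\<^sub>M lborel) (case_prod k)"
  proof (rule lborel_pair.Fubini_integrable[OF k_meas])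
    show "AE x in lborel. integrable lborel (\<lambda>s. case_prod k (x, s))"
      unfolding k_def case_prod_conv by (intro AE_I2 integrable_mult_right int)
    have "integrable lborel (\<lambda>x. \<bar>deriv \<theta> x\<bar> * (LINT s|lborel. norm (g s)))"
      using d by auto
    then show "integrable lborel (\<lambda>x. LINT s|lborel. norm (case_prod k (x, s)))"
    proof (rule Bochner_Integration.integrable_bound)
      show "(\<lambda>x. LINT s|lborel. norm (case_prod k (x, s))) \<in> borel_measurable lborel"
        using k_meas by measurable
      show "AE x in lborel. norm (LINT s|lborel. norm (case_prod k (x, s)))
          \<le> norm (\<bar>deriv \<theta> x\<bar> * (LINT s|lborel. norm (g s)))"
      proof (rule AE_I2)
        fix x
        have "(LINT s|lborel. norm (k x s)) = \<bar>deriv \<theta> x\<bar> * (LINT s|lborel. norm (indicator {..x} s *\<^sub>R g s))"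
          by (simp add: k_def norm_mult mult.left_commute[of _ "\<bar>deriv \<theta> x\<bar>"])
        also have "\<dots> \<le> \<bar>deriv \<theta> x\<bar> * (LINT s|lborel. norm (g s))"
          by (intro mult_left_mono integral_mono integrable_norm int g) (auto simp: indicator_def)
        finally show "norm (LINT s|lborel. norm (case_prod k (x, s)))
          \<le> norm (\<bar>deriv \<theta> x\<bar> * (LINT s|lborel. norm (g s)))"
          by (simp add: abs_mult)
      qed
    qed
  qed
  then have "(LINT s|lborel. LINT x|lborel. k x s) = (LINT x|lborel. LINT s|lborel. k x s)"
    by (rule lborel_pair.Fubini_integral)
  moreover have "(LINT s|lborel. k x s) = complex_of_real (deriv \<theta> x) * (LINT s:{..x}|lborel. g s)" for x
    unfolding k_def set_lebesgue_integral_def by (rule integral_mult_right_zero)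
  moreover have "(LINT x|lborel. k x s) = - (complex_of_real (\<theta> s) * g s)" for s
  proof -
    have "(LINT x|lborel. k x s) = (LINT x|lborel. complex_of_real (indicator {s..} x * deriv \<theta> x) * g s)"
      by (intro Bochner_Integration.integral_cong) (auto simp: k_def indicator_def)
    also have "\<dots> = complex_of_real (LINT x|lborel. indicator {s..} x * deriv \<theta> x) * g s"
      by (simp only: integral_mult_left_zero integral_complex_of_real)
    finally show ?thesis
      using integral_deriv_test_function_ge[OF \<theta>] by simp
  qed
  ultimately show ?thesis by simp
qed

lemma primitive_continuous:
  fixes g :: "real \<Rightarrow> complex"
  assumes g: "locally_integrable g" and G: "\<And>x y. x \<le> y \<Longrightarrow> G y - G x = (LINT s:{x..y}|lborel. g s)"
  shows "continuous_on UNIV G"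
proof (intro continuous_at_imp_continuous_on ballI)
  fix x :: real
  have i: "set_integrable lborel {x-1..y} g" for y
    using g by (simp add: locally_integrable_def)
  have "continuous_on {x-1..x+1} (\<lambda>y. G (x - 1) + integral {x-1..y} g)"
    using set_borel_integral_eq_integral(1)[OF i]
    by (intro continuous_intros indefinite_integral_continuous_1) auto
  moreover have "G (x - 1) + integral {x-1..y} g = G y" if "y \<in> {x-1..x+1}" for y
    using G[of "x-1" y] that set_borel_integral_eq_integral(2)[OF i, of y] by (simp add: algebra_simps)
  ultimately have "continuous_on {x-1..x+1} G"
    by (rule continuous_on_eq)
  then show "isCont G x"
    by (rule continuous_on_interior) auto
qed

lemma primitive_exists:
  fixes g :: "real \<Rightarrow> complex"
  assumes g: "locally_integrable g"
  obtains G where "\<And>x y. x \<le> y \<Longrightarrow> G y - G x = (LINT s:{x..y}|lborel. g s)"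
proof
  \<comment> \<open>An oriented integral from 0 has the right increments for all signs of
    \<open>x\<close> and \<open>y\<close>. A primitive from minus infinity need not exist, as
    \<open>g\<close> is only locally integrable.\<close>
  define G where "G = (\<lambda>x. LBINT s=ereal 0..ereal x. g s)"
  fix x y :: real assume xy: "x \<le> y"
  have "interval_lebesgue_integrable lborel (min 0 (min (ereal x) y)) (max 0 (max (ereal x) y)) g"
  proof -
    have "set_integrable lborel {min 0 x<..<max 0 y} g"
      by (rule locally_integrable_subset[OF g, of _ "min 0 x" "max 0 y"]) auto
    moreover have "min 0 (min (ereal x) y) = ereal (min 0 x)" "max 0 (max (ereal x) y) = ereal (max 0 y)"
      using xy by (auto simp: min_def max_def)
    ultimately show ?thesis
      unfolding interval_lebesgue_integrable_def by (simp only: einterval_eq) auto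
  qed
  then have "(LBINT s=ereal 0..ereal x. g s) + (LBINT s=ereal x..ereal y. g s) = (LBINT s=ereal 0..ereal y. g s)"
    by (intro interval_integral_sum) (simp add: zero_ereal_def)
  then have "G y - G x = (LBINT s=ereal x..ereal y. g s)"
    by (simp add: G_def algebra_simps)
  then show "(LBINT s=ereal 0..ereal y. g s) - (LBINT s=ereal 0..ereal x. g s) = (LINT s:{x..y}|lborel. g s)"
    using xy by (simp add: G_def interval_integral_Icc)
qed

text \<open>Outside \<open>[-R, R]\<close> both \<open>\<theta>\<close> and its derivative vanish,
  so \<open>g\<close> may be cut off there and becomes integrable. The constant
  \<open>G (-R)\<close> by which \<open>G\<close> differs from the primitive of the truncation is
  invisible, because \<open>deriv \<theta>\<close> has integral zero.\<close>

lemma weak_derivative_locally_integrable_primitive: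
  fixes g :: "real \<Rightarrow> complex"
  assumes g: "locally_integrable g" and G: "\<And>x y. x \<le> y \<Longrightarrow> G y - G x = (LINT s:{x..y}|lborel. g s)"
    and \<theta>: "test_function \<theta>"
  shows "(LINT x|lborel. complex_of_real (deriv \<theta> x) * G x) = - (LINT s|lborel. complex_of_real (\<theta> s) * g s)"
proof -
  have \<theta>': "test_function (deriv \<theta>)" by (rule test_function_deriv[OF \<theta>])
  have 1: "locally_integrable (\<lambda>x. c :: complex)" for c
    by (intro locally_integrable_continuous continuous_intros)
  have Gc: "locally_integrable G"
    using primitive_continuous[OF g G] locally_integrable_continuous by blast
  obtain R1 where R1: "\<And>x. \<bar>x\<bar> > R1 \<Longrightarrow> \<theta> x = 0" using \<theta> test_function_iff by blast
  obtain R2 where R2: "\<And>x. \<bar>x\<bar> > R2 \<Longrightarrow> deriv \<theta> x = 0" using \<theta>' test_function_iff by blast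
  define R where "R = \<bar>R1\<bar> + \<bar>R2\<bar>"
  define gR where "gR = (\<lambda>s. indicator {-R..R} s *\<^sub>R g s)"
  have gR: "integrable lborel gR"
    using g by (simp add: locally_integrable_def set_integrable_def gR_def)
  have "(LINT x|lborel. complex_of_real (deriv \<theta> x) * G x) =
      (LINT x|lborel. complex_of_real (deriv \<theta> x) * G x) - (LINT x|lborel. complex_of_real (deriv \<theta> x)) * G (-R)"
    using integral_deriv_test_function[OF \<theta>] by (simp add: integral_complex_of_real)
  also have "\<dots> = (LINT x|lborel. complex_of_real (deriv \<theta> x) * G x - complex_of_real (deriv \<theta> x) * G (-R))"
    using test_function_integrable[OF \<theta>' Gc] test_function_integrable[OF \<theta>' 1[of "G (-R)"]] by simp
  also have "\<dots> = (LINT x|lborel. complex_of_real (deriv \<theta> x) * (LINT s:{..x}|lborel. gR s))"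
  proof (intro Bochner_Integration.integral_cong refl)
    fix x
    show "complex_of_real (deriv \<theta> x) * G x - complex_of_real (deriv \<theta> x) * G (-R) =
      complex_of_real (deriv \<theta> x) * (LINT s:{..x}|lborel. gR s)"
    proof (cases "\<bar>x\<bar> \<le> R")
      case True
      then have "G x - G (-R) = (LINT s:{-R..x}|lborel. g s)"
        using G[of "-R" x] by simp
      also have "\<dots> = (LINT s:{..x}|lborel. gR s)"
        unfolding set_lebesgue_integral_def gR_def
        by (intro Bochner_Integration.integral_cong refl) (use True in \<open>auto simp: indicator_def\<close>)
      finally show ?thesis by (simp add: right_diff_distrib[symmetric])
    next
      case False
      then show ?thesis using R2[of x] by (simp add: R_def)
    qed
  qed
  also have "\<dots> = - (LINT s|lborel. complex_of_real (\<theta> s) * gR s)"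
    by (rule weak_derivative_primitive[OF gR \<theta>])
  also have "(LINT s|lborel. complex_of_real (\<theta> s) * gR s) = (LINT s|lborel. complex_of_real (\<theta> s) * g s)"
  proof (intro Bochner_Integration.integral_cong refl)
    fix s
    show "complex_of_real (\<theta> s) * gR s = complex_of_real (\<theta> s) * g s"
      using R1[of s] by (cases "\<bar>s\<bar> \<le> R") (auto simp: gR_def R_def indicator_def)
  qed
  finally show ?thesis .
qed

lemma test_function_antiderivative:
  assumes \<theta>: "test_function \<theta>" and 0: "(LINT x|lborel. \<theta> x) = 0"
  obtains \<Theta> where "test_function \<Theta>" "deriv \<Theta> = \<theta>"
proof -
  obtain R where R: "\<And>x. \<bar>x\<bar> > R \<Longrightarrow> \<theta> x = 0" and s: "smooth \<theta>" using \<theta> test_function_iff by blast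
  define M where "M = \<bar>R\<bar> + 1"
  have M: "\<theta> x = 0" if "\<bar>x\<bar> \<ge> M" for x using R that by (simp add: M_def)
  then have M': "\<bar>x\<bar> < M" if "\<theta> x \<noteq> 0" for x using that not_le by blast
  \<comment> \<open>The base point lies one unit to the left of \<open>-M\<close>, so that
    \<open>-M\<close> is an interior point at which the fundamental theorem gives a two-sided
    derivative. To the right of the support the vanishing total integral makes the primitive zero
    again.\<close>
  define \<Theta> where "\<Theta> = (\<lambda>x. integral {-M-1..x} \<theta>)"
  have \<Theta>0: "\<Theta> x = 0" if "x \<le> -M" for x
  proof -
    have "\<Theta> x = integral {-M-1..x} (\<lambda>x. 0)"
      unfolding \<Theta>_def by (rule integral_cong) (use M that in auto)
    then show ?thesis by simp
  qed
  have D: "(\<Theta> has_real_derivative \<theta> x) (at x)" for x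
  proof (cases "x < -M")
    case True
    have "((\<lambda>x. 0) has_real_derivative \<theta> x) (at x)"
      using M[of x] True by (simp add: M_def)
    then show ?thesis
      by (rule has_field_derivative_transform_within_open[where S = "{..<-M}"])
        (use \<Theta>0 True in auto)
  next
    case False
    have "(\<Theta> has_vector_derivative \<theta> x) (at x within {-M-1..x+1})"
      unfolding \<Theta>_def using False by (intro integral_has_vector_derivative smooth_continuous s) auto
    then have "(\<Theta> has_real_derivative \<theta> x) (at x within {-M-1<..<x+1})"
      unfolding has_real_derivative_iff_has_vector_derivative
      by (rule has_vector_derivative_within_subset) auto
    then show ?thesis
      using False by (simp add: at_within_open[of x "{-M-1<..<x+1}"])
  qed
  have d: "deriv \<Theta> = \<theta>" using D DERIV_imp_deriv by blast
  have "smooth \<Theta>"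
    unfolding smooth_rec[of \<Theta>] d using D s field_differentiable_def by blast
  moreover have "\<Theta> x = 0" if "\<bar>x\<bar> > M" for x
  proof (cases "x < 0")
    case False
    have "(LINT s|lborel. \<theta> s) = (LINT s:{-M-1..x}|lborel. \<theta> s)"
      unfolding set_lebesgue_integral_def
      by (intro Bochner_Integration.integral_cong refl) (use M' that False in \<open>force simp: indicator_def\<close>)
    also have "\<dots> = \<Theta> x"
      unfolding \<Theta>_def by (intro set_borel_integral_eq_integral borel_integrable_atLeastAtMost' smooth_continuous s)
    finally show ?thesis using 0 by simp
  qed (use that \<Theta>0 in auto)
  ultimately show ?thesis using that d test_function_iff by blast
qed

lemma test_function_add_scaled:
  assumes "test_function \<theta>" "test_function \<kappa>"
  shows "test_function (\<lambda>x. \<theta> x + c * \<kappa> x)"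
proof -
  obtain R where R: "\<And>x. \<bar>x\<bar> > R \<Longrightarrow> \<theta> x = 0" and s: "smooth \<theta>" using assms test_function_iff by blast
  obtain R' where R': "\<And>x. \<bar>x\<bar> > R' \<Longrightarrow> \<kappa> x = 0" and s': "smooth \<kappa>" using assms test_function_iff by blast
  have "smooth (\<lambda>x. \<theta> x + c * \<kappa> x)"
    by (intro smooth_add smooth_mult smooth_const s s')
  moreover have "\<theta> x + c * \<kappa> x = 0" if "\<bar>x\<bar> > max R R'" for x
    using R R' that by simp
  ultimately show ?thesis using test_function_iff by blast
qed

lemma test_function_real_integrable:
  assumes "test_function \<theta>"
  shows "integrable lborel \<theta>"
proof -
  have "locally_integrable (\<lambda>x. 1 :: complex)"
    by (intro locally_integrable_continuous continuous_intros)
  from test_function_integrable[OF assms this] show ?thesis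
    by (simp add: complex_of_real_integrable_eq)
qed

text \<open>The argument of du Bois-Reymond: \<open>h\<close> annihilates test functions of mean
  zero, and a multiple of one fixed \<open>\<kappa>\<close> with nonzero mean brings any test
  function to mean zero. The constant is the average of \<open>h\<close> weighted by
  \<open>\<kappa>\<close>.\<close>

lemma constant_if_weak_derivative_zero:
  fixes h :: "real \<Rightarrow> complex"
  assumes h: "locally_integrable h"
    and 0: "\<And>\<theta>. test_function \<theta> \<Longrightarrow> (LINT x|lborel. complex_of_real (deriv \<theta> x) * h x) = 0"
  obtains c where "AE x in lborel. h x = c"
proof -
  have *: "(LINT x|lborel. complex_of_real (\<theta> x) * h x) = 0"
    if \<theta>: "test_function \<theta>" and "(LINT x|lborel. \<theta> x) = 0" for \<theta>
    by (rule test_function_antiderivative[OF that]) (use 0 in auto)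
  show ?thesis
  \<comment> \<open>If every test function had mean zero, the fundamental lemma would apply at once;
    the case distinction spares the construction of a particular \<open>\<kappa>\<close>.\<close>
  proof (cases "\<exists>\<kappa>. test_function \<kappa> \<and> (LINT x|lborel. \<kappa> x) \<noteq> 0")
    case False
    then have "AE x in lborel. h x = 0"
      using * by (intro fundamental_lemma[OF h]) blast
    then show ?thesis by (rule that)
  next
    case True
    then obtain \<kappa> where \<kappa>: "test_function \<kappa>" and k: "(LINT x|lborel. \<kappa> x) \<noteq> 0" by blast
    define c where "c = (LINT x|lborel. complex_of_real (\<kappa> x) * h x) / complex_of_real (LINT x|lborel. \<kappa> x)"
    have ch: "locally_integrable (\<lambda>x. c)"
      by (intro locally_integrable_continuous continuous_intros)
    have "AE x in lborel. h x - c = 0"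
    proof (rule fundamental_lemma)
      show "locally_integrable (\<lambda>x. h x - c)"
        by (intro locally_integrable_diff h ch)
      fix \<theta> assume \<theta>: "test_function \<theta>"
      define e where "e = - (LINT x|lborel. \<theta> x) / (LINT x|lborel. \<kappa> x)"
      have "(LINT x|lborel. \<theta> x + e * \<kappa> x) = 0"
        using test_function_real_integrable[OF \<theta>] test_function_real_integrable[OF \<kappa>] k
        by (simp add: e_def)
      then have "0 = (LINT x|lborel. complex_of_real (\<theta> x + e * \<kappa> x) * h x)"
        using *[OF test_function_add_scaled[OF \<theta> \<kappa>]] by simp
      also have "\<dots> = (LINT x|lborel. complex_of_real (\<theta> x) * h x + complex_of_real e * (complex_of_real (\<kappa> x) * h x))"
        by (simp add: algebra_simps)
      also have "\<dots> = (LINT x|lborel. complex_of_real (\<theta> x) * h x) + complex_of_real e * (LINT x|lborel. complex_of_real (\<kappa> x) * h x)"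
        using test_function_integrable[OF \<theta> h] test_function_integrable[OF \<kappa> h] by simp
      also have "complex_of_real e * (LINT x|lborel. complex_of_real (\<kappa> x) * h x) = - c * (LINT x|lborel. \<theta> x)"
        using k by (simp add: c_def e_def field_simps)
      also have "\<dots> = - (LINT x|lborel. complex_of_real (\<theta> x) * c)"
        using integral_mult_left_zero[of lborel "\<lambda>x. complex_of_real (\<theta> x)" c]
        by (simp add: integral_complex_of_real mult.commute)
      finally have "(LINT x|lborel. complex_of_real (\<theta> x) * h x) = (LINT x|lborel. complex_of_real (\<theta> x) * c)"
        by simp
      then show "(LINT x|lborel. complex_of_real (\<theta> x) * (h x - c)) = 0"
        using test_function_integrable[OF \<theta> h] test_function_integrable[OF \<theta> ch]
        unfolding right_diff_distrib by (subst Bochner_Integration.integral_diff) auto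
    qed
    then show ?thesis using that[of c] by simp
  qed
qed

section \<open>Continuous representatives of weakly differentiable functions\<close>

lemma ddx_locally_integrable:
  "(f, g) \<in> ddx \<Longrightarrow> locally_integrable f \<and> locally_integrable g"
  by (auto simp: ddx_def intro: L2_locally_integrable)

text \<open>\<open>f\<close> and a primitive of \<open>g\<close> have the same weak derivative, so
  they differ by a constant almost everywhere.\<close>

lemma ddx_primitive:
  assumes "(f, g) \<in> ddx"
  obtains F where "continuous_on UNIV F" "AE x in lborel. F x = f x"
    "\<And>x y. x \<le> y \<Longrightarrow> F y - F x = (LINT s:{x..y}|lborel. g s)"
proof -
  have f: "locally_integrable f" and g: "locally_integrable g"
    using ddx_locally_integrable[OF assms] by auto
  obtain G where G: "\<And>x y. x \<le> y \<Longrightarrow> G y - G x = (LINT s:{x..y}|lborel. g s)"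
    using primitive_exists[OF g] by blast
  have Gc: "continuous_on UNIV G" by (rule primitive_continuous[OF g G])
  have G': "locally_integrable G" by (rule locally_integrable_continuous[OF Gc])
  obtain c where c: "AE x in lborel. f x - G x = c"
  proof (rule constant_if_weak_derivative_zero)
    show "locally_integrable (\<lambda>x. f x - G x)"
      by (intro locally_integrable_diff f G')
    fix \<theta> assume \<theta>: "test_function \<theta>"
    have "(LINT x|lborel. complex_of_real (deriv \<theta> x) * (f x - G x)) =
        (LINT x|lborel. complex_of_real (deriv \<theta> x) * f x) - (LINT x|lborel. complex_of_real (deriv \<theta> x) * G x)"
      using test_function_integrable[OF test_function_deriv[OF \<theta>] f]
        test_function_integrable[OF test_function_deriv[OF \<theta>] G']
      unfolding right_diff_distrib by (rule Bochner_Integration.integral_diff)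
    also have "\<dots> = 0"
      using assms \<theta> weak_derivative_locally_integrable_primitive[OF g G \<theta>] by (simp add: ddx_def)
    finally show "(LINT x|lborel. complex_of_real (deriv \<theta> x) * (f x - G x)) = 0" .
  qed
  show ?thesis
  proof (rule that[of "\<lambda>x. G x + c"])
    show "continuous_on UNIV (\<lambda>x. G x + c)" by (intro continuous_intros Gc)
    show "AE x in lborel. G x + c = f x" using c by eventually_elim (simp add: algebra_simps)
  qed (use G in simp)
qed

text \<open>The graph \<open>ddx\<close> is single valued on classes only. This identifies
  derivatives that \<open>helmholtz b\<close> and \<open>op_J\<close> choose independently of each
  other.\<close>

lemma ddx_unique:
  assumes "(f, g) \<in> ddx" "(f', g') \<in> ddx" and ff': "AE x in lborel. f x = f' x"
  shows "AE x in lborel. g x = g' x"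
proof -
  have g: "locally_integrable g" "locally_integrable g'"
    using ddx_locally_integrable assms by auto
  have [measurable]: "f \<in> borel_measurable borel" "f' \<in> borel_measurable borel"
    using assms by (auto simp: ddx_def L2_def)
  have "AE x in lborel. g x - g' x = 0"
  proof (rule fundamental_lemma)
    show "locally_integrable (\<lambda>x. g x - g' x)" by (intro locally_integrable_diff g)
    fix \<theta> assume \<theta>: "test_function \<theta>"
    have [measurable]: "deriv \<theta> \<in> borel_measurable borel"
      using test_function_real_integrable[OF test_function_deriv[OF \<theta>]] by auto
    have "(LINT x|lborel. complex_of_real (\<theta> x) * (g x - g' x)) =
        (LINT x|lborel. complex_of_real (\<theta> x) * g x) - (LINT x|lborel. complex_of_real (\<theta> x) * g' x)"
      using test_function_integrable[OF \<theta> g(1)] test_function_integrable[OF \<theta> g(2)]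
      unfolding right_diff_distrib by (rule Bochner_Integration.integral_diff)
    also have "\<dots> = (LINT x|lborel. complex_of_real (deriv \<theta> x) * f' x) - (LINT x|lborel. complex_of_real (deriv \<theta> x) * f x)"
      using assms \<theta> by (simp add: ddx_def)
    also have "(LINT x|lborel. complex_of_real (deriv \<theta> x) * f' x) = (LINT x|lborel. complex_of_real (deriv \<theta> x) * f x)"
      using ff' by (intro integral_cong_AE) (auto elim!: eventually_mono)
    finally show "(LINT x|lborel. complex_of_real (\<theta> x) * (g x - g' x)) = 0" by simp
  qed
  then show ?thesis by simp
qed

lemma L2_scale:
  assumes "f \<in> L2"
  shows "(\<lambda>x. c * f x) \<in> L2"
  using assms by (auto simp: L2_def norm_mult power_mult_distrib)

lemma ddx_scale:
  assumes "(f, g) \<in> ddx"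
  shows "(\<lambda>x. c * f x, \<lambda>x. c * g x) \<in> ddx"
proof -
  have "(LINT x|lborel. complex_of_real (\<theta> x) * (c * h x)) = c * (LINT x|lborel. complex_of_real (\<theta> x) * h x)"
    for \<theta> :: "real \<Rightarrow> real" and h
    unfolding mult.left_commute[of _ c] by (rule integral_mult_right_zero)
  then show ?thesis using assms by (auto simp: ddx_def L2_scale)
qed

text \<open>A continuous representative of the derivative may replace \<open>g\<close> in the
  increment formula, and the fundamental theorem of calculus then gives a derivative at every
  point.\<close>

lemma ddx_classical:
  assumes fg: "(f, g) \<in> ddx" and G: "continuous_on UNIV G" "AE x in lborel. G x = g x"
  obtains F where "\<And>x. (F has_vector_derivative G x) (at x)" "AE x in lborel. F x = f x"
proof -
  obtain F where F: "continuous_on UNIV F" "AE x in lborel. F x = f x"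
    "\<And>x y. x \<le> y \<Longrightarrow> F y - F x = (LINT s:{x..y}|lborel. g s)"
    using ddx_primitive[OF fg] by blast
  have [measurable]: "g \<in> borel_measurable borel" "G \<in> borel_measurable borel"
    using fg borel_measurable_continuous_onI[OF G(1)] by (auto simp: ddx_def L2_def)
  have "(F has_vector_derivative G x) (at x)" for x
  proof -
    have inc: "F (x - 1) + integral {x-1..y} G = F y" if "y \<in> {x-1..x+1}" for y
    proof -
      have "(LINT s:{x-1..y}|lborel. g s) = (LINT s:{x-1..y}|lborel. G s)"
        using G(2) by (intro set_lebesgue_integral_cong_AE) (auto elim!: eventually_mono)
      also have "\<dots> = integral {x-1..y} G"
        by (intro set_borel_integral_eq_integral borel_integrable_atLeastAtMost' continuous_on_subset[OF G(1)]) auto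
      finally have "F y - F (x - 1) = integral {x-1..y} G"
        using F(3)[of "x-1" y] that by simp
      then show ?thesis by (simp add: algebra_simps)
    qed
    have "((\<lambda>y. F (x - 1) + integral {x-1..y} G) has_vector_derivative 0 + G x) (at x within {x-1..x+1})"
      by (intro has_vector_derivative_add has_vector_derivative_const integral_has_vector_derivative
          continuous_on_subset[OF G(1)]) auto
    then have "(F has_vector_derivative G x) (at x within {x-1..x+1})"
      using inc by (intro has_vector_derivative_transform[of x "{x-1..x+1}" F "\<lambda>y. F (x - 1) + integral {x-1..y} G"]) auto
    then have "(F has_vector_derivative G x) (at x within {x-1<..<x+1})"
      by (rule has_vector_derivative_within_subset) auto
    then show ?thesis
      by (simp add: at_within_open[of x "{x-1<..<x+1}"])
  qed
  then show ?thesis using that F(2) by blast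
qed

text \<open>The set where the two functions differ is open, and an open null set is empty.\<close>

lemma continuous_AE_eq_imp_eq:
  fixes F G :: "real \<Rightarrow> complex"
  assumes "continuous_on UNIV F" "continuous_on UNIV G" "AE x in lborel. F x = G x"
  shows "F = G"
proof -
  have o: "open {x. F x \<noteq> G x}"
    using assms by (intro open_Collect_neq)
  have "{x. F x \<noteq> G x} \<in> null_sets lborel"
    using AE_iff_null_sets[of "{x. F x \<noteq> G x}" lborel] o assms(3) by simp
  then have "negligible {x. F x \<noteq> G x}"
    unfolding negligible_iff_null_sets by (rule null_sets_completionI)
  then show ?thesis using open_not_negligible[OF o] by blast
qed

subsection \<open>Continuously differentiable square integrable functions\<close>

text \<open>The class constraints admit both \<open>real\<close> and \<open>complex\<close>:
  eigenfunctions are complex, while the quadratic forms are studied on real and imaginary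
  parts.\<close>

definition L2_continuous :: "(real \<Rightarrow> 'a :: {euclidean_space, real_normed_field}) \<Rightarrow> bool" where
  "L2_continuous f \<longleftrightarrow> continuous_on UNIV f \<and> integrable lborel (\<lambda>x. (norm (f x))\<^sup>2)"

definition classical_H1 ::
  "(real \<Rightarrow> 'a :: {euclidean_space, real_normed_field}) \<Rightarrow> (real \<Rightarrow> 'a) \<Rightarrow> bool" where
  "classical_H1 f f' \<longleftrightarrow>
     (\<forall>x. (f has_vector_derivative f' x) (at x)) \<and> L2_continuous f \<and> L2_continuous f'"

lemma classical_H1_D:
  assumes "classical_H1 f f'"
  shows "(f has_vector_derivative f' x) (at x)" "L2_continuous f" "L2_continuous f'"
    "continuous_on UNIV f" "continuous_on UNIV f'"
  using assms by (auto simp: classical_H1_def L2_continuous_def)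

lemma L2_continuous_measurable: "L2_continuous f \<Longrightarrow> f \<in> borel_measurable borel"
  by (simp add: L2_continuous_def borel_measurable_continuous_onI)

lemma L2_continuous_mult_integrable:
  assumes f: "L2_continuous f" and g: "L2_continuous g"
  shows "integrable lborel (\<lambda>x. f x * g x)"
proof (rule Bochner_Integration.integrable_bound)
  show "integrable lborel (\<lambda>x. (norm (f x))\<^sup>2 + (norm (g x))\<^sup>2)"
    using assms by (simp add: L2_continuous_def)
  show "(\<lambda>x. f x * g x) \<in> borel_measurable lborel"
    using assms[THEN L2_continuous_measurable] by simp
  show "AE x in lborel. norm (f x * g x) \<le> norm ((norm (f x))\<^sup>2 + (norm (g x))\<^sup>2)"
  proof (rule AE_I2)
    fix x
    have "2 * (norm (f x) * norm (g x)) \<le> (norm (f x))\<^sup>2 + (norm (g x))\<^sup>2"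
      using sum_squares_bound[of "norm (f x)" "norm (g x)"] by (simp add: mult_ac)
    then show "norm (f x * g x) \<le> norm ((norm (f x))\<^sup>2 + (norm (g x))\<^sup>2)"
      by (simp add: norm_mult order_trans[rotated])
  qed
qed

lemma L2_continuous_mult_bounded:
  assumes f: "L2_continuous f" and g: "continuous_on UNIV g" "\<And>x. norm (g x) \<le> B"
  shows "L2_continuous (\<lambda>x. g x * f x)"
  unfolding L2_continuous_def
proof
  show c: "continuous_on UNIV (\<lambda>x. g x * f x)"
    using assms by (intro continuous_intros) (auto simp: L2_continuous_def)
  have i: "integrable lborel (\<lambda>x. B\<^sup>2 * (norm (f x))\<^sup>2)"
    using f by (simp add: L2_continuous_def)
  show "integrable lborel (\<lambda>x. (norm (g x * f x))\<^sup>2)"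
  proof (rule Bochner_Integration.integrable_bound[OF i])
    have [measurable]: "(\<lambda>x. g x * f x) \<in> borel_measurable borel"
      using c by (rule borel_measurable_continuous_onI)
    show "(\<lambda>x. (norm (g x * f x))\<^sup>2) \<in> borel_measurable lborel" by simp
    show "AE x in lborel. norm ((norm (g x * f x))\<^sup>2) \<le> norm (B\<^sup>2 * (norm (f x))\<^sup>2)"
      using g(2) by (auto intro!: AE_I2 mult_right_mono power_mono simp: norm_mult power_mult_distrib)
  qed
qed

lemma L2_continuous_scale: "L2_continuous f \<Longrightarrow> L2_continuous (\<lambda>x. c * f x)"
  by (rule L2_continuous_mult_bounded[where B = "norm c"]) auto

lemma L2_continuous_add:
  assumes f: "L2_continuous f" and g: "L2_continuous g"
  shows "L2_continuous (\<lambda>x. f x + g x)"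
  unfolding L2_continuous_def
proof
  show c: "continuous_on UNIV (\<lambda>x. f x + g x)"
    using assms by (intro continuous_intros) (auto simp: L2_continuous_def)
  have i: "integrable lborel (\<lambda>x. 2 * ((norm (f x))\<^sup>2 + (norm (g x))\<^sup>2))"
    using assms by (simp add: L2_continuous_def)
  show "integrable lborel (\<lambda>x. (norm (f x + g x))\<^sup>2)"
  proof (rule Bochner_Integration.integrable_bound[OF i])
    have [measurable]: "(\<lambda>x. f x + g x) \<in> borel_measurable borel"
      using c by (rule borel_measurable_continuous_onI)
    show "(\<lambda>x. (norm (f x + g x))\<^sup>2) \<in> borel_measurable lborel" by simp
    show "AE x in lborel. norm ((norm (f x + g x))\<^sup>2) \<le> norm (2 * ((norm (f x))\<^sup>2 + (norm (g x))\<^sup>2))"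
    proof (rule AE_I2)
      fix x
      have "(norm (f x + g x))\<^sup>2 \<le> (norm (f x) + norm (g x))\<^sup>2"
        by (intro power_mono norm_triangle_ineq) auto
      also have "\<dots> \<le> 2 * ((norm (f x))\<^sup>2 + (norm (g x))\<^sup>2)"
        using sum_squares_bound[of "norm (f x)" "norm (g x)"] by (simp add: power2_sum)
      finally show "norm ((norm (f x + g x))\<^sup>2) \<le> norm (2 * ((norm (f x))\<^sup>2 + (norm (g x))\<^sup>2))"
        by simp
    qed
  qed
qed

lemma L2_continuous_diff:
  "L2_continuous f \<Longrightarrow> L2_continuous g \<Longrightarrow> L2_continuous (\<lambda>x. f x - g x)"
  using L2_continuous_add[of f "\<lambda>x. (-1) * g x"] L2_continuous_scale[of g "-1"] by simp

lemma L2_continuous_Re_Im: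
  assumes "L2_continuous f"
  shows "L2_continuous (\<lambda>x. Re (f x))" "L2_continuous (\<lambda>x. Im (f x))"
proof -
  have c: "continuous_on UNIV f" and i: "integrable lborel (\<lambda>x. (cmod (f x))\<^sup>2)"
    using assms by (auto simp: L2_continuous_def)
  note [measurable] = borel_measurable_continuous_onI[OF c]
  have "integrable lborel (\<lambda>x. (Re (f x))\<^sup>2)" "integrable lborel (\<lambda>x. (Im (f x))\<^sup>2)"
    by (rule Bochner_Integration.integrable_bound[OF i]; (simp add: cmod_power2 AE_I2))+
  then show "L2_continuous (\<lambda>x. Re (f x))" "L2_continuous (\<lambda>x. Im (f x))"
    using c by (simp_all add: L2_continuous_def continuous_on_Re continuous_on_Im)
qed

lemma classical_H1_add:
  "classical_H1 f f' \<Longrightarrow> classical_H1 g g' \<Longrightarrow> classical_H1 (\<lambda>x. f x + g x) (\<lambda>x. f' x + g' x)"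
  by (auto simp: classical_H1_def intro!: has_vector_derivative_add L2_continuous_add)

lemma classical_H1_diff:
  "classical_H1 f f' \<Longrightarrow> classical_H1 g g' \<Longrightarrow> classical_H1 (\<lambda>x. f x - g x) (\<lambda>x. f' x - g' x)"
  by (auto simp: classical_H1_def intro!: has_vector_derivative_diff L2_continuous_diff)

lemma classical_H1_scale:
  "classical_H1 f f' \<Longrightarrow> classical_H1 (\<lambda>x. c * f x) (\<lambda>x. c * f' x)"
  by (auto simp: classical_H1_def intro!: L2_continuous_scale has_vector_derivative_mult_right)

lemma classical_H1_Re_Im:
  assumes "classical_H1 f f'"
  shows "classical_H1 (\<lambda>x. Re (f x)) (\<lambda>x. Re (f' x))" "classical_H1 (\<lambda>x. Im (f x)) (\<lambda>x. Im (f' x))"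
  using assms by (auto simp: classical_H1_def L2_continuous_Re_Im
      intro: bounded_linear.has_vector_derivative[OF bounded_linear_Re]
        bounded_linear.has_vector_derivative[OF bounded_linear_Im])

section \<open>Vanishing at infinity and integration by parts on the line\<close>

lemma integrable_tendsto_0_at_top:
  fixes F :: "real \<Rightarrow> 'a :: euclidean_space"
  assumes D: "\<And>x. (F has_vector_derivative F' x) (at x)" and c: "continuous_on UNIV F'"
    and i: "integrable lborel F" "integrable lborel F'"
  shows "(F \<longlongrightarrow> 0) at_top"
proof -
  have Fx: "F x = F 0 + (LINT s:{0..x}|lborel. F' s)" if "x \<ge> 0" for x
    unfolding set_lebesgue_integral_def using that
    by (subst integral_FTC_atLeastAtMost)
      (auto intro: has_vector_derivative_at_within D continuous_on_subset[OF c])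
  have "((\<lambda>x. LINT s|lborel. indicator {0..x} s *\<^sub>R F' s) \<longlongrightarrow> (LINT s|lborel. indicator {0..} s *\<^sub>R F' s)) at_top"
  proof (rule integral_dominated_convergence_at_top)
    show "integrable lborel (\<lambda>s. norm (F' s))" using i by simp
    show "AE s in lborel. ((\<lambda>x. indicat_real {0..x} s *\<^sub>R F' s) \<longlongrightarrow> indicat_real {0..} s *\<^sub>R F' s) at_top"
    proof (rule AE_I2, rule tendsto_eventually)
      fix s :: real
      show "\<forall>\<^sub>F x in at_top. indicat_real {0..x} s *\<^sub>R F' s = indicat_real {0..} s *\<^sub>R F' s"
        using eventually_ge_at_top[of s] by eventually_elim (auto simp: indicator_def)
    qed
  qed (use i in \<open>auto simp: indicator_def intro!: always_eventually\<close>)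
  then have "((\<lambda>x. F 0 + (LINT s:{0..x}|lborel. F' s)) \<longlongrightarrow> F 0 + (LINT s:{0..}|lborel. F' s)) at_top"
    unfolding set_lebesgue_integral_def by (intro tendsto_intros)
  then have L: "(F \<longlongrightarrow> F 0 + (LINT s:{0..}|lborel. F' s)) at_top"
    by (rule Lim_transform_eventually) (use Fx eventually_mono[OF eventually_ge_at_top[of 0]] in \<open>metis (mono_tags, lifting)\<close>)
  define l where "l = F 0 + (LINT s:{0..}|lborel. F' s)"
  \<comment> \<open>The limit exists because the derivative is integrable. If it were not 0,
    \<open>norm (F x)\<close> would stay above a positive constant on a half line, which would then
    have finite length.\<close>
  have "l = 0"
  proof (rule ccontr)
    assume "l \<noteq> 0"
    then have "\<forall>\<^sub>F x in at_top. norm l / 2 < norm (F x)"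
      using order_tendstoD(1)[OF tendsto_norm[OF L], of "norm l / 2"] by (simp add: l_def)
    then obtain M where M: "\<And>x. x \<ge> M \<Longrightarrow> norm l / 2 < norm (F x)"
      by (auto simp: eventually_at_top_linorder)
    have "integrable lborel (\<lambda>x. indicator {M..} x *\<^sub>R (norm l / 2))"
    proof (rule Bochner_Integration.integrable_bound[OF i(1)])
      show "AE x in lborel. norm (indicat_real {M..} x *\<^sub>R (norm l / 2)) \<le> norm (F x)"
        using M by (auto intro!: AE_I2 simp: indicator_def less_imp_le)
    qed simp
    then have "integrable lborel (\<lambda>x. (2 / norm l) * (indicator {M..} x *\<^sub>R (norm l / 2)))"
      by (rule Bochner_Integration.integrable_mult_right)
    then have "integrable lborel (\<lambda>x. indicat_real {M..} x)"
      by (rule back_subst[where P = "integrable lborel"]) (use \<open>l \<noteq> 0\<close> in auto)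
    then have "emeasure lborel {M..} < \<infinity>"
      by (simp add: integrable_indicator_iff)
    moreover have "emeasure lborel {M..M + real n} \<le> emeasure lborel {M..}" for n
      by (intro emeasure_mono) auto
    then have "of_nat n \<le> emeasure lborel {M..}" for n
      by (simp add: ennreal_of_nat_eq_real_of_nat)
    ultimately show False
      by (metis ennreal_of_nat_eq_real_of_nat ennreal_Ex_less_of_nat infinity_ennreal_def leD)
  qed
  then show ?thesis using L by (simp add: l_def)
qed

lemma integrable_tendsto_0_at_bot:
  fixes F :: "real \<Rightarrow> 'a :: euclidean_space"
  assumes D: "\<And>x. (F has_vector_derivative F' x) (at x)" and c: "continuous_on UNIV F'"
    and i: "integrable lborel F" "integrable lborel F'"
  shows "(F \<longlongrightarrow> 0) at_bot"
proof -
  have "((\<lambda>x. F (- x)) \<longlongrightarrow> 0) at_top"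
  proof (rule integrable_tendsto_0_at_top)
    show "((\<lambda>x. F (- x)) has_vector_derivative - F' (- x)) (at x)" for x
    proof -
      have "(uminus has_vector_derivative (- 1 :: real)) (at x)"
        unfolding has_real_derivative_iff_has_vector_derivative[symmetric]
        by (auto intro!: derivative_eq_intros)
      from vector_diff_chain_at[OF this D] show ?thesis by (simp add: o_def)
    qed
    show "continuous_on UNIV (\<lambda>x. - F' (- x))"
      by (intro continuous_intros continuous_on_compose2[OF c]) auto
    show "integrable lborel (\<lambda>x. F (- x))" "integrable lborel (\<lambda>x. - F' (- x))"
      using lborel_integrable_real_affine[OF i(1), of "-1" 0] lborel_integrable_real_affine[OF i(2), of "-1" 0]
      by auto
  qed
  then show ?thesis by (simp add: filterlim_at_bot_mirror)
qed

text \<open>In the applications \<open>F\<close> is built from products of square integrable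
  functions, so integrability of \<open>F\<close> and of its derivative takes the place of decay
  estimates.\<close>

lemma integral_derivative_zero:
  fixes F :: "real \<Rightarrow> 'a :: euclidean_space"
  assumes D: "\<And>x. (F has_vector_derivative F' x) (at x)" and c: "continuous_on UNIV F'"
    and i: "integrable lborel F" "integrable lborel F'"
  shows "(LINT x|lborel. F' x) = 0"
proof -
  have "(\<lambda>n. LINT s|lborel. indicator {-real n..real n} s *\<^sub>R F' s) \<longlonglongrightarrow> (LINT s|lborel. F' s)"
  proof (rule integral_dominated_convergence)
    show "integrable lborel (\<lambda>s. norm (F' s))" using i by simp
    show "AE s in lborel. (\<lambda>n. indicat_real {-real n..real n} s *\<^sub>R F' s) \<longlonglongrightarrow> F' s"
    proof (rule AE_I2, rule tendsto_eventually)
      fix s :: real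
      obtain N where "\<bar>s\<bar> \<le> real N" using real_arch_simple by blast
      then show "\<forall>\<^sub>F n in sequentially. indicat_real {-real n..real n} s *\<^sub>R F' s = F' s"
        by (intro eventually_sequentiallyI[of N]) (auto simp: indicator_def)
    qed
  qed (use i in \<open>auto simp: indicator_def\<close>)
  moreover have "(LINT s|lborel. indicator {-real n..real n} s *\<^sub>R F' s) = F (real n) - F (- real n)" for n
    by (rule integral_FTC_atLeastAtMost)
      (auto intro: has_vector_derivative_at_within D continuous_on_subset[OF c])
  ultimately have "(\<lambda>n. F (real n) - F (- real n)) \<longlonglongrightarrow> (LINT s|lborel. F' s)" by simp
  moreover have "(\<lambda>n. F (real n) - F (- real n)) \<longlonglongrightarrow> 0 - 0"
  proof (intro tendsto_diff)
    show "(\<lambda>n. F (real n)) \<longlonglongrightarrow> 0"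
      by (rule filterlim_compose[OF integrable_tendsto_0_at_top[OF assms] filterlim_real_sequentially])
    show "(\<lambda>n. F (- real n)) \<longlonglongrightarrow> 0"
      by (rule filterlim_compose[OF integrable_tendsto_0_at_bot[OF assms]])
        (simp add: filterlim_uminus_at_bot filterlim_real_sequentially)
  qed
  ultimately show ?thesis using LIMSEQ_unique[of _ _ "0 - 0 :: 'a"] by simp
qed

lemma integral_by_parts:
  assumes f: "classical_H1 f f'" and g: "classical_H1 g g'"
  shows "integrable lborel (\<lambda>x. f' x * g x)" "integrable lborel (\<lambda>x. f x * g' x)"
    "(LINT x|lborel. f' x * g x) = - (LINT x|lborel. f x * g' x)"
proof -
  note fD = classical_H1_D[OF f] and gD = classical_H1_D[OF g]
  show i: "integrable lborel (\<lambda>x. f' x * g x)" "integrable lborel (\<lambda>x. f x * g' x)"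
    using L2_continuous_mult_integrable fD gD by blast+
  have "(LINT x|lborel. f x * g' x + f' x * g x) = 0"
  proof (rule integral_derivative_zero)
    show "((\<lambda>x. f x * g x) has_vector_derivative f x * g' x + f' x * g x) (at x)" for x
      by (intro has_vector_derivative_mult fD gD)
    show "continuous_on UNIV (\<lambda>x. f x * g' x + f' x * g x)"
      by (intro continuous_intros fD gD)
    show "integrable lborel (\<lambda>x. f x * g x)"
      using L2_continuous_mult_integrable fD gD by blast
  qed (use i in simp)
  with i show "(LINT x|lborel. f' x * g x) = - (LINT x|lborel. f x * g' x)"
    by (simp add: eq_neg_iff_add_eq_0 add.commute)
qed

lemma integral_square_zero_imp_zero:
  assumes "L2_continuous f" "(LINT x|lborel. (norm (f x))\<^sup>2) = 0"
  shows "f x = 0"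
proof -
  have c: "continuous_on UNIV f" and i: "integrable lborel (\<lambda>x. (norm (f x))\<^sup>2)"
    using assms by (auto simp: L2_continuous_def)
  have "AE x in lborel. (norm (f x))\<^sup>2 = 0"
    using integral_nonneg_eq_0_iff_AE[OF i] assms(2) by simp
  then have "AE x in lborel. complex_of_real (norm (f x)) = 0"
    by eventually_elim simp
  then have "(\<lambda>x. complex_of_real (norm (f x))) = (\<lambda>x. 0)"
    by (intro continuous_AE_eq_imp_eq continuous_intros c)
  then show ?thesis by (metis norm_eq_zero of_real_eq_0_iff)
qed

subsection \<open>The profile and its quadratic forms\<close>

locale sech_profile =
  fixes b :: real
  assumes b_pos: "b > 0"
begin

definition "\<beta> = 1 / (2 * sqrt b)"
text \<open>Since \<open>\<tau>\<close> has derivative \<open>\<beta> S\<close>, all derivatives of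
  the profile \<open>1 - \<tau>^2\<close> are polynomials in \<open>\<tau>\<close> and
  \<open>S\<close>. The primed names below are such explicit formulas, identified as derivatives
  afterwards.\<close>

definition "\<tau> x = tanh (\<beta> * x)"
definition "S x = 1 - (\<tau> x)\<^sup>2"
definition "S' x = - 2 * \<beta> * \<tau> x * S x"
definition "S'' x = \<beta>\<^sup>2 * (4 * S x - 6 * (S x)\<^sup>2)"
definition "S''' x = \<beta>\<^sup>2 * (4 - 12 * S x) * S' x"

lemma \<beta>_pos: "\<beta> > 0"
  using b_pos by (simp add: \<beta>_def)

lemma b_\<beta>: "b * \<beta>\<^sup>2 = 1 / 4"
  using b_pos by (simp add: \<beta>_def power_divide power_mult_distrib)

lemma \<tau>_derivative: "(\<tau> has_real_derivative \<beta> * S x) (at x)"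
  unfolding \<tau>_def S_def by (auto intro!: derivative_eq_intros)

lemma S_derivative: "(S has_real_derivative S' x) (at x)"
proof -
  have "((\<lambda>x. 1 - (\<tau> x)\<^sup>2) has_real_derivative S' x) (at x)"
    by (auto intro!: derivative_eq_intros \<tau>_derivative simp: S'_def)
  then show ?thesis by (simp add: S_def[abs_def])
qed

lemma S'_derivative: "(S' has_real_derivative S'' x) (at x)"
proof -
  have "((\<lambda>x. - 2 * \<beta> * \<tau> x * S x) has_real_derivative S'' x) (at x)"
    by (auto intro!: derivative_eq_intros \<tau>_derivative S_derivative)
      (simp add: S''_def S'_def S_def power2_eq_square algebra_simps)
  then show ?thesis by (simp add: S'_def[abs_def])
qed

lemma S''_derivative: "(S'' has_real_derivative S''' x) (at x)"
proof -
  have "((\<lambda>x. \<beta>\<^sup>2 * (4 * S x - 6 * (S x)\<^sup>2)) has_real_derivative S''' x) (at x)"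
    by (auto intro!: derivative_eq_intros S_derivative) (simp add: S'''_def algebra_simps)
  then show ?thesis by (simp add: S''_def[abs_def])
qed

lemma profile_equation: "b * S'' x = S x - 3 / 2 * (S x)\<^sup>2"
proof -
  have "b * S'' x = (b * \<beta>\<^sup>2) * (4 * S x - 6 * (S x)\<^sup>2)"
    by (simp add: S''_def)
  then show ?thesis by (simp add: b_\<beta> algebra_simps)
qed

lemma profile_equation': "b * S''' x = (1 - 3 * S x) * S' x"
proof -
  have "b * S''' x = (b * \<beta>\<^sup>2) * (4 - 12 * S x) * S' x"
    by (simp add: S'''_def)
  then show ?thesis by (simp add: b_\<beta> algebra_simps)
qed

lemma \<tau>_bounds: "\<bar>\<tau> x\<bar> < 1"
  using tanh_real_lt_1[of "\<beta> * x"] tanh_real_gt_neg1[of "\<beta> * x"] by (simp add: \<tau>_def)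

lemma S_pos: "S x > 0"
  using \<tau>_bounds[of x] by (simp add: S_def abs_square_less_1)

lemma S_le_1: "S x \<le> 1"
  by (simp add: S_def)

lemma \<tau>_eq_0_iff: "\<tau> x = 0 \<longleftrightarrow> x = 0"
  using \<beta>_pos by (simp add: \<tau>_def)

lemma S_0: "S 0 = 1"
  by (simp add: S_def \<tau>_def)

lemma \<tau>_continuous: "continuous_on UNIV \<tau>"
  by (meson DERIV_isCont \<tau>_derivative continuous_at_imp_continuous_on)

lemma S_continuous: "continuous_on UNIV S"
  by (meson DERIV_isCont S_derivative continuous_at_imp_continuous_on)

lemma \<tau>_at_top: "(\<tau> \<longlongrightarrow> 1) at_top"
  unfolding \<tau>_def
  by (rule filterlim_compose[OF tanh_real_at_top]) (rule filterlim_tendsto_pos_mult_at_top[OF tendsto_const \<beta>_pos filterlim_ident])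

lemma \<tau>_at_bot: "(\<tau> \<longlongrightarrow> -1) at_bot"
proof -
  have "((\<lambda>x. - \<tau> x) \<longlongrightarrow> - 1) at_top"
    by (intro tendsto_minus \<tau>_at_top)
  then show ?thesis by (simp add: filterlim_at_bot_mirror \<tau>_def)
qed

text \<open>\<open>S\<close> is positive and is the derivative of \<open>\<tau> / \<beta>\<close>,
  which has finite limits at both ends, so the improper fundamental theorem replaces an exponential
  estimate.\<close>

lemma S_integrable: "integrable lborel S"
proof -
  have "set_integrable lborel (einterval (-\<infinity>) \<infinity>) S"
  proof (rule interval_integral_FTC_nonneg(1))
    show "((\<lambda>x. \<tau> x / \<beta>) has_real_derivative S x) (at x)" for x
    proof -
      have "((\<lambda>x. \<tau> x / \<beta>) has_real_derivative \<beta> * S x / \<beta>) (at x)"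
        by (rule DERIV_cdivide[OF \<tau>_derivative])
      moreover have "\<beta> * S x / \<beta> = S x" using \<beta>_pos by simp
      ultimately show ?thesis by metis
    qed
    show "isCont S x" for x
      by (rule DERIV_isCont[OF S_derivative])
    show "(((\<lambda>x. \<tau> x / \<beta>) \<circ> real_of_ereal) \<longlongrightarrow> -1 / \<beta>) (at_right (-\<infinity>))"
      unfolding o_def at_right_MInf
      by (use tendsto_divide[OF \<tau>_at_bot tendsto_const[of \<beta>]] \<beta>_pos in \<open>simp add: filterlim_filtermap\<close>)
    show "(((\<lambda>x. \<tau> x / \<beta>) \<circ> real_of_ereal) \<longlongrightarrow> 1 / \<beta>) (at_left \<infinity>)"
      unfolding o_def at_left_PInf
      by (use tendsto_divide[OF \<tau>_at_top tendsto_const[of \<beta>]] \<beta>_pos in \<open>simp add: filterlim_filtermap\<close>)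
  qed (auto intro!: AE_I2 less_imp_le[OF S_pos])
  moreover have "einterval (-\<infinity>) \<infinity> = UNIV" by (auto simp: einterval_iff)
  ultimately show ?thesis by (simp add: set_integrable_def)
qed

lemma S_L2: "L2_continuous S"
  unfolding L2_continuous_def
proof
  show "integrable lborel (\<lambda>x. (norm (S x))\<^sup>2)"
  proof (rule Bochner_Integration.integrable_bound[OF S_integrable])
    note [measurable] = borel_measurable_continuous_onI[OF S_continuous]
    show "(\<lambda>x. (norm (S x))\<^sup>2) \<in> borel_measurable lborel" by simp
    show "AE x in lborel. norm ((norm (S x))\<^sup>2) \<le> norm (S x)"
    proof (rule AE_I2)
      fix x
      have "S x * S x \<le> 1 * S x"
        using S_pos[of x] S_le_1[of x] by (intro mult_right_mono) auto
      then show "norm ((norm (S x))\<^sup>2) \<le> norm (S x)"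
        using S_pos[of x] by (simp add: power2_eq_square)
    qed
  qed
qed (rule S_continuous)

text \<open>Each derivative is a bounded continuous function times \<open>S\<close> or
  \<open>S'\<close>, so square integrability passes down from \<open>S\<close>.\<close>

lemma S_classical_H1: "classical_H1 S S'" "classical_H1 S' S''" "classical_H1 S'' S'''"
proof -
  have S': "L2_continuous S'"
  proof -
    have "L2_continuous (\<lambda>x. (- 2 * \<beta> * \<tau> x) * S x)"
    proof (rule L2_continuous_mult_bounded[OF S_L2])
      show "norm (- 2 * \<beta> * \<tau> x) \<le> 2 * \<beta>" for x
        using \<tau>_bounds[of x] \<beta>_pos by (simp add: abs_mult)
    qed (intro continuous_intros \<tau>_continuous)
    then show ?thesis by (simp add: S'_def[abs_def])
  qed
  have S'': "L2_continuous S''"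
  proof -
    have "L2_continuous (\<lambda>x. (\<beta>\<^sup>2 * (4 - 6 * S x)) * S x)"
    proof (rule L2_continuous_mult_bounded[OF S_L2])
      show "norm (\<beta>\<^sup>2 * (4 - 6 * S x)) \<le> \<beta>\<^sup>2 * 4" for x
        using S_pos[of x] S_le_1[of x] by (simp add: abs_mult mult_left_mono)
    qed (intro continuous_intros S_continuous)
    then show ?thesis by (simp add: S''_def[abs_def] power2_eq_square algebra_simps)
  qed
  have S''': "L2_continuous S'''"
    unfolding S'''_def[abs_def]
  proof (rule L2_continuous_mult_bounded[OF S'])
    show "norm (\<beta>\<^sup>2 * (4 - 12 * S x)) \<le> \<beta>\<^sup>2 * 8" for x
      using S_pos[of x] S_le_1[of x] by (simp add: abs_mult mult_left_mono)
  qed (intro continuous_intros S_continuous)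
  show "classical_H1 S S'" "classical_H1 S' S''" "classical_H1 S'' S'''"
    using S_L2 S' S'' S''' S_derivative S'_derivative S''_derivative
    by (simp_all add: classical_H1_def has_real_derivative_iff_has_vector_derivative)
qed

text \<open>The quotient \<open>S'' / S'\<close> with the factor \<open>S\<close> cancelled. Its
  only singularity is a simple pole at the origin, where the convention for division gives the value
  0.\<close>

definition "r x = \<beta> * (1 - 3 * (\<tau> x)\<^sup>2) / \<tau> x"

lemma r_derivative:
  assumes "x \<noteq> 0"
  shows "(r has_real_derivative (1 - 3 * S x) / b - (r x)\<^sup>2) (at x)"
proof -
  have t: "\<tau> x \<noteq> 0" using assms by (simp add: \<tau>_eq_0_iff)
  have "(r has_real_derivative
      ((\<beta> * (0 - 3 * (2 * \<tau> x * (\<beta> * S x)))) * \<tau> x - \<beta> * (1 - 3 * (\<tau> x)\<^sup>2) * (\<beta> * S x)) / (\<tau> x * \<tau> x)) (at x)"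
    unfolding r_def[abs_def] using t
    by (auto intro!: derivative_eq_intros \<tau>_derivative)
  also have "((\<beta> * (0 - 3 * (2 * \<tau> x * (\<beta> * S x)))) * \<tau> x - \<beta> * (1 - 3 * (\<tau> x)\<^sup>2) * (\<beta> * S x)) / (\<tau> x * \<tau> x) =
      - \<beta>\<^sup>2 * S x * (1 + 3 * (\<tau> x)\<^sup>2) / (\<tau> x)\<^sup>2"
    by (simp add: power2_eq_square algebra_simps)
  also have "\<dots> = (1 - 3 * S x) / b - (r x)\<^sup>2"
  proof -
    \<comment> \<open>With \<open>4 \<beta>^2\<close> in place of \<open>1 / b\<close> both terms
      have the denominator \<open>\<tau>^2\<close>, and the numerators satisfy a polynomial identity
      through \<open>S = 1 - \<tau>^2\<close>.\<close>
    have "b = 1 / (4 * \<beta>\<^sup>2)"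
      using b_\<beta> \<beta>_pos by (simp add: field_simps)
    have "(1 - 3 * S x) / b = (1 - 3 * S x) * (4 * \<beta>\<^sup>2)"
      by (subst \<open>b = _\<close>) simp
    then have "(1 - 3 * S x) / b = \<beta>\<^sup>2 * (4 * (1 - 3 * S x) * (\<tau> x)\<^sup>2) / (\<tau> x)\<^sup>2"
      using t by simp
    moreover have "(r x)\<^sup>2 = \<beta>\<^sup>2 * (1 - 3 * (\<tau> x)\<^sup>2)\<^sup>2 / (\<tau> x)\<^sup>2"
      by (simp add: r_def power_divide power_mult_distrib)
    ultimately have "(1 - 3 * S x) / b - (r x)\<^sup>2 = \<beta>\<^sup>2 * (4 * (1 - 3 * S x) * (\<tau> x)\<^sup>2 - (1 - 3 * (\<tau> x)\<^sup>2)\<^sup>2) / (\<tau> x)\<^sup>2"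
      by (simp only: right_diff_distrib diff_divide_distrib)
    also have "4 * (1 - 3 * S x) * (\<tau> x)\<^sup>2 - (1 - 3 * (\<tau> x)\<^sup>2)\<^sup>2 = - S x * (1 + 3 * (\<tau> x)\<^sup>2)"
      by (simp add: S_def power2_eq_square algebra_simps)
    finally show ?thesis by simp
  qed
  finally show ?thesis .
qed


text \<open>The zero of \<open>g\<close> at the origin absorbs the pole of \<open>r\<close>: near 0
  the function is a convergent factor times \<open>g / \<tau>\<close>, which tends to
  \<open>g' 0 / \<beta>\<close>, times one more \<open>g\<close>, which tends to 0.\<close>

lemma r_square_continuous:
  fixes g :: "real \<Rightarrow> real"
  assumes D: "\<And>x. (g has_real_derivative g' x) (at x)" and 0: "g 0 = 0"
  shows "isCont (\<lambda>x. b * r x * (g x)\<^sup>2) x"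
proof (cases "x = 0")
  case False
  have "isCont r x" "isCont g x"
    using DERIV_isCont[OF r_derivative[OF False]] DERIV_isCont[OF D] by auto
  then show ?thesis by (intro continuous_intros)
next
  case True
  have "((\<lambda>h. (g h / h) / (\<tau> h / h)) \<longlongrightarrow> g' 0 / \<beta>) (at 0)"
  proof (rule tendsto_divide)
    show "((\<lambda>h. g h / h) \<longlongrightarrow> g' 0) (at 0)"
      using D[of 0] 0 by (simp add: DERIV_def)
    show "((\<lambda>h. \<tau> h / h) \<longlongrightarrow> \<beta>) (at 0)"
      using \<tau>_derivative[of 0] by (simp add: DERIV_def S_0 \<tau>_eq_0_iff[THEN iffD2])
  qed (use \<beta>_pos in simp)
  then have q: "((\<lambda>h. g h / \<tau> h) \<longlongrightarrow> g' 0 / \<beta>) (at 0)"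
    by (rule Lim_transform_eventually) (auto simp: eventually_at_filter)
  have l: "(\<tau> \<longlongrightarrow> \<tau> 0) (at 0)" "(g \<longlongrightarrow> g 0) (at 0)"
    using DERIV_isCont[OF \<tau>_derivative[of 0]] DERIV_isCont[OF D[of 0]] by (auto simp: isCont_def)
  have "((\<lambda>h. b * (\<beta> * (1 - 3 * (\<tau> h)\<^sup>2)) * (g h / \<tau> h) * g h) \<longlongrightarrow>
      b * (\<beta> * (1 - 3 * (\<tau> 0)\<^sup>2)) * (g' 0 / \<beta>) * g 0) (at 0)"
    by (intro tendsto_mult tendsto_diff tendsto_power tendsto_const q l)
  then show ?thesis
    using True 0 by (simp add: isCont_def r_def power2_eq_square mult_ac)
qed

text \<open>Jacobi's substitution with the zero mode \<open>S'\<close>, whose only zero is the origin: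
  \<open>r = S'' / S'\<close> solves the Riccati equation of the operator \<open>1 - b \<partial>\<^sup>2 - 3 S\<close>.\<close>

lemma
  fixes g g' :: "real \<Rightarrow> real"
  assumes g: "classical_H1 g g'" and 0: "g 0 = 0"
  shows kdv_form_nonneg: "0 \<le> (LINT x|lborel. (g x)\<^sup>2 + b * (g' x)\<^sup>2 - 3 * S x * (g x)\<^sup>2)"
    and kdv_form_zero: "(LINT x|lborel. (g x)\<^sup>2 + b * (g' x)\<^sup>2 - 3 * S x * (g x)\<^sup>2) = 0 \<Longrightarrow>
      x \<noteq> 0 \<Longrightarrow> g' x = r x * g x"
proof -
  note gD = classical_H1_D[OF g]
  have D: "(g has_real_derivative g' x) (at x)" for x
    using gD(1) by (simp add: has_real_derivative_iff_has_vector_derivative)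
  have int_g: "integrable lborel (\<lambda>x. g x * g x)" "integrable lborel (\<lambda>x. g x * g' x)"
      "integrable lborel (\<lambda>x. g' x * g' x)"
    by (intro L2_continuous_mult_integrable gD)+
  \<comment> \<open>The identity behind the substitution is \<open>e = m + P'\<close> away from the
    origin: expanding the square \<open>m\<close> leaves the derivative of \<open>b r g^2\<close>,
    by the Riccati equation.\<close>
  define e where "e = (\<lambda>x. (g x)\<^sup>2 + b * (g' x)\<^sup>2 - 3 * S x * (g x)\<^sup>2)"
  define m where "m = (\<lambda>x. b * (g' x - r x * g x)\<^sup>2)"
  define P where "P = (\<lambda>x. b * r x * (g x)\<^sup>2)"
  have m: "m x \<ge> 0" for x using b_pos by (simp add: m_def)
  have e_cont: "continuous_on UNIV e"
    unfolding e_def by (intro continuous_intros gD S_continuous)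
  have e_int: "integrable lborel e"
  proof -
    have "L2_continuous (\<lambda>x. S x * g x)"
      using S_pos S_le_1 by (intro L2_continuous_mult_bounded[where B = 1] gD S_continuous) (simp add: less_imp_le)
    from L2_continuous_mult_integrable[OF this gD(2)]
    have "integrable lborel (\<lambda>x. S x * g x * g x)" .
    then have "integrable lborel (\<lambda>x. g x * g x + b * (g' x * g' x) - 3 * (S x * g x * g x))"
      using int_g by simp
    then show ?thesis by (simp add: e_def power2_eq_square mult_ac)
  qed
  have P': "(P has_real_derivative e x - m x) (at x)" if "x \<noteq> 0" for x
  proof -
    have "(P has_real_derivative
        b * (((1 - 3 * S x) / b - (r x)\<^sup>2) * (g x)\<^sup>2 + r x * (2 * g x * g' x))) (at x)"
      unfolding P_def by (auto intro!: derivative_eq_intros r_derivative[OF that] D simp: algebra_simps)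
    also have "b * (((1 - 3 * S x) / b - (r x)\<^sup>2) * (g x)\<^sup>2 + r x * (2 * g x * g' x)) = e x - m x"
      using b_pos by (simp add: e_def m_def field_simps power2_eq_square)
    finally show ?thesis .
  qed
  have P_cont: "continuous_on A P" for A
    unfolding P_def by (intro continuous_at_imp_continuous_on ballI r_square_continuous[OF D 0])
  \<comment> \<open>\<open>M x y\<close> is the integral of \<open>m\<close> over
    \<open>[x, y]\<close>, expressed by \<open>e\<close> and \<open>P\<close>. It is taken as a
    gauge integral, whose fundamental theorem tolerates the exceptional point 0, so \<open>m\<close>
    need not be examined there.\<close>
  define M where "M = (\<lambda>x y. (LINT s:{x..y}|lborel. e s) - (P y - P x))"
  have M: "(m has_integral M x y) {x..y}" if "x \<le> y" for x y
  proof -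
    have i: "set_integrable lborel {x..y} e"
      unfolding set_integrable_def using e_int by (intro integrable_mult_indicator) auto
    have "(e has_integral (LINT s:{x..y}|lborel. e s)) {x..y}"
      using set_borel_integral_eq_integral[OF i] by (simp add: has_integral_integral[symmetric] has_integral_iff)
    moreover have "((\<lambda>x. e x - m x) has_integral P y - P x) {x..y}"
      using that P' by (intro fundamental_theorem_of_calculus_strong[of "{0}"] P_cont)
        (auto simp: has_real_derivative_iff_has_vector_derivative[symmetric])
    ultimately have "((\<lambda>x. e x - (e x - m x)) has_integral M x y) {x..y}"
      unfolding M_def by (rule has_integral_diff)
    then show ?thesis by simp
  qed
  have sq: "((\<lambda>x. (g x)\<^sup>2) has_vector_derivative 2 * (g x * g' x)) (at x)" for x
    unfolding has_real_derivative_iff_has_vector_derivative[symmetric]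
    by (auto intro!: derivative_eq_intros D)
  have sq_c: "continuous_on UNIV (\<lambda>x. 2 * (g x * g' x))"
    by (intro continuous_intros gD)
  have sq_i: "integrable lborel (\<lambda>x. (g x)\<^sup>2)" "integrable lborel (\<lambda>x. 2 * (g x * g' x))"
    using int_g by (simp_all add: power2_eq_square)
  note g0 = integrable_tendsto_0_at_top[OF sq sq_c sq_i] integrable_tendsto_0_at_bot[OF sq sq_c sq_i]
  have Pt: "(P \<longlongrightarrow> 0) at_top" "(P \<longlongrightarrow> 0) at_bot"
  proof -
    have "((\<lambda>x. b * (\<beta> * (1 - 3 * (\<tau> x)\<^sup>2) / \<tau> x) * (g x)\<^sup>2) \<longlongrightarrow> b * (\<beta> * (1 - 3 * 1\<^sup>2) / 1) * 0) at_top"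
      by (intro tendsto_intros \<tau>_at_top g0) auto
    then show "(P \<longlongrightarrow> 0) at_top" by (simp add: P_def r_def)
    have "((\<lambda>x. b * (\<beta> * (1 - 3 * (\<tau> x)\<^sup>2) / \<tau> x) * (g x)\<^sup>2) \<longlongrightarrow> b * (\<beta> * (1 - 3 * (-1)\<^sup>2) / (-1)) * 0) at_bot"
      by (intro tendsto_intros \<tau>_at_bot g0) auto
    then show "(P \<longlongrightarrow> 0) at_bot" by (simp add: P_def r_def)
  qed
  have lim: "(\<lambda>n. M (- real n) (real n)) \<longlonglongrightarrow> (LINT s|lborel. e s)"
  proof -
    have "(\<lambda>n. LINT s:{- real n..real n}|lborel. e s) \<longlonglongrightarrow> (LINT s|lborel. e s)"
      unfolding set_lebesgue_integral_def
    proof (rule integral_dominated_convergence)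
      show "integrable lborel (\<lambda>s. norm (e s))" using e_int by simp
      show "AE s in lborel. (\<lambda>n. indicat_real {-real n..real n} s *\<^sub>R e s) \<longlonglongrightarrow> e s"
      proof (rule AE_I2, rule tendsto_eventually)
        fix s :: real
        obtain N where "\<bar>s\<bar> \<le> real N" using real_arch_simple by blast
        then show "\<forall>\<^sub>F n in sequentially. indicat_real {-real n..real n} s *\<^sub>R e s = e s"
          by (intro eventually_sequentiallyI[of N]) (auto simp: indicator_def)
      qed
    qed (use e_int in \<open>auto simp: indicator_def\<close>)
    moreover have "(\<lambda>n. P (real n)) \<longlonglongrightarrow> 0"
      by (rule filterlim_compose[OF Pt(1) filterlim_real_sequentially])
    moreover have "(\<lambda>n. P (- real n)) \<longlonglongrightarrow> 0"
      by (rule filterlim_compose[OF Pt(2)]) (simp add: filterlim_uminus_at_bot filterlim_real_sequentially)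
    ultimately have "(\<lambda>n. M (- real n) (real n)) \<longlonglongrightarrow> (LINT s|lborel. e s) - (0 - 0)"
      unfolding M_def by (intro tendsto_diff)
    then show ?thesis by simp
  qed
  have mono: "M x y \<le> M x' y'" if "x' \<le> x" "x \<le> y" "y \<le> y'" for x y x' y'
    by (rule has_integral_subset_le[OF _ M M]) (use that m in auto)
  have le: "M x y \<le> (LINT s|lborel. e s)" if "x \<le> y" for x y
  proof -
    obtain N where N: "\<bar>x\<bar> + \<bar>y\<bar> \<le> real N" using real_arch_simple by blast
    have "M x y \<le> M (- real n) (real n)" if "n \<ge> N" for n
      using N that \<open>x \<le> y\<close> by (intro mono) auto
    then show ?thesis
      by (intro tendsto_lowerbound[OF lim]) (auto simp: eventually_sequentially)
  qed
  have M_nonneg: "0 \<le> M x y" if "x \<le> y" for x y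
    by (rule has_integral_nonneg[OF M]) (use that m in auto)
  show "0 \<le> (LINT x|lborel. (g x)\<^sup>2 + b * (g' x)\<^sup>2 - 3 * S x * (g x)\<^sup>2)"
    using le[of 0 0] M_nonneg[of 0 0] by (simp add: e_def)
  assume "(LINT x|lborel. (g x)\<^sup>2 + b * (g' x)\<^sup>2 - 3 * S x * (g x)\<^sup>2) = 0" and x: "x \<noteq> 0"
  then have M0: "M y z = 0" if "y \<le> z" for y z
    using le[OF that] M_nonneg[OF that] by (simp add: e_def)
  \<comment> \<open>A unit interval with endpoint \<open>x\<close> on the side away from the origin:
    \<open>m\<close> is continuous there, so a vanishing integral forces
    \<open>m x = 0\<close>.\<close>
  define y z where "y = (if x > 0 then x else x - 1)" and "z = (if x > 0 then x + 1 else x)"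
  have yz: "y < z" "x \<in> {y..z}" "0 \<notin> {y..z}"
    using x by (auto simp: y_def z_def)
  have "m x = 0"
  proof (rule has_integral_0_cbox_imp_0[of y z m])
    have "isCont m u" if "u \<in> {y..z}" for u
    proof -
      have "u \<noteq> 0" using yz(3) that by auto
      then have "isCont r u" using DERIV_isCont[OF r_derivative] by blast
      moreover have "isCont g u" "isCont g' u"
        using gD(4,5) by (auto simp: continuous_on_eq_continuous_at)
      ultimately show ?thesis unfolding m_def by (intro continuous_intros)
    qed
    then show "continuous_on (cbox y z) m"
      by (auto intro!: continuous_at_imp_continuous_on)
    show "(m has_integral 0) (cbox y z)"
      using M[of y z] M0[of y z] yz by simp
  qed (use m yz in auto)
  then show "g' x = r x * g x"
    using b_pos by (simp add: m_def)
qed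


section \<open>Quadratic forms and their expansion along the profile\<close>

definition form :: "real \<Rightarrow> (real \<Rightarrow> real) \<Rightarrow> (real \<Rightarrow> real) \<Rightarrow> real" where
  "form c f f' = (LINT x|lborel. (f x)\<^sup>2 + b * (f' x)\<^sup>2 + c * S x * (f x)\<^sup>2)"

lemma S_mult_L2: "L2_continuous f \<Longrightarrow> L2_continuous (\<lambda>x. S x * f x)" for f :: "real \<Rightarrow> real"
  using S_pos S_le_1 by (intro L2_continuous_mult_bounded[where B = 1] S_continuous) (simp_all add: less_imp_le)

lemma form_integrable:
  assumes "classical_H1 f f'"
  shows "integrable lborel (\<lambda>x. (f x)\<^sup>2 + b * (f' x)\<^sup>2 + c * S x * (f x)\<^sup>2)"
proof -
  note fD = classical_H1_D[OF assms]
  have "integrable lborel (\<lambda>x. f x * f x + b * (f' x * f' x) + c * (S x * f x * f x))"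
    using L2_continuous_mult_integrable[OF fD(2) fD(2)] L2_continuous_mult_integrable[OF fD(3) fD(3)]
      L2_continuous_mult_integrable[OF S_mult_L2[OF fD(2)] fD(2)]
    by simp
  then show ?thesis by (simp add: power2_eq_square mult_ac)
qed

lemma square_S_integrable:
  assumes "L2_continuous f"
  shows "integrable lborel (\<lambda>x. f x * (S x)\<^sup>2)"
  using L2_continuous_mult_integrable[OF assms S_mult_L2[OF S_L2]] by (simp add: power2_eq_square)

text \<open>Integration by parts moves the derivative onto \<open>S'\<close>, and the profile
  equation removes it; all that remains of the polarized form is the moment of \<open>f\<close>
  against \<open>S^2\<close>.\<close>

lemma
  assumes f: "classical_H1 f f'"
  shows cross_integrable: "integrable lborel (\<lambda>x. f x * S x + b * (f' x * S' x) + c * (f x * (S x)\<^sup>2))"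
    and cross_integral: "(LINT x|lborel. f x * S x + b * (f' x * S' x) + c * (f x * (S x)\<^sup>2)) =
      (3 / 2 + c) * (LINT x|lborel. f x * (S x)\<^sup>2)"
proof -
  note fD = classical_H1_D[OF f]
  note parts = integral_by_parts[OF f S_classical_H1(2)]
  have i: "integrable lborel (\<lambda>x. f x * S x)" "integrable lborel (\<lambda>x. f x * (S x)\<^sup>2)"
    using L2_continuous_mult_integrable[OF fD(2) S_L2] square_S_integrable[OF fD(2)] by auto
  show "integrable lborel (\<lambda>x. f x * S x + b * (f' x * S' x) + c * (f x * (S x)\<^sup>2))"
    using i parts(1) by simp
  have "b * (LINT x|lborel. f x * S'' x) = (LINT x|lborel. f x * (b * S'' x))"
    by (simp add: mult.left_commute)
  also have "\<dots> = (LINT x|lborel. f x * S x - 3 / 2 * (f x * (S x)\<^sup>2))"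
    by (simp add: profile_equation algebra_simps)
  also have "\<dots> = (LINT x|lborel. f x * S x) - 3 / 2 * (LINT x|lborel. f x * (S x)\<^sup>2)"
    using i by simp
  finally have "b * (LINT x|lborel. f' x * S' x) =
      3 / 2 * (LINT x|lborel. f x * (S x)\<^sup>2) - (LINT x|lborel. f x * S x)"
    using parts(3) by simp
  then show "(LINT x|lborel. f x * S x + b * (f' x * S' x) + c * (f x * (S x)\<^sup>2)) =
      (3 / 2 + c) * (LINT x|lborel. f x * (S x)\<^sup>2)"
    using i parts(1) by (simp add: algebra_simps)
qed

lemma form_add_S:
  assumes f: "classical_H1 f f'"
  shows "form c (\<lambda>x. f x + s * S x) (\<lambda>x. f' x + s * S' x) =
    form c f f' + (3 / 2 + c) * (2 * s * (LINT x|lborel. f x * (S x)\<^sup>2) + s\<^sup>2 * (LINT x|lborel. S x * (S x)\<^sup>2))"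
proof -
  have "form c (\<lambda>x. f x + s * S x) (\<lambda>x. f' x + s * S' x) =
    (LINT x|lborel. ((f x)\<^sup>2 + b * (f' x)\<^sup>2 + c * S x * (f x)\<^sup>2)
      + (2 * s) * (f x * S x + b * (f' x * S' x) + c * (f x * (S x)\<^sup>2))
      + s\<^sup>2 * (S x * S x + b * (S' x * S' x) + c * (S x * (S x)\<^sup>2)))"
    unfolding form_def
    by (intro Bochner_Integration.integral_cong refl) (simp add: power2_eq_square algebra_simps)
  also have "\<dots> = form c f f' + (2 * s) * ((3 / 2 + c) * (LINT x|lborel. f x * (S x)\<^sup>2))
      + s\<^sup>2 * ((3 / 2 + c) * (LINT x|lborel. S x * (S x)\<^sup>2))"
    unfolding form_def
      cross_integral[OF f, of c, symmetric] cross_integral[OF S_classical_H1(1), of c, symmetric]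
    using form_integrable[OF f, of c] cross_integrable[OF f, of c] cross_integrable[OF S_classical_H1(1), of c]
    by (simp only: Bochner_Integration.integral_add Bochner_Integration.integrable_add
        integral_mult_right_zero Bochner_Integration.integrable_mult_right)
  finally show ?thesis by (simp add: algebra_simps)
qed

lemma S_cube_integral_pos: "(LINT x|lborel. S x * (S x)\<^sup>2) > 0"
proof -
  have i: "integrable lborel (\<lambda>x. S x * (S x)\<^sup>2)" by (rule square_S_integrable[OF S_L2])
  have pos: "S x * (S x)\<^sup>2 > 0" for x using S_pos[of x] by simp
  have "(LINT x|lborel. S x * (S x)\<^sup>2) \<noteq> 0"
  proof
    assume "(LINT x|lborel. S x * (S x)\<^sup>2) = 0"
    then have "AE x in lborel. S x * (S x)\<^sup>2 = 0"
      using integral_nonneg_eq_0_iff_AE[OF i] pos by (simp add: less_imp_le)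
    then have "AE x in lborel. complex_of_real (S x * (S x)\<^sup>2) = 0"
      by eventually_elim simp
    then have "(\<lambda>x. complex_of_real (S x * (S x)\<^sup>2)) = (\<lambda>x. 0)"
      by (intro continuous_AE_eq_imp_eq continuous_intros S_continuous)
    then show False using pos[of 0] by (metis less_irrefl of_real_eq_0_iff)
  qed
  moreover have "0 \<le> (LINT x|lborel. S x * (S x)\<^sup>2)"
    using pos by (intro integral_nonneg_AE) (auto intro: AE_I2 less_imp_le)
  ultimately show ?thesis by simp
qed

lemma form_lower_bound:
  assumes f: "classical_H1 f f'" and c: "c \<ge> 0"
  shows "(LINT x|lborel. (norm (f x))\<^sup>2) \<le> form c f f'"
  unfolding form_def
proof (rule integral_mono[OF _ form_integrable[OF f]])
  show "integrable lborel (\<lambda>x. (norm (f x))\<^sup>2)"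
    using classical_H1_D(2)[OF f] by (simp add: L2_continuous_def)
  show "(norm (f x))\<^sup>2 \<le> (f x)\<^sup>2 + b * (f' x)\<^sup>2 + c * S x * (f x)\<^sup>2" for x
    using c b_pos S_pos[of x] by simp
qed

text \<open>Multiples of \<open>S\<close> are split off: from \<open>u1\<close> so that the rest is orthogonal to \<open>S\<^sup>2\<close>, from \<open>u2\<close> so
  that the rest vanishes at the origin. Since \<open>(1 - b \<partial>\<^sup>2 + c S) S = (3/2 + c) S\<^sup>2\<close> for every \<open>c\<close>, all
  cross terms are explicit and the form becomes a sum of nonnegative terms.\<close>

lemma
  assumes u1: "classical_H1 u1 u1'" and u2: "classical_H1 u2 u2'"
    and orth: "(LINT x|lborel. u1 x * (S x)\<^sup>2) + 2 * (LINT x|lborel. u2 x * (S x)\<^sup>2) = 0"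
    and N: "N1 > 0" "N2 > 0" "c \<ge> 0" "4 * N1 * (3 / 2 + c) > 3 / 2 * N2"
  shows coercive_form_nonneg: "0 \<le> N1 * form c u1 u1' + N2 * form (-3) u2 u2'"
    and coercive_form_zero: "N1 * form c u1 u1' + N2 * form (-3) u2 u2' = 0 \<Longrightarrow>
      u1 x = 0 \<and> (x \<noteq> 0 \<longrightarrow> u2' x = r x * u2 x)"
proof -
  define I where "I = (LINT x|lborel. S x * (S x)\<^sup>2)"
  have I: "I > 0" using S_cube_integral_pos by (simp add: I_def)
  have Ii: "integrable lborel (\<lambda>x. S x * (S x)\<^sup>2)" by (rule square_S_integrable[OF S_L2])
  \<comment> \<open>\<open>t\<close> is the \<open>S^2\<close>-moment of \<open>u2\<close> in units
    of that of \<open>S\<close>. The constraint makes the moment of \<open>u1\<close> equal to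
    \<open>-2 t I\<close>, hence the multiple \<open>-2 t\<close> of \<open>S\<close> removed from
    \<open>u1\<close>.\<close>
  define t where "t = (LINT x|lborel. u2 x * (S x)\<^sup>2) / I"
  have B: "(LINT x|lborel. u2 x * (S x)\<^sup>2) = t * I" using I by (simp add: t_def)
  have A: "(LINT x|lborel. u1 x * (S x)\<^sup>2) = - 2 * t * I" using orth B by simp
  define h h' where "h = (\<lambda>x. u1 x - (- 2 * t) * S x)" and "h' = (\<lambda>x. u1' x - (- 2 * t) * S' x)"
  \<comment> \<open>Since \<open>S 0 = 1\<close>, removing \<open>e\<close> times \<open>S\<close>
    makes the rest of \<open>u2\<close> vanish at the origin. Its moment \<open>(t - e) I\<close>
    need not be zero and is absorbed by completing a square.\<close>
  define e where "e = u2 0"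
  define g g' where "g = (\<lambda>x. u2 x - e * S x)" and "g' = (\<lambda>x. u2' x - e * S' x)"
  have h: "classical_H1 h h'" unfolding h_def h'_def
    by (intro classical_H1_diff classical_H1_scale u1 S_classical_H1)
  have g: "classical_H1 g g'" unfolding g_def g'_def
    by (intro classical_H1_diff classical_H1_scale u2 S_classical_H1)
  have "(LINT x|lborel. h x * (S x)\<^sup>2) = (LINT x|lborel. u1 x * (S x)\<^sup>2 - (- 2 * t) * (S x * (S x)\<^sup>2))"
    by (intro Bochner_Integration.integral_cong refl) (simp add: h_def algebra_simps)
  also have "\<dots> = 0"
    using square_S_integrable[OF classical_H1_D(2)[OF u1]] Ii A by (simp add: I_def[symmetric])
  finally have hS: "(LINT x|lborel. h x * (S x)\<^sup>2) = 0" .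
  have "(LINT x|lborel. g x * (S x)\<^sup>2) = (LINT x|lborel. u2 x * (S x)\<^sup>2 - e * (S x * (S x)\<^sup>2))"
    by (intro Bochner_Integration.integral_cong refl) (simp add: g_def algebra_simps)
  also have "\<dots> = (t - e) * I"
    using square_S_integrable[OF classical_H1_D(2)[OF u2]] Ii B by (simp add: I_def[symmetric] algebra_simps)
  finally have gS: "(LINT x|lborel. g x * (S x)\<^sup>2) = (t - e) * I" .
  have 1: "form c u1 u1' = form c h h' + (3 / 2 + c) * (4 * t\<^sup>2 * I)"
    using form_add_S[OF h, of c "- 2 * t"] hS by (simp add: h_def h'_def I_def power2_eq_square)
  have 2: "form (-3) u2 u2' = form (-3) g g' + 3 / 2 * I * ((e - t)\<^sup>2 - t\<^sup>2)"
  proof -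
    have "(\<lambda>x. g x + e * S x) = u2" "(\<lambda>x. g' x + e * S' x) = u2'"
      by (simp_all add: g_def g'_def fun_eq_iff)
    from form_add_S[OF g, of "-3" e, unfolded this gS I_def[symmetric]]
    show ?thesis by (simp add: power2_eq_square field_simps)
  qed
  \<comment> \<open>The only negative contribution is \<open>- 3/2 N2 I t^2\<close>, from
    \<open>u2\<close>. The part of \<open>u1\<close> along \<open>S\<close> outweighs it; the factor
    4 there is the square of the coefficient -2 forced by the constraint. This is the origin of the
    last inequality in \<open>N\<close>.\<close>
  have total: "N1 * form c u1 u1' + N2 * form (-3) u2 u2' =
      N1 * form c h h' + N2 * form (-3) g g' + N2 * (3 / 2) * I * (e - t)\<^sup>2
      + (4 * N1 * (3 / 2 + c) - 3 / 2 * N2) * I * t\<^sup>2"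
    unfolding 1 2 by (simp add: algebra_simps)
  have "0 \<le> (LINT x|lborel. (norm (h x))\<^sup>2)" by simp
  then have p1: "0 \<le> form c h h'" using form_lower_bound[OF h N(3)] by linarith
  have g0: "g 0 = 0" by (simp add: g_def e_def S_0)
  have p2: "0 \<le> form (-3) g g'"
    using kdv_form_nonneg[OF g g0] by (simp add: form_def)
  have p3: "0 \<le> N2 * (3 / 2) * I * (e - t)\<^sup>2" "0 \<le> (4 * N1 * (3 / 2 + c) - 3 / 2 * N2) * I * t\<^sup>2"
    using N I by simp_all
  show "0 \<le> N1 * form c u1 u1' + N2 * form (-3) u2 u2'"
    unfolding total using p1 p2 p3 N by simp
  assume "N1 * form c u1 u1' + N2 * form (-3) u2 u2' = 0"
  then have z: "N1 * form c h h' = 0" "N2 * form (-3) g g' = 0" "N2 * (3 / 2) * I * (e - t)\<^sup>2 = 0"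
      "(4 * N1 * (3 / 2 + c) - 3 / 2 * N2) * I * t\<^sup>2 = 0"
    unfolding total using p3 mult_nonneg_nonneg[OF less_imp_le[OF N(1)] p1]
      mult_nonneg_nonneg[OF less_imp_le[OF N(2)] p2] by linarith+
  have t: "t = 0" using z(4) N(4) I by simp
  have e: "e = 0" using z(3) N I t by simp
  have "(LINT x|lborel. (norm (h x))\<^sup>2) = 0"
  proof -
    have "form c h h' = 0" using z(1) N(1) by simp
    then show ?thesis
      using form_lower_bound[OF h N(3)] \<open>0 \<le> (LINT x|lborel. (norm (h x))\<^sup>2)\<close> by linarith
  qed
  then have "h x = 0"
    using integral_square_zero_imp_zero[OF classical_H1_D(2)[OF h]] by blast
  moreover have "x \<noteq> 0 \<Longrightarrow> g' x = r x * g x"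
  proof (rule kdv_form_zero[OF g g0])
    have "form (-3) g g' = 0" using z(2) N(2) by simp
    then show "(LINT x|lborel. (g x)\<^sup>2 + b * (g' x)\<^sup>2 - 3 * S x * (g x)\<^sup>2) = 0"
      by (simp add: form_def)
  qed
  ultimately show "u1 x = 0 \<and> (x \<noteq> 0 \<longrightarrow> u2' x = r x * u2 x)"
    by (simp add: h_def g_def g'_def t e)
qed

text \<open>Integrate by parts against \<open>S'\<close>, which is in the kernel of \<open>1 - b \<partial>\<^sup>2 - 3 S\<close>.\<close>

lemma derivative_orthogonal_S_square:
  fixes W u :: "real \<Rightarrow> real"
  assumes W: "classical_H1 W W'" "classical_H1 W' W''" and u: "classical_H1 u u'" "classical_H1 u' u''"
    and eq: "\<And>x. W x - b * W'' x = N * (u x - b * u'' x - 3 * S x * u x)"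
  shows "(LINT x|lborel. W' x * (S x)\<^sup>2) = 0"
proof -
  note WD = classical_H1_D[OF W(1)] classical_H1_D[OF W(2)]
  note uD = classical_H1_D[OF u(1)] classical_H1_D[OF u(2)]
  \<comment> \<open>The derivative of \<open>F\<close> is \<open>3/2 W' S^2\<close> plus
    \<open>S'\<close> times the residual of \<open>eq\<close>. The terms with \<open>b\<close> are
    Wronskians of \<open>S'\<close> with \<open>W\<close> and with \<open>u\<close>; the equation
    for \<open>S'''\<close> accounts for the rest.\<close>
  define F where "F = (\<lambda>x. 3 / 2 * (W x * (S x)\<^sup>2) + b * (W x * S'' x) - b * (W' x * S' x)
      - N * b * (u x * S'' x - u' x * S' x))"
  have D: "(S has_vector_derivative S' x) (at x)" "(S' has_vector_derivative S'' x) (at x)"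
      "(S'' has_vector_derivative S''' x) (at x)" for x
    using S_classical_H1 by (auto simp: classical_H1_def)
  have int: "integrable lborel F"
    unfolding F_def
    using square_S_integrable[OF WD(2)] L2_continuous_mult_integrable[OF WD(2) classical_H1_D(3)[OF S_classical_H1(2)]]
      L2_continuous_mult_integrable[OF WD(3) classical_H1_D(3)[OF S_classical_H1(1)]]
      L2_continuous_mult_integrable[OF uD(2) classical_H1_D(3)[OF S_classical_H1(2)]]
      L2_continuous_mult_integrable[OF uD(3) classical_H1_D(3)[OF S_classical_H1(1)]]
    by simp
  have "(LINT x|lborel. 3 / 2 * (W' x * (S x)\<^sup>2)) = 0"
  proof (rule integral_derivative_zero[OF _ _ int])
    show "continuous_on UNIV (\<lambda>x. 3 / 2 * (W' x * (S x)\<^sup>2))"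
      by (intro continuous_intros WD S_continuous)
    show "integrable lborel (\<lambda>x. 3 / 2 * (W' x * (S x)\<^sup>2))"
      using square_S_integrable[OF WD(3)] by simp
    fix x
    have "(F has_vector_derivative 3 / 2 * (W' x * (S x)\<^sup>2 + W x * (2 * S x * S' x))
        + b * (W x * S''' x + W' x * S'' x) - b * (W' x * S'' x + W'' x * S' x)
        - N * b * ((u x * S''' x + u' x * S'' x) - (u' x * S'' x + u'' x * S' x))) (at x)"
    proof -
      note d = WD(1) WD(6) uD(1) uD(6) D
      note d = d[folded has_real_derivative_iff_has_vector_derivative]
      have "((\<lambda>x. W x * (S x)\<^sup>2) has_real_derivative W x * (2 * S x * S' x) + W' x * (S x)\<^sup>2) (at x)"
        by (rule DERIV_mult'[OF d(1)]) (auto intro!: derivative_eq_intros d)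
      then have "((\<lambda>x. W x * (S x)\<^sup>2) has_real_derivative W' x * (S x)\<^sup>2 + W x * (2 * S x * S' x)) (at x)"
        by (simp only: add.commute)
      then show ?thesis
        unfolding F_def has_real_derivative_iff_has_vector_derivative[symmetric]
        by (intro DERIV_add DERIV_diff DERIV_cmult DERIV_mult' d)
    qed
    also have "3 / 2 * (W' x * (S x)\<^sup>2 + W x * (2 * S x * S' x))
        + b * (W x * S''' x + W' x * S'' x) - b * (W' x * S'' x + W'' x * S' x)
        - N * b * ((u x * S''' x + u' x * S'' x) - (u' x * S'' x + u'' x * S' x)) =
        3 / 2 * (W' x * (S x)\<^sup>2) + 3 * W x * S x * S' x + W x * (b * S''' x) - b * W'' x * S' x
        - N * (u x * (b * S''' x) - b * u'' x * S' x)"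
      by (simp add: algebra_simps)
    also have "\<dots> = 3 / 2 * (W' x * (S x)\<^sup>2) + (W x - b * W'' x - N * (u x - b * u'' x - 3 * S x * u x)) * S' x"
      unfolding profile_equation' by (simp add: algebra_simps)
    also have "\<dots> = 3 / 2 * (W' x * (S x)\<^sup>2)"
      using eq[of x] by simp
    finally show "(F has_vector_derivative 3 / 2 * (W' x * (S x)\<^sup>2)) (at x)" .
  qed
  then show ?thesis by simp
qed


section \<open>The decoupled operators on classical functions\<close>

lemma operator_mult_integrable:
  fixes f :: "real \<Rightarrow> real"
  assumes f: "classical_H1 f f'" "classical_H1 f' f''" and g: "L2_continuous g"
  shows "integrable lborel (\<lambda>x. (f x - b * f'' x + c * S x * f x) * g x)"
proof -
  note fD = classical_H1_D[OF f(1)] classical_H1_D[OF f(2)]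
  have "integrable lborel (\<lambda>x. f x * g x - b * (f'' x * g x) + c * (S x * f x * g x))"
    using L2_continuous_mult_integrable[OF fD(2) g] L2_continuous_mult_integrable[OF fD(8) g]
      L2_continuous_mult_integrable[OF S_mult_L2[OF fD(2)] g] by simp
  then show ?thesis by (simp add: algebra_simps)
qed

lemma operator_integral:
  fixes f g :: "real \<Rightarrow> real"
  assumes f: "classical_H1 f f'" "classical_H1 f' f''" and g: "classical_H1 g g'"
  shows "(LINT x|lborel. (f x - b * f'' x + c * S x * f x) * g x) =
    (LINT x|lborel. f x * g x + b * (f' x * g' x) + c * (S x * f x * g x))"
proof -
  note fD = classical_H1_D[OF f(1)] classical_H1_D[OF f(2)]
  note gD = classical_H1_D[OF g]
  note i = L2_continuous_mult_integrable[OF fD(2) gD(2)] L2_continuous_mult_integrable[OF S_mult_L2[OF fD(2)] gD(2)]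
  note parts = integral_by_parts[OF f(2) g]
  have "(LINT x|lborel. (f x - b * f'' x + c * S x * f x) * g x) =
      (LINT x|lborel. f x * g x - b * (f'' x * g x) + c * (S x * f x * g x))"
    by (intro Bochner_Integration.integral_cong refl) (simp add: algebra_simps)
  also have "\<dots> = (LINT x|lborel. f x * g x) - b * (LINT x|lborel. f'' x * g x) + c * (LINT x|lborel. S x * f x * g x)"
    using i parts(1) by simp
  also have "\<dots> = (LINT x|lborel. f x * g x) + b * (LINT x|lborel. f' x * g' x) + c * (LINT x|lborel. S x * f x * g x)"
    unfolding parts(3) by simp
  also have "\<dots> = (LINT x|lborel. f x * g x + b * (f' x * g' x) + c * (S x * f x * g x))"
    using i parts(2) by simp
  finally show ?thesis .
qed

lemma operator_form:
  fixes f :: "real \<Rightarrow> real"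
  assumes "classical_H1 f f'" "classical_H1 f' f''"
  shows "(LINT x|lborel. (f x - b * f'' x + c * S x * f x) * f x) = form c f f'"
  unfolding operator_integral[OF assms(1,2,1)] form_def
  by (intro Bochner_Integration.integral_cong refl) (simp add: power2_eq_square)

lemma operator_symmetric:
  fixes f g :: "real \<Rightarrow> real"
  assumes f: "classical_H1 f f'" "classical_H1 f' f''" and g: "classical_H1 g g'" "classical_H1 g' g''"
  shows "(LINT x|lborel. (f x - b * f'' x + c * S x * f x) * g x) =
    (LINT x|lborel. (g x - b * g'' x + c * S x * g x) * f x)"
  unfolding operator_integral[OF f g(1)] operator_integral[OF g f(1)]
  by (intro Bochner_Integration.integral_cong refl) (simp add: mult_ac)

lemma helmholtz_injective:
  fixes W :: "real \<Rightarrow> real"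
  assumes W: "classical_H1 W W'" "classical_H1 W' W''" and eq: "\<And>x. W x - b * W'' x = 0"
  shows "W x = 0"
proof -
  have "0 = (LINT x|lborel. (W x - b * W'' x + 0 * S x * W x) * W x)"
    by (simp add: eq)
  then have 0: "form 0 W W' = 0"
    using operator_form[OF W, of 0] by simp
  have "0 \<le> (LINT x|lborel. (norm (W x))\<^sup>2)"
    by (rule Bochner_Integration.integral_nonneg) simp
  with form_lower_bound[OF W(1), of 0] 0 have "(LINT x|lborel. (norm (W x))\<^sup>2) = 0"
    by linarith
  with classical_H1_D(2)[OF W(1)] show ?thesis
    by (rule integral_square_zero_imp_zero)
qed

text \<open>Skewness of \<open>J\<close> in the decoupled variables: the rows \<open>(2, -1)\<close>
  and \<open>(-1, -4)\<close> form a symmetric matrix, so the integrand is an exact derivative.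
  \<open>F\<close> is the quadratic form of half this matrix at \<open>(V, W)\<close> minus
  \<open>b\<close> times the same form at \<open>(V', W')\<close>.\<close>

lemma skew_integral:
  fixes V W :: "real \<Rightarrow> real"
  assumes V: "classical_H1 V V'" "classical_H1 V' V''" and W: "classical_H1 W W'" "classical_H1 W' W''"
  shows "integrable lborel (\<lambda>x. (V x - b * V'' x) * (2 * V' x - W' x) - (W x - b * W'' x) * (V' x + 4 * W' x))"
    and "(LINT x|lborel. (V x - b * V'' x) * (2 * V' x - W' x) - (W x - b * W'' x) * (V' x + 4 * W' x)) = 0"
proof -
  note VD = classical_H1_D[OF V(1)] classical_H1_D[OF V(2)]
  note WD = classical_H1_D[OF W(1)] classical_H1_D[OF W(2)]
  have L2: "L2_continuous (\<lambda>x. V x - b * V'' x)" "L2_continuous (\<lambda>x. W x - b * W'' x)"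
    "L2_continuous (\<lambda>x. 2 * V' x - W' x)" "L2_continuous (\<lambda>x. V' x + 4 * W' x)"
    by (intro L2_continuous_diff L2_continuous_add L2_continuous_scale VD WD)+
  show int: "integrable lborel (\<lambda>x. (V x - b * V'' x) * (2 * V' x - W' x) - (W x - b * W'' x) * (V' x + 4 * W' x))"
    by (intro Bochner_Integration.integrable_diff L2_continuous_mult_integrable L2)
  define F where "F = (\<lambda>x. (V x * V x - V x * W x - 2 * (W x * W x)) - b * (V' x * V' x - V' x * W' x - 2 * (W' x * W' x)))"
  show "(LINT x|lborel. (V x - b * V'' x) * (2 * V' x - W' x) - (W x - b * W'' x) * (V' x + 4 * W' x)) = 0"
  proof (rule integral_derivative_zero[OF _ _ _ int])
    show "integrable lborel F" unfolding F_def
      by (intro Bochner_Integration.integrable_diff integrable_mult_right L2_continuous_mult_integrable VD WD)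
    show "continuous_on UNIV (\<lambda>x. (V x - b * V'' x) * (2 * V' x - W' x) - (W x - b * W'' x) * (V' x + 4 * W' x))"
      by (intro continuous_intros VD WD)
    fix x
    note d = VD(1) VD(6) WD(1) WD(6)
    note d = d[folded has_real_derivative_iff_has_vector_derivative]
    have "(F has_real_derivative
        ((V x * V' x + V' x * V x) - (V x * W' x + V' x * W x) - 2 * (W x * W' x + W' x * W x)) -
        b * ((V' x * V'' x + V'' x * V' x) - (V' x * W'' x + V'' x * W' x) - 2 * (W' x * W'' x + W'' x * W' x))) (at x)"
      unfolding F_def by (intro DERIV_diff DERIV_cmult DERIV_mult' d)
    then show "(F has_vector_derivative
        (V x - b * V'' x) * (2 * V' x - W' x) - (W x - b * W'' x) * (V' x + 4 * W' x)) (at x)"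
      unfolding has_real_derivative_iff_has_vector_derivative[symmetric]
      by (rule back_subst[where P = "\<lambda>d. (F has_real_derivative d) (at x)"]) algebra
  qed
qed

text \<open>Differentiating \<open>v' = r v\<close> gives \<open>v'' = (r' + r^2) v\<close>, and the
  Riccati equation turns the bracket into \<open>(1 - 3 S) / b\<close>. The origin follows by
  continuity. There is no need to identify \<open>v\<close> as a multiple of
  \<open>S'\<close>.\<close>

lemma zero_mode_equation:
  fixes v :: "real \<Rightarrow> real"
  assumes v: "classical_H1 v v'" "classical_H1 v' v''" and r: "\<And>x. x \<noteq> 0 \<Longrightarrow> v' x = r x * v x"
  shows "v x - b * v'' x - 3 * S x * v x = 0"
proof -
  note vD = classical_H1_D[OF v(1)] classical_H1_D[OF v(2)]
  note d = vD(1) vD(6)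
  note d = d[folded has_real_derivative_iff_has_vector_derivative]
  have off: "v x - b * v'' x - 3 * S x * v x = 0" if x: "x \<noteq> 0" for x
  proof -
    have "((\<lambda>x. r x * v x) has_real_derivative r x * v' x + ((1 - 3 * S x) / b - (r x)\<^sup>2) * v x) (at x)"
      by (intro DERIV_mult' r_derivative x d)
    then have "(v' has_real_derivative r x * v' x + ((1 - 3 * S x) / b - (r x)\<^sup>2) * v x) (at x)"
      by (rule has_field_derivative_transform_within_open[where S = "- {0}"]) (use r x in auto)
    with d(2) have "v'' x = r x * v' x + ((1 - 3 * S x) / b - (r x)\<^sup>2) * v x"
      by (rule DERIV_unique)
    then have "v'' x = (1 - 3 * S x) / b * v x"
      using r[OF x] by (simp add: power2_eq_square algebra_simps)
    then show ?thesis using b_pos by (simp add: field_simps)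
  qed
  show ?thesis
  proof (cases "x = 0")
    case True
    have "continuous_on UNIV (\<lambda>x. v x - b * v'' x - 3 * S x * v x)"
      by (intro continuous_intros vD S_continuous)
    then have "((\<lambda>x. v x - b * v'' x - 3 * S x * v x) \<longlongrightarrow> v 0 - b * v'' 0 - 3 * S 0 * v 0) (at 0)"
      by (simp add: continuous_on_def)
    moreover have "((\<lambda>x. v x - b * v'' x - 3 * S x * v x) \<longlongrightarrow> 0) (at 0)"
      by (rule tendsto_eventually) (use off in \<open>auto simp: eventually_at_filter\<close>)
    ultimately have "v 0 - b * v'' 0 - 3 * S 0 * v 0 = 0"
      by (rule tendsto_unique[rotated]) simp
    then show ?thesis using True by simp
  qed (rule off)
qed

lemma classical_H1_zero_deriv:
  assumes "classical_H1 f f'" "\<And>x. f x = 0"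
  shows "f' x = 0"
proof -
  have "f = (\<lambda>x. 0)" using assms(2) by auto
  then show ?thesis
    using classical_H1_D(1)[OF assms(1), of x] vector_derivative_unique_at has_vector_derivative_const by blast
qed

text \<open>The eigenvalue problem in decoupled form: the \<open>W\<close> are potentials with
  \<open>T W = L u\<close>, and \<open>\<mu> u = J L u\<close> becomes
  \<open>\<mu> u = \<kappa> P W'\<close>, where \<open>P\<close> is the symmetric matrix with rows
  \<open>(2, -1)\<close> and \<open>(-1, -4)\<close>. The forms are real, so everything is split
  into real and imaginary parts, on which \<open>\<mu>\<close> acts through \<open>\<alpha>\<close>
  and \<open>\<gamma>\<close>.\<close>

lemma no_unstable_mode:
  fixes u1 u2 W1 W2 u1' u2' W1' W2' u1'' u2'' W1'' W2'' :: "real \<Rightarrow> complex" and \<mu> :: complex and \<kappa> c N1 N2 :: real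
  assumes u1: "classical_H1 u1 u1'" "classical_H1 u1' u1''" and u2: "classical_H1 u2 u2'" "classical_H1 u2' u2''"
    and W1: "classical_H1 W1 W1'" "classical_H1 W1' W1''" and W2: "classical_H1 W2 W2'" "classical_H1 W2' W2''"
    and eq1: "\<And>x. W1 x - b * W1'' x = N1 * (u1 x - b * u1'' x + c * S x * u1 x)"
    and eq2: "\<And>x. W2 x - b * W2'' x = N2 * (u2 x - b * u2'' x - 3 * S x * u2 x)"
    and d1: "\<And>x. \<mu> * u1 x = \<kappa> * (2 * W1' x - W2' x)"
    and d2: "\<And>x. \<mu> * u2 x = - \<kappa> * (W1' x + 4 * W2' x)"
    and \<mu>: "Re \<mu> > 0"
    and N: "N1 > 0" "N2 > 0" "c \<ge> 0" "4 * N1 * (3 / 2 + c) > 3 / 2 * N2"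
  shows "u1 x = 0 \<and> u2 x = 0"
proof -
  note u1R = classical_H1_Re_Im(1)[OF u1(1)] classical_H1_Re_Im(1)[OF u1(2)]
  note u1I = classical_H1_Re_Im(2)[OF u1(1)] classical_H1_Re_Im(2)[OF u1(2)]
  note u2R = classical_H1_Re_Im(1)[OF u2(1)] classical_H1_Re_Im(1)[OF u2(2)]
  note u2I = classical_H1_Re_Im(2)[OF u2(1)] classical_H1_Re_Im(2)[OF u2(2)]
  note W1R = classical_H1_Re_Im(1)[OF W1(1)] classical_H1_Re_Im(1)[OF W1(2)]
  note W1I = classical_H1_Re_Im(2)[OF W1(1)] classical_H1_Re_Im(2)[OF W1(2)]
  note W2R = classical_H1_Re_Im(1)[OF W2(1)] classical_H1_Re_Im(1)[OF W2(2)]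
  note W2I = classical_H1_Re_Im(2)[OF W2(1)] classical_H1_Re_Im(2)[OF W2(2)]
  define \<alpha> \<gamma> where "\<alpha> = Re \<mu>" and "\<gamma> = Im \<mu>"
  have eq1R: "Re (W1 x) - b * Re (W1'' x) = N1 * (Re (u1 x) - b * Re (u1'' x) + c * S x * Re (u1 x))" for x
    using arg_cong[OF eq1[of x], of Re] by simp
  have eq1I: "Im (W1 x) - b * Im (W1'' x) = N1 * (Im (u1 x) - b * Im (u1'' x) + c * S x * Im (u1 x))" for x
    using arg_cong[OF eq1[of x], of Im] by simp
  have eq2R: "Re (W2 x) - b * Re (W2'' x) = N2 * (Re (u2 x) - b * Re (u2'' x) - 3 * S x * Re (u2 x))" for x
    using arg_cong[OF eq2[of x], of Re] by simp
  have eq2I: "Im (W2 x) - b * Im (W2'' x) = N2 * (Im (u2 x) - b * Im (u2'' x) - 3 * S x * Im (u2 x))" for x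
    using arg_cong[OF eq2[of x], of Im] by simp
  have d1R: "\<alpha> * Re (u1 x) - \<gamma> * Im (u1 x) = \<kappa> * (2 * Re (W1' x) - Re (W2' x))" for x
    using arg_cong[OF d1[of x], of Re] by (simp add: \<alpha>_def \<gamma>_def)
  have d1I: "\<alpha> * Im (u1 x) + \<gamma> * Re (u1 x) = \<kappa> * (2 * Im (W1' x) - Im (W2' x))" for x
    using arg_cong[OF d1[of x], of Im] by (simp add: \<alpha>_def \<gamma>_def)
  have d2R: "\<alpha> * Re (u2 x) - \<gamma> * Im (u2 x) = - \<kappa> * (Re (W1' x) + 4 * Re (W2' x))" for x
    using arg_cong[OF d2[of x], of Re] by (simp add: \<alpha>_def \<gamma>_def)
  have d2I: "\<alpha> * Im (u2 x) + \<gamma> * Re (u2 x) = - \<kappa> * (Im (W1' x) + 4 * Im (W2' x))" for x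
    using arg_cong[OF d2[of x], of Im] by (simp add: \<alpha>_def \<gamma>_def)

  define o1 where "o1 = (\<lambda>f f'' :: real \<Rightarrow> real. \<lambda>x. f x - b * f'' x + c * S x * f x)"
  define o2 where "o2 = (\<lambda>f f'' :: real \<Rightarrow> real. \<lambda>x. f x - b * f'' x + (-3) * S x * f x)"
  let ?u1R = "\<lambda>x. Re (u1 x)" and ?u1I = "\<lambda>x. Im (u1 x)" and ?u2R = "\<lambda>x. Re (u2 x)" and ?u2I = "\<lambda>x. Im (u2 x)"
  let ?u1R' = "\<lambda>x. Re (u1' x)" and ?u1I' = "\<lambda>x. Im (u1' x)" and ?u2R' = "\<lambda>x. Re (u2' x)" and ?u2I' = "\<lambda>x. Im (u2' x)"
  let ?u1R'' = "\<lambda>x. Re (u1'' x)" and ?u1I'' = "\<lambda>x. Im (u1'' x)" and ?u2R'' = "\<lambda>x. Re (u2'' x)" and ?u2I'' = "\<lambda>x. Im (u2'' x)"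
  have int1: "integrable lborel (\<lambda>x. o1 f f'' x * g x)"
    if "classical_H1 f f'" "classical_H1 f' f''" "classical_H1 g g'" for f f' f'' g g'
    unfolding o1_def by (rule operator_mult_integrable[OF that(1,2) classical_H1_D(2)[OF that(3)]])
  have int2: "integrable lborel (\<lambda>x. o2 f f'' x * g x)"
    if "classical_H1 f f'" "classical_H1 f' f''" "classical_H1 g g'" for f f' f'' g g'
    unfolding o2_def by (rule operator_mult_integrable[OF that(1,2) classical_H1_D(2)[OF that(3)]])
  note ints = int1[OF u1R u1R(1)] int1[OF u1I u1I(1)] int1[OF u1R u1I(1)] int1[OF u1I u1R(1)]
    int2[OF u2R u2R(1)] int2[OF u2I u2I(1)] int2[OF u2R u2I(1)] int2[OF u2I u2R(1)]
  define QR where "QR = N1 * form c ?u1R ?u1R' + N2 * form (-3) ?u2R ?u2R'"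
  define QI where "QI = N1 * form c ?u1I ?u1I' + N2 * form (-3) ?u2I ?u2I'"
  \<comment> \<open>\<open>T W\<close> is paired with \<open>\<mu> u = \<kappa> P W'\<close>. One
    side is zero by skewness; on the other the \<open>\<alpha>\<close> terms are the two energies
    and the \<open>\<gamma>\<close> terms cancel because the operators are symmetric. As
    \<open>\<alpha> > 0\<close>, the energies add up to 0.\<close>
  have "0 = \<kappa> * (0 + 0)" by simp
  also have "\<dots> = (LINT x|lborel. \<kappa> *
     (((Re (W1 x) - b * Re (W1'' x)) * (2 * Re (W1' x) - Re (W2' x)) - (Re (W2 x) - b * Re (W2'' x)) * (Re (W1' x) + 4 * Re (W2' x)))
    + ((Im (W1 x) - b * Im (W1'' x)) * (2 * Im (W1' x) - Im (W2' x)) - (Im (W2 x) - b * Im (W2'' x)) * (Im (W1' x) + 4 * Im (W2' x)))))"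
    using skew_integral[OF W1R W2R] skew_integral[OF W1I W2I]
    by (subst integral_mult_right_zero, subst Bochner_Integration.integral_add) simp_all
  also have "\<dots> = (LINT x|lborel. \<alpha> * (N1 * (o1 ?u1R ?u1R'' x * ?u1R x + o1 ?u1I ?u1I'' x * ?u1I x)
        + N2 * (o2 ?u2R ?u2R'' x * ?u2R x + o2 ?u2I ?u2I'' x * ?u2I x))
      + \<gamma> * (N1 * (o1 ?u1I ?u1I'' x * ?u1R x - o1 ?u1R ?u1R'' x * ?u1I x)
        + N2 * (o2 ?u2I ?u2I'' x * ?u2R x - o2 ?u2R ?u2R'' x * ?u2I x)))"
  proof (intro Bochner_Integration.integral_cong refl)
    fix x
    have "\<kappa> *
     (((Re (W1 x) - b * Re (W1'' x)) * (2 * Re (W1' x) - Re (W2' x)) - (Re (W2 x) - b * Re (W2'' x)) * (Re (W1' x) + 4 * Re (W2' x)))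
    + ((Im (W1 x) - b * Im (W1'' x)) * (2 * Im (W1' x) - Im (W2' x)) - (Im (W2 x) - b * Im (W2'' x)) * (Im (W1' x) + 4 * Im (W2' x))))
      = (Re (W1 x) - b * Re (W1'' x)) * (\<alpha> * Re (u1 x) - \<gamma> * Im (u1 x))
      + (Re (W2 x) - b * Re (W2'' x)) * (\<alpha> * Re (u2 x) - \<gamma> * Im (u2 x))
      + (Im (W1 x) - b * Im (W1'' x)) * (\<alpha> * Im (u1 x) + \<gamma> * Re (u1 x))
      + (Im (W2 x) - b * Im (W2'' x)) * (\<alpha> * Im (u2 x) + \<gamma> * Re (u2 x))"
      unfolding d1R d1I d2R d2I by algebra
    also have "\<dots> = \<alpha> * (N1 * (o1 ?u1R ?u1R'' x * ?u1R x + o1 ?u1I ?u1I'' x * ?u1I x)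
        + N2 * (o2 ?u2R ?u2R'' x * ?u2R x + o2 ?u2I ?u2I'' x * ?u2I x))
      + \<gamma> * (N1 * (o1 ?u1I ?u1I'' x * ?u1R x - o1 ?u1R ?u1R'' x * ?u1I x)
        + N2 * (o2 ?u2I ?u2I'' x * ?u2R x - o2 ?u2R ?u2R'' x * ?u2I x))"
      unfolding eq1R eq1I eq2R eq2I o1_def o2_def by algebra
    finally show "\<kappa> *
     (((Re (W1 x) - b * Re (W1'' x)) * (2 * Re (W1' x) - Re (W2' x)) - (Re (W2 x) - b * Re (W2'' x)) * (Re (W1' x) + 4 * Re (W2' x)))
    + ((Im (W1 x) - b * Im (W1'' x)) * (2 * Im (W1' x) - Im (W2' x)) - (Im (W2 x) - b * Im (W2'' x)) * (Im (W1' x) + 4 * Im (W2' x))))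
      = \<alpha> * (N1 * (o1 ?u1R ?u1R'' x * ?u1R x + o1 ?u1I ?u1I'' x * ?u1I x)
        + N2 * (o2 ?u2R ?u2R'' x * ?u2R x + o2 ?u2I ?u2I'' x * ?u2I x))
      + \<gamma> * (N1 * (o1 ?u1I ?u1I'' x * ?u1R x - o1 ?u1R ?u1R'' x * ?u1I x)
        + N2 * (o2 ?u2I ?u2I'' x * ?u2R x - o2 ?u2R ?u2R'' x * ?u2I x))" .
  qed
  also have "\<dots> = \<alpha> * (N1 * ((LINT x|lborel. o1 ?u1R ?u1R'' x * ?u1R x) + (LINT x|lborel. o1 ?u1I ?u1I'' x * ?u1I x))
        + N2 * ((LINT x|lborel. o2 ?u2R ?u2R'' x * ?u2R x) + (LINT x|lborel. o2 ?u2I ?u2I'' x * ?u2I x)))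
      + \<gamma> * (N1 * ((LINT x|lborel. o1 ?u1I ?u1I'' x * ?u1R x) - (LINT x|lborel. o1 ?u1R ?u1R'' x * ?u1I x))
        + N2 * ((LINT x|lborel. o2 ?u2I ?u2I'' x * ?u2R x) - (LINT x|lborel. o2 ?u2R ?u2R'' x * ?u2I x)))"
    using ints
    by (simp only: Bochner_Integration.integral_add Bochner_Integration.integral_diff
        Bochner_Integration.integrable_add Bochner_Integration.integrable_diff
        integral_mult_right_zero Bochner_Integration.integrable_mult_right)
  also have "\<dots> = \<alpha> * (QR + QI)"
    unfolding o1_def o2_def QR_def QI_def
      operator_form[OF u1R] operator_form[OF u1I] operator_form[OF u2R] operator_form[OF u2I]
      operator_symmetric[OF u1I u1R] operator_symmetric[OF u2I u2R]
    by (simp add: algebra_simps)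
  finally have Q: "QR + QI = 0"
    using \<mu> by (simp add: \<alpha>_def)

  have sq: "integrable lborel (\<lambda>x. f x * (S x)\<^sup>2)" if "classical_H1 f f'" for f f'
    by (rule square_S_integrable[OF classical_H1_D(2)[OF that]])
  note sqs = sq[OF u1R(1)] sq[OF u1I(1)] sq[OF u2R(1)] sq[OF u2I(1)]
  define AR where "AR = (LINT x|lborel. ?u1R x * (S x)\<^sup>2) + 2 * (LINT x|lborel. ?u2R x * (S x)\<^sup>2)"
  define AI where "AI = (LINT x|lborel. ?u1I x * (S x)\<^sup>2) + 2 * (LINT x|lborel. ?u2I x * (S x)\<^sup>2)"
  have AR': "AR = (LINT x|lborel. ?u1R x * (S x)\<^sup>2 + 2 * (?u2R x * (S x)\<^sup>2))"
    and AI': "AI = (LINT x|lborel. ?u1I x * (S x)\<^sup>2 + 2 * (?u2I x * (S x)\<^sup>2))"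
    using sqs by (simp_all add: AR_def AI_def)
  \<comment> \<open>In \<open>u1 + 2 u2\<close> the potential \<open>W1\<close> drops out and
    \<open>-9 \<kappa> W2'\<close> is left. Its \<open>S^2\<close>-moment vanishes because
    \<open>W2\<close> belongs to the operator with zero mode \<open>S'\<close>.\<close>
  have "\<alpha> * AR - \<gamma> * AI = (LINT x|lborel. \<alpha> * (?u1R x * (S x)\<^sup>2 + 2 * (?u2R x * (S x)\<^sup>2)) - \<gamma> * (?u1I x * (S x)\<^sup>2 + 2 * (?u2I x * (S x)\<^sup>2)))"
    unfolding AR' AI' using sqs by simp
  also have "\<dots> = (LINT x|lborel. - 9 * \<kappa> * (Re (W2' x) * (S x)\<^sup>2))"
  proof (intro Bochner_Integration.integral_cong refl)
    show "\<alpha> * (?u1R x * (S x)\<^sup>2 + 2 * (?u2R x * (S x)\<^sup>2)) - \<gamma> * (?u1I x * (S x)\<^sup>2 + 2 * (?u2I x * (S x)\<^sup>2)) =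
        - 9 * \<kappa> * (Re (W2' x) * (S x)\<^sup>2)" for x
      using d1R[of x] d2R[of x] by algebra
  qed
  also have "\<dots> = 0"
    by (simp only: integral_mult_right_zero derivative_orthogonal_S_square[OF W2R u2R eq2R] mult_zero_right)
  finally have A1: "\<alpha> * AR - \<gamma> * AI = 0" .
  have "\<alpha> * AI + \<gamma> * AR = (LINT x|lborel. \<alpha> * (?u1I x * (S x)\<^sup>2 + 2 * (?u2I x * (S x)\<^sup>2)) + \<gamma> * (?u1R x * (S x)\<^sup>2 + 2 * (?u2R x * (S x)\<^sup>2)))"
    unfolding AR' AI' using sqs by simp
  also have "\<dots> = (LINT x|lborel. - 9 * \<kappa> * (Im (W2' x) * (S x)\<^sup>2))"
  proof (intro Bochner_Integration.integral_cong refl)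
    show "\<alpha> * (?u1I x * (S x)\<^sup>2 + 2 * (?u2I x * (S x)\<^sup>2)) + \<gamma> * (?u1R x * (S x)\<^sup>2 + 2 * (?u2R x * (S x)\<^sup>2)) =
        - 9 * \<kappa> * (Im (W2' x) * (S x)\<^sup>2)" for x
      using d1I[of x] d2I[of x] by algebra
  qed
  also have "\<dots> = 0"
    by (simp only: integral_mult_right_zero derivative_orthogonal_S_square[OF W2I u2I eq2I] mult_zero_right)
  finally have A2: "\<alpha> * AI + \<gamma> * AR = 0" .
  \<comment> \<open>The two relations are the real and imaginary parts of \<open>\<mu>\<close> times
    the complex moment with parts \<open>AR\<close> and \<open>AI\<close>.\<close>
  have "\<alpha>\<^sup>2 + \<gamma>\<^sup>2 > 0"
    using \<mu> by (simp add: \<alpha>_def sum_power2_gt_zero_iff)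
  moreover have "(\<alpha>\<^sup>2 + \<gamma>\<^sup>2) * AR = 0" "(\<alpha>\<^sup>2 + \<gamma>\<^sup>2) * AI = 0"
    using A1 A2 by algebra+
  ultimately have A: "AR = 0" "AI = 0" by auto

  have "QR \<ge> 0" "QI \<ge> 0"
    using coercive_form_nonneg[OF u1R(1) u2R(1) _ N] coercive_form_nonneg[OF u1I(1) u2I(1) _ N] A
    by (simp_all add: QR_def QI_def AR_def AI_def)
  with Q have "QR = 0" "QI = 0" by simp_all
  then have zR: "Re (u1 x) = 0 \<and> (x \<noteq> 0 \<longrightarrow> Re (u2' x) = r x * Re (u2 x))"
    and zI: "Im (u1 x) = 0 \<and> (x \<noteq> 0 \<longrightarrow> Im (u2' x) = r x * Im (u2 x))" for x
    using coercive_form_zero[OF u1R(1) u2R(1) _ N, of x] coercive_form_zero[OF u1I(1) u2I(1) _ N, of x] A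
    by (simp_all add: QR_def QI_def AR_def AI_def)
  have 0: "u1 x = 0" for x
    using zR zI by (simp add: complex_eq_iff)
  have "u1'' x = 0" for x
    using classical_H1_zero_deriv[OF u1(2) classical_H1_zero_deriv[OF u1(1) 0]] .
  then have T1: "Re (W1 x) - b * Re (W1'' x) = 0" "Im (W1 x) - b * Im (W1'' x) = 0" for x
    unfolding eq1R eq1I by (simp_all add: 0)
  have T2: "Re (W2 x) - b * Re (W2'' x) = 0" "Im (W2 x) - b * Im (W2'' x) = 0" for x
    unfolding eq2R eq2I
    using zero_mode_equation[OF u2R, of x] zero_mode_equation[OF u2I, of x] zR zI by simp_all
  have "W1 x = 0" "W2 x = 0" for x
    using helmholtz_injective[OF W1R T1(1)] helmholtz_injective[OF W1I T1(2)]
      helmholtz_injective[OF W2R T2(1)] helmholtz_injective[OF W2I T2(2)]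
    by (simp_all add: complex_eq_iff)
  then have "W1' x = 0" "W2' x = 0" for x
    using classical_H1_zero_deriv[OF W1(1)] classical_H1_zero_deriv[OF W2(1)] by blast+
  then have "\<mu> * u2 x = 0" using d2[of x] by simp
  then show ?thesis using 0 \<mu> by auto
qed

end

subsection \<open>Regularity of eigenfunctions\<close>

lemma L2_continuousI:
  assumes "f \<in> L2" "continuous_on UNIV F" "AE x in lborel. F x = f x"
  shows "L2_continuous F"
proof -
  have i: "integrable lborel (\<lambda>x. (cmod (f x))\<^sup>2)" and [measurable]: "f \<in> borel_measurable borel"
    using assms(1) by (auto simp: L2_def)
  note [measurable] = borel_measurable_continuous_onI[OF assms(2)]
  have "integrable lborel (\<lambda>x. (cmod (F x))\<^sup>2)"
    using i by (rule integrable_cong_AE_imp) (use assms(3) in \<open>auto elim!: eventually_mono\<close>)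
  then show ?thesis using assms(2) by (simp add: L2_continuous_def)
qed

lemma ddx_classical_H1:
  assumes "(f, g) \<in> ddx" "continuous_on UNIV G" "AE x in lborel. G x = g x"
  obtains F where "classical_H1 F G" "AE x in lborel. F x = f x"
proof -
  obtain F where F: "\<And>x. (F has_vector_derivative G x) (at x)" "AE x in lborel. F x = f x"
    using ddx_classical[OF assms] by blast
  have "continuous_on UNIV F"
    using F(1) by (meson continuous_at_imp_continuous_on has_vector_derivative_continuous)
  then have "classical_H1 F G"
    using F assms by (auto simp: classical_H1_def ddx_def intro: L2_continuousI)
  then show ?thesis using that F(2) by blast
qed

text \<open>Bootstrapping: the eigenvalue relation \<open>v' = -\<mu> f\<close> makes \<open>(1 - b \<partial>\<^sup>2) v = L f\<close> continuous, and since
  the matrix with rows \<open>(-b, b w)\<close> and \<open>(b w, -b)\<close> is invertible for \<open>w\<^sup>2 < 1\<close>, so are the second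
  derivatives of \<open>f\<close>.\<close>

lemma unstable_mode_classical:
  fixes b w :: real and \<phi> \<psi> :: "real \<Rightarrow> real"
  assumes b: "b > 0" and w: "w\<^sup>2 < 1" and cont: "continuous_on UNIV \<phi>" "continuous_on UNIV \<psi>"
    and unstable: "spectrally_unstable (- b) b (- b) \<phi> \<psi> w"
  obtains \<mu> :: complex and F1 F1' F1'' F2 F2' F2'' V1 V2 :: "real \<Rightarrow> complex"
  where "Re \<mu> > 0" "\<exists>x. F1 x \<noteq> 0 \<or> F2 x \<noteq> 0"
    "classical_H1 F1 F1'" "classical_H1 F1' F1''" "classical_H1 F2 F2'" "classical_H1 F2' F2''"
    "classical_H1 V1 (\<lambda>x. - \<mu> * F2 x)" "classical_H1 V2 (\<lambda>x. - \<mu> * F1 x)"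
    "\<And>x. V1 x + b * \<mu> * F2' x = (F1 x - b * F1'' x) - w * (F2 x - b * F2'' x) + \<psi> x * F2 x"
    "\<And>x. V2 x + b * \<mu> * F1' x = - w * (F1 x - b * F1'' x) + \<psi> x * F1 x + (F2 x - b * F2'' x) + \<phi> x * F2 x"
proof -
  obtain f1 f2 \<mu> g1 g2 where nz: "\<not> (AE x in lborel. f1 x = 0 \<and> f2 x = 0)" and \<mu>: "Re \<mu> > 0"
    and L: "((f1, f2), (g1, g2)) \<in> op_L (- b) b (- b) \<phi> \<psi> w"
    and J: "((g1, g2), (\<lambda>x. \<mu> * f1 x, \<lambda>x. \<mu> * f2 x)) \<in> op_J b"
    using unstable by (auto simp: spectrally_unstable_def simp del: AE_conj_iff)
  obtain f1x f1xx f2x f2xx where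
    f1: "(f1, f1x) \<in> ddx" "(f1x, f1xx) \<in> ddx" and f2: "(f2, f2x) \<in> ddx" "(f2x, f2xx) \<in> ddx"
    and g1: "AE x in lborel. g1 x = (f1 x + of_real (- b) * f1xx x)
                + (of_real (b * w) * f2xx x + of_real (\<psi> x) * f2 x - of_real w * f2 x)"
    and g2: "AE x in lborel. g2 x = (of_real (b * w) * f1xx x + of_real (\<psi> x) * f1 x - of_real w * f1 x)
                + (f2 x + of_real (- b) * f2xx x + of_real (\<phi> x) * f2 x)"
    using L by (auto simp: op_L_def simp del: of_real_minus of_real_mult)
  obtain v1 v2 where v: "(v2, g2) \<in> helmholtz b" "(v2, \<lambda>x. - (\<mu> * f1 x)) \<in> ddx"
      "(v1, g1) \<in> helmholtz b" "(v1, \<lambda>x. - (\<mu> * f2 x)) \<in> ddx"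
    using J by (auto simp: op_J_def)
  \<comment> \<open>The graph of \<open>J\<close> gives \<open>v' = - \<mu> f\<close>, while
    \<open>helmholtz b\<close> comes with its own derivatives of \<open>v\<close>. Uniqueness yields
    \<open>v'' = - \<mu> f'\<close>, which trades the second derivative of \<open>v\<close> for a
    first derivative of \<open>f\<close>.\<close>
  have potential: "AE x in lborel. g x = v x + of_real b * \<mu> * fx x"
    if H: "(v, g) \<in> helmholtz b" "(v, \<lambda>x. - (\<mu> * f x)) \<in> ddx" "(f, fx) \<in> ddx" for v g f fx
  proof -
    obtain vx vxx where vx: "(v, vx) \<in> ddx" "(vx, vxx) \<in> ddx"
      and g: "AE x in lborel. g x = v x - of_real b * vxx x"
      using H by (auto simp: helmholtz_def)
    have "AE x in lborel. vx x = - (\<mu> * f x)"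
      by (rule ddx_unique[OF vx(1) that(2)]) simp
    moreover have "(\<lambda>x. - (\<mu> * f x), \<lambda>x. - (\<mu> * fx x)) \<in> ddx"
      using ddx_scale[OF that(3), of "- \<mu>"] by simp
    ultimately have "AE x in lborel. vxx x = - (\<mu> * fx x)"
      using ddx_unique[OF vx(2)] by blast
    with g show ?thesis by eventually_elim simp
  qed
  note p1 = potential[OF v(3,4) f2(1)] and p2 = potential[OF v(1,2) f1(1)]
  obtain A1 where A1: "continuous_on UNIV A1" "AE x in lborel. A1 x = f1x x"
    using ddx_primitive[OF f1(2)] by metis
  obtain A2 where A2: "continuous_on UNIV A2" "AE x in lborel. A2 x = f2x x"
    using ddx_primitive[OF f2(2)] by metis
  obtain F1 where F1: "classical_H1 F1 A1" "AE x in lborel. F1 x = f1 x"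
    using ddx_classical_H1[OF f1(1) A1] by blast
  obtain F2 where F2: "classical_H1 F2 A2" "AE x in lborel. F2 x = f2 x"
    using ddx_classical_H1[OF f2(1) A2] by blast
  note c = classical_H1_D(4)[OF F1(1)] classical_H1_D(4)[OF F2(1)] A1(1) A2(1) cont
  obtain V1 where V1: "classical_H1 V1 (\<lambda>x. - \<mu> * F2 x)" "AE x in lborel. V1 x = v1 x"
  proof (rule ddx_classical_H1[OF v(4)])
    show "continuous_on UNIV (\<lambda>x. - \<mu> * F2 x)" by (intro continuous_intros c)
    show "AE x in lborel. - \<mu> * F2 x = - (\<mu> * f2 x)" using F2(2) by eventually_elim simp
  qed
  obtain V2 where V2: "classical_H1 V2 (\<lambda>x. - \<mu> * F1 x)" "AE x in lborel. V2 x = v2 x"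
  proof (rule ddx_classical_H1[OF v(2)])
    show "continuous_on UNIV (\<lambda>x. - \<mu> * F1 x)" by (intro continuous_intros c)
    show "AE x in lborel. - \<mu> * F1 x = - (\<mu> * f1 x)" using F1(2) by eventually_elim simp
  qed
  note c = c classical_H1_D(4)[OF V1(1)] classical_H1_D(4)[OF V2(1)]
  \<comment> \<open>The determinant of the system for the second derivatives is \<open>b d\<close>;
    a common factor \<open>b\<close> has been cancelled in the inverse.\<close>
  define d where "d = complex_of_real (b * (1 - w\<^sup>2))"
  have "b * (1 - w\<^sup>2) \<noteq> 0" using b w by simp
  then have d: "d \<noteq> 0" unfolding d_def of_real_eq_0_iff .
  \<comment> \<open>\<open>R1\<close> and \<open>R2\<close> collect the terms without second
    derivatives, at continuous representatives. Solving the linear system for them makes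
    \<open>B1\<close> and \<open>B2\<close> continuous candidates for \<open>f1xx\<close> and
    \<open>f2xx\<close>.\<close>
  define R1 where "R1 = (\<lambda>x. V1 x + b * \<mu> * A2 x - F1 x - \<psi> x * F2 x + w * F2 x)"
  define R2 where "R2 = (\<lambda>x. V2 x + b * \<mu> * A1 x - \<psi> x * F1 x + w * F1 x - F2 x - \<phi> x * F2 x)"
  define B1 where "B1 = (\<lambda>x. - (R1 x + w * R2 x) / d)"
  define B2 where "B2 = (\<lambda>x. - (w * R1 x + R2 x) / d)"
  have Bc: "continuous_on UNIV B1" "continuous_on UNIV B2"
    unfolding B1_def B2_def R1_def R2_def using d by (auto intro!: continuous_intros c)
  have solve: "y1 = - (r1 + w * r2) / d" "y2 = - (w * r1 + r2) / d"
    if "r1 = - b * y1 + b * w * y2" "r2 = b * w * y1 - b * y2" for r1 r2 y1 y2 :: complex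
  proof -
    have "d * y1 = - (r1 + w * r2)" "d * y2 = - (w * r1 + r2)"
      unfolding that d_def by (simp_all add: power2_eq_square algebra_simps)
    then show "y1 = - (r1 + w * r2) / d" "y2 = - (w * r1 + r2) / d"
      using d by (simp_all add: field_simps)
  qed
  have R: "AE x in lborel. R1 x = - b * f1xx x + b * w * f2xx x \<and> R2 x = b * w * f1xx x - b * f2xx x"
    using g1 g2 p1 p2 F1(2) F2(2) A1(2) A2(2) V1(2) V2(2)
  proof eventually_elim
    case (elim x)
    from elim(1,3) have "v1 x + b * \<mu> * f2x x = (f1 x + of_real (- b) * f1xx x)
                + (of_real (b * w) * f2xx x + of_real (\<psi> x) * f2 x - of_real w * f2 x)" by simp
    moreover from elim(2,4) have "v2 x + b * \<mu> * f1x x = (of_real (b * w) * f1xx x + of_real (\<psi> x) * f1 x - of_real w * f1 x)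
                + (f2 x + of_real (- b) * f2xx x + of_real (\<phi> x) * f2 x)" by simp
    ultimately show ?case
      unfolding R1_def R2_def elim(5-) by (simp add: algebra_simps)
  qed
  then have "AE x in lborel. B1 x = f1xx x" "AE x in lborel. B2 x = f2xx x"
    unfolding B1_def B2_def by (eventually_elim, use solve in metis)+
  note B = Bc this
  obtain A1' where A1': "classical_H1 A1' B1" "AE x in lborel. A1' x = f1x x"
    using ddx_classical_H1[OF f1(2) B(1,3)] by blast
  have "A1' = A1"
  proof (rule continuous_AE_eq_imp_eq[OF classical_H1_D(4)[OF A1'(1)] A1(1)])
    show "AE x in lborel. A1' x = A1 x" using A1(2) A1'(2) by eventually_elim simp
  qed
  then have A1B1: "classical_H1 A1 B1" using A1'(1) by simp
  obtain A2' where A2': "classical_H1 A2' B2" "AE x in lborel. A2' x = f2x x"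
    using ddx_classical_H1[OF f2(2) B(2,4)] by blast
  have "A2' = A2"
  proof (rule continuous_AE_eq_imp_eq[OF classical_H1_D(4)[OF A2'(1)] A2(1)])
    show "AE x in lborel. A2' x = A2 x" using A2(2) A2'(2) by eventually_elim simp
  qed
  then have A2B2: "classical_H1 A2 B2" using A2'(1) by simp
  have RB: "R1 x = - b * B1 x + b * w * B2 x" "R2 x = b * w * B1 x - b * B2 x" for x
  proof -
    have "d * (- b * B1 x + b * w * B2 x) = d * R1 x" "d * (b * w * B1 x - b * B2 x) = d * R2 x"
      unfolding B1_def B2_def using d
      by (simp_all add: field_simps) (simp_all add: d_def power2_eq_square algebra_simps)
    then show "R1 x = - b * B1 x + b * w * B2 x" "R2 x = b * w * B1 x - b * B2 x"
      using d by simp_all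
  qed
  show ?thesis
  proof (rule that[OF \<mu> _ F1(1) A1B1 F2(1) A2B2 V1(1) V2(1)])
    show "\<exists>x. F1 x \<noteq> 0 \<or> F2 x \<noteq> 0"
    proof (rule ccontr)
      assume "\<not> (\<exists>x. F1 x \<noteq> 0 \<or> F2 x \<noteq> 0)"
      then have "AE x in lborel. f1 x = 0 \<and> f2 x = 0"
        using F1(2) F2(2) by (auto elim!: eventually_elim2)
      then show False using nz by blast
    qed
    show "V1 x + b * \<mu> * A2 x = (F1 x - b * B1 x) - w * (F2 x - b * B2 x) + \<psi> x * F2 x" for x
      using RB(1)[of x] by (simp add: R1_def algebra_simps)
    show "V2 x + b * \<mu> * A1 x = - w * (F1 x - b * B1 x) + \<psi> x * F1 x + (F2 x - b * B2 x) + \<phi> x * F2 x" for x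
      using RB(2)[of x] by (simp add: R2_def algebra_simps)
  qed
qed

subsection \<open>The traveling waves\<close>

lemma traveling_profile_derivatives:
  fixes p p1 :: "real \<Rightarrow> real"
  assumes "\<And>y. (p has_real_derivative p1 y) (at y)"
  shows "((\<lambda>y. p (y - w * t)) has_real_derivative p1 (x - w * t)) (at x)"
    and "((\<lambda>s. p (x - w * s)) has_real_derivative - w * p1 (x - w * t)) (at t)"
    and "partial_x (\<lambda>x t. p (x - w * t)) = (\<lambda>x t. p1 (x - w * t))"
    and "partial_t (\<lambda>x t. p (x - w * t)) = (\<lambda>x t. - w * p1 (x - w * t))"
proof -
  have "((\<lambda>y. y - w * t) has_real_derivative 1) (at x)" for x t
    by (auto intro!: derivative_eq_intros)
  from DERIV_chain2[OF assms this]
  have 1: "((\<lambda>y. p (y - w * t)) has_real_derivative p1 (x - w * t)) (at x)" for x t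
    by simp
  have "((\<lambda>s. x - w * s) has_real_derivative - w) (at t)" for x t
    by (auto intro!: derivative_eq_intros)
  from DERIV_chain2[OF assms this]
  have 2: "((\<lambda>s. p (x - w * s)) has_real_derivative - w * p1 (x - w * t)) (at t)" for x t
    by (simp add: mult.commute)
  show "((\<lambda>y. p (y - w * t)) has_real_derivative p1 (x - w * t)) (at x)"
    "((\<lambda>s. p (x - w * s)) has_real_derivative - w * p1 (x - w * t)) (at t)"
    by (rule 1 2)+
  show "partial_x (\<lambda>x t. p (x - w * t)) = (\<lambda>x t. p1 (x - w * t))"
    unfolding partial_x_def by (intro ext DERIV_imp_deriv 1)
  show "partial_t (\<lambda>x t. p (x - w * t)) = (\<lambda>x t. - w * p1 (x - w * t))"
    unfolding partial_t_def by (intro ext DERIV_imp_deriv 2)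
qed

lemma traveling_profile_regular:
  fixes p p1 p2 p3 :: "real \<Rightarrow> real"
  assumes p: "\<And>y. (p has_real_derivative p1 y) (at y)" "\<And>y. (p1 has_real_derivative p2 y) (at y)"
    "\<And>y. (p2 has_real_derivative p3 y) (at y)"
  shows "boussinesq_regular (\<lambda>x t. p (x - w * t))"
proof -
  have fd: "f field_differentiable at x" if "(f has_real_derivative d) (at x)" for f d and x :: real
    using that by (auto simp: field_differentiable_def)
  note fds = traveling_profile_derivatives(1,2)[OF p(1), THEN fd] traveling_profile_derivatives(1,2)[OF p(2), THEN fd]
    traveling_profile_derivatives(1,2)[OF p(3), THEN fd]
  show ?thesis
    unfolding boussinesq_regular_def traveling_profile_derivatives(3)[OF p(1)]
      traveling_profile_derivatives(3)[OF p(2)] x_differentiable_def t_differentiable_def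
    by (intro conjI allI fds)
qed

context sech_profile
begin

lemma wave_phi_eq: "wave_phi b \<eta> = (\<lambda>y. \<eta> * S y)"
  and wave_psi_eq: "wave_psi \<sigma> b \<eta> = (\<lambda>y. \<sigma> * \<eta> * sqrt (3 / (\<eta> + 3)) * S y)"
proof -
  have "(sech (y / (2 * sqrt b)))\<^sup>2 = S y" for y
  proof -
    have "cosh (y / (2 * sqrt b)) \<noteq> 0"
      using cosh_real_pos[of "y / (2 * sqrt b)"] by simp
    then have "1 - (sinh (y / (2 * sqrt b)) / cosh (y / (2 * sqrt b)))\<^sup>2 =
        ((cosh (y / (2 * sqrt b)))\<^sup>2 - (sinh (y / (2 * sqrt b)))\<^sup>2) / (cosh (y / (2 * sqrt b)))\<^sup>2"
      by (simp add: power_divide diff_divide_distrib)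
    also have "\<dots> = (1 / cosh (y / (2 * sqrt b)))\<^sup>2"
      unfolding hyperbolic_pythagoras by (simp add: power_divide)
    finally show ?thesis
      by (simp add: sech_def S_def \<tau>_def \<beta>_def tanh_def)
  qed
  then show "wave_phi b \<eta> = (\<lambda>y. \<eta> * S y)"
    "wave_psi \<sigma> b \<eta> = (\<lambda>y. \<sigma> * \<eta> * sqrt (3 / (\<eta> + 3)) * S y)"
    by (simp_all add: wave_phi_def[abs_def] wave_psi_def[abs_def])
qed

lemma scaled_S_derivatives:
  "((\<lambda>y. e * S y) has_real_derivative e * S' y) (at y)"
  "((\<lambda>y. e * S' y) has_real_derivative e * S'' y) (at y)"
  "((\<lambda>y. e * S'' y) has_real_derivative e * S''' y) (at y)"
  by (intro DERIV_cmult S_derivative S'_derivative S''_derivative)+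

text \<open>By \<open>S' - b S''' = 3 S S'\<close> the linear terms become multiples of
  \<open>S S'\<close>, as the nonlinear ones already are. The two assumptions say that its
  coefficient vanishes in each equation.\<close>

lemma traveling_wave:
  assumes "3 * (p - w * \<eta>) + 2 * \<eta> * p = 0" and "3 * (\<eta> - w * p) + p\<^sup>2 = 0"
  shows "traveling_wave_solution (- b) b (- b) (\<lambda>y. \<eta> * S y) (\<lambda>y. p * S y) w"
proof -
  note d = scaled_S_derivatives
  note pd = traveling_profile_derivatives(3,4)[OF d(1)] traveling_profile_derivatives(3,4)[OF d(2)]
    traveling_profile_derivatives(3,4)[OF d(3)]
  have prod: "partial_x (\<lambda>y s. (\<eta> * S (y - w * s)) * (p * S (y - w * s))) x t =
      2 * \<eta> * p * S (x - w * t) * S' (x - w * t)" for x t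
  proof -
    have "((\<lambda>y. (\<eta> * S (y - w * t)) * (p * S (y - w * t))) has_real_derivative
        (\<eta> * S (x - w * t)) * (p * S' (x - w * t)) + (\<eta> * S' (x - w * t)) * (p * S (x - w * t))) (at x)"
      by (rule DERIV_mult'[OF traveling_profile_derivatives(1)[OF d(1)] traveling_profile_derivatives(1)[OF d(1)]])
    then show ?thesis
      unfolding partial_x_def by (subst DERIV_imp_deriv) (auto simp: algebra_simps)
  qed
  have pe: "b * S''' y = S' y - 3 * S y * S' y" for y
    unfolding profile_equation' by (simp add: algebra_simps)
  have 1: "- w * (\<eta> * S' y) + p * S' y + 2 * \<eta> * p * S y * S' y + - b * (p * S''' y) - b * (- w * (\<eta> * S''' y)) = 0" for y
    using pe[of y] assms(1) by algebra
  have 2: "- w * (p * S' y) + \<eta> * S' y + p * S y * (p * S' y) + - b * (\<eta> * S''' y) - b * (- w * (p * S''' y)) = 0" for y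
    using pe[of y] assms(2) by algebra
  show ?thesis
    unfolding traveling_wave_solution_def boussinesq_solution_def
    by (intro conjI allI traveling_profile_regular[OF d])
      (simp_all only: pd prod 1 2)
qed

end

text \<open>\<open>a\<close> is the ratio of the amplitude of \<psi> to that of \<phi> when \<eta>
  is nonzero. In terms of \<open>a\<close> and its inverse \<open>q\<close> the square roots and the
  sign disappear, and later identities follow from \<open>a q = 1\<close> by algebra.\<close>

lemma wave_parameters:
  fixes \<eta> \<sigma> :: real
  assumes \<eta>: "\<eta> > - 3" and \<sigma>: "\<sigma> = 1 \<or> \<sigma> = - 1"
  obtains a q where "a * q = 1" "\<sigma> * \<eta> * sqrt (3 / (\<eta> + 3)) = 3 * (q - a)" "\<eta> = 3 * (q\<^sup>2 - 1)"
    "wave_speed \<sigma> \<eta> = 2 * q - a" "a\<^sup>2 = 3 / (\<eta> + 3)"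
proof -
  define k where "k = sqrt (3 / (\<eta> + 3))"
  define a q where "a = \<sigma> * k" and "q = \<sigma> / k"
  have k: "k > 0" "k\<^sup>2 = 3 / (\<eta> + 3)"
    using \<eta> by (simp_all add: k_def)
  have \<sigma>2: "\<sigma> * \<sigma> = 1" using \<sigma> by auto
  have aq: "a * q = 1" using k \<sigma>2 by (simp add: a_def q_def)
  have q2: "\<eta> = 3 * (q\<^sup>2 - 1)"
  proof -
    have "q\<^sup>2 = (\<eta> + 3) / 3"
      using \<sigma>2 k(2) by (simp add: q_def power_divide) (simp add: power2_eq_square)
    then show ?thesis by (simp add: field_simps)
  qed
  have "sqrt (3 * (3 + \<eta>)) = 3 / k"
  proof (rule real_sqrt_unique)
    show "(3 / k)\<^sup>2 = 3 * (3 + \<eta>)" using k \<eta> by (simp add: power_divide)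
  qed (use k in simp)
  then have "wave_speed \<sigma> \<eta> = a * (3 + 2 * \<eta>) / 3"
    by (simp add: wave_speed_def a_def)
  also have "\<dots> = 2 * q - a"
    unfolding q2 using aq by (simp add: field_simps) algebra
  finally have ws: "wave_speed \<sigma> \<eta> = 2 * q - a" .
  have psi: "\<sigma> * \<eta> * k = 3 * (q - a)"
  proof -
    have "\<sigma> * \<eta> * k = \<eta> * a" by (simp add: a_def)
    also have "\<dots> = 3 * (q - a)" unfolding q2 using aq by algebra
    finally show ?thesis .
  qed
  have "a\<^sup>2 = 3 / (\<eta> + 3)"
    using \<sigma>2 k(2) by (simp add: a_def power_mult_distrib) (simp add: power2_eq_square)
  with aq psi q2 ws show ?thesis using that unfolding k_def by blast
qed

lemma wave_speed_less_1_iff: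
  assumes "\<eta> > - 3" "\<eta> \<noteq> 0" "\<sigma> = 1 \<or> \<sigma> = - 1"
  shows "\<bar>wave_speed \<sigma> \<eta>\<bar> < 1 \<longleftrightarrow> - 9 / 4 < \<eta> \<and> \<eta> < 0"
proof -
  have \<sigma>2: "\<sigma>\<^sup>2 = 1" using assms(3) by auto
  have "\<bar>wave_speed \<sigma> \<eta>\<bar> < 1 \<longleftrightarrow> (wave_speed \<sigma> \<eta>)\<^sup>2 < 1"
    by (simp add: abs_square_less_1)
  also have "(wave_speed \<sigma> \<eta>)\<^sup>2 = (3 + 2 * \<eta>)\<^sup>2 / (3 * (3 + \<eta>))"
    using assms(1) \<sigma>2 by (simp add: wave_speed_def power_mult_distrib power_divide)
  also have "\<dots> < 1 \<longleftrightarrow> (3 + 2 * \<eta>)\<^sup>2 < 3 * (3 + \<eta>)"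
    using assms(1) by (simp add: divide_less_eq)
  also have "\<dots> \<longleftrightarrow> \<eta> * (9 + 4 * \<eta>) < 0"
    by (simp add: power2_eq_square algebra_simps)
  also have "\<dots> \<longleftrightarrow> - 9 / 4 < \<eta> \<and> \<eta> < 0"
    using assms(1) by (auto simp: mult_less_0_iff)
  finally show ?thesis .
qed

section \<open>Decoupling and stability of the waves\<close>

text \<open>In the eigenbasis \<open>(2, -a)\<close>, \<open>(1, a)\<close> the matrices of \<open>1 - b \<partial>\<^sup>2\<close> and of \<open>S\<close> in \<open>L\<close> are both diagonal.\<close>

lemma simultaneous_diagonalization:
  fixes a q :: "'a :: field"
  assumes aq: "a * q = 1"
    and y1: "y1 = x1 - (2 * q - a) * x2 + 3 * (q - a) * s * f2"
    and y2: "y2 = - (2 * q - a) * x1 + 3 * (q - a) * s * f1 + x2 + 3 * (q\<^sup>2 - 1) * s * f2"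
  shows "2 * y1 - a * y2 = (4 - a\<^sup>2) * (x1 - q * x2) + 3 * (a\<^sup>2 - 1) * s * (f1 - q * f2)"
    and "y1 + a * y2 = (a\<^sup>2 - 1) * (x1 + 2 * q * x2 - 3 * s * (f1 + 2 * q * f2))"
  unfolding y1 y2 using aq by algebra+

lemma (in sech_profile) wave_stable:
  fixes a q \<eta> p w :: real
  assumes aq: "a * q = 1" and p: "p = 3 * (q - a)" and \<eta>: "\<eta> = 3 * (q\<^sup>2 - 1)" and w: "w = 2 * q - a"
    and a: "1 < a\<^sup>2" "a\<^sup>2 < 4" and w1: "w\<^sup>2 < 1"
  shows "spectrally_stable (- b) b (- b) (\<lambda>y. \<eta> * S y) (\<lambda>y. p * S y) w"
  unfolding spectrally_stable_def
proof
  assume U: "spectrally_unstable (- b) b (- b) (\<lambda>y. \<eta> * S y) (\<lambda>y. p * S y) w"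
  have cont: "continuous_on UNIV (\<lambda>y. \<eta> * S y)" "continuous_on UNIV (\<lambda>y. p * S y)"
    by (intro continuous_intros S_continuous)+
  obtain \<mu> :: complex and F1 F1' F1'' F2 F2' F2'' V1 V2 :: "real \<Rightarrow> complex"
  where \<mu>: "Re \<mu> > 0" and nz: "\<exists>x. F1 x \<noteq> 0 \<or> F2 x \<noteq> 0"
    and F: "classical_H1 F1 F1'" "classical_H1 F1' F1''" "classical_H1 F2 F2'" "classical_H1 F2' F2''"
    and V: "classical_H1 V1 (\<lambda>x. - \<mu> * F2 x)" "classical_H1 V2 (\<lambda>x. - \<mu> * F1 x)"
    and E1: "\<And>x. V1 x + b * \<mu> * F2' x = (F1 x - b * F1'' x) - w * (F2 x - b * F2'' x) + complex_of_real (p * S x) * F2 x"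
    and E2: "\<And>x. V2 x + b * \<mu> * F1' x = - w * (F1 x - b * F1'' x) + complex_of_real (p * S x) * F1 x
        + (F2 x - b * F2'' x) + complex_of_real (\<eta> * S x) * F2 x"
    by (rule unstable_mode_classical[OF b_pos w1 cont U]) (rule that)
  have V': "classical_H1 (\<lambda>x. - \<mu> * F2 x) (\<lambda>x. - \<mu> * F2' x)" "classical_H1 (\<lambda>x. - \<mu> * F1 x) (\<lambda>x. - \<mu> * F1' x)"
    by (intro classical_H1_scale F)+
  \<comment> \<open>The matrix of \<open>T\<close> takes the values \<open>N1\<close> and
    \<open>N2\<close> on the basis vectors \<open>(2, -a)\<close> and \<open>(1, a)\<close>; the
    matrix of \<open>S\<close> takes the values \<open>9 (a^2 - 1)\<close>, which is
    \<open>N1 c\<close>, and \<open>-9 (a^2 - 1)\<close>, which is \<open>-3 N2\<close>.\<close>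
  define N1 N2 c where "N1 = 3 * (4 - a\<^sup>2)" and "N2 = 3 * (a\<^sup>2 - 1)" and "c = 9 * (a\<^sup>2 - 1) / N1"
  have N: "N1 > 0" "N2 > 0" "c \<ge> 0" using a by (simp_all add: N1_def N2_def c_def)
  have N1c: "N1 * c = 9 * (a\<^sup>2 - 1)" using N by (simp add: c_def)
  \<comment> \<open>Already \<open>4 N1 c = 36 (a^2 - 1)\<close> exceeds
    \<open>3/2 N2 = 9/2 (a^2 - 1)\<close>.\<close>
  have gap: "4 * N1 * (3 / 2 + c) > 3 / 2 * N2"
  proof -
    have "4 * N1 * (3 / 2 + c) = 6 * N1 + 4 * (N1 * c)" by (simp add: algebra_simps)
    then show ?thesis unfolding N1c using a by (simp add: N1_def N2_def)
  qed
  define A Q :: complex where "A = of_real a" and "Q = of_real q"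
  have AQ: "A * Q = 1" using aq unfolding A_def Q_def by (metis of_real_1 of_real_mult)
  have cw: "complex_of_real w = 2 * Q - A" by (simp add: w A_def Q_def)
  have cp: "complex_of_real p = 3 * (Q - A)" by (simp add: p A_def Q_def)
  have c\<eta>: "complex_of_real \<eta> = 3 * (Q\<^sup>2 - 1)" by (simp add: \<eta> Q_def)
  have cN1: "complex_of_real N1 = 3 * (4 - A\<^sup>2)" by (simp add: N1_def A_def)
  have cN2: "complex_of_real N2 = 3 * (A\<^sup>2 - 1)" by (simp add: N2_def A_def)
  have cN1c: "complex_of_real N1 * complex_of_real c = 9 * (A\<^sup>2 - 1)"
    using arg_cong[OF N1c, of complex_of_real] by (simp add: A_def)
  have c\<kappa>: "complex_of_real (q / 9) = Q / 9" by (simp add: Q_def)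
  have D1: "V1 x + b * \<mu> * F2' x = (F1 x - b * F1'' x) - (2 * Q - A) * (F2 x - b * F2'' x) + 3 * (Q - A) * S x * F2 x" for x
    using E1[of x] by (simp only: of_real_mult cw cp)
  have D2: "V2 x + b * \<mu> * F1' x = - (2 * Q - A) * (F1 x - b * F1'' x) + 3 * (Q - A) * S x * F1 x
      + (F2 x - b * F2'' x) + 3 * (Q\<^sup>2 - 1) * S x * F2 x" for x
    using E2[of x] by (simp only: of_real_mult of_real_minus cw cp c\<eta>)
  \<comment> \<open>The two combinations are the coordinates of \<open>(F1, F2)\<close> in the basis
    \<open>(2, -a)\<close>, \<open>(1, a)\<close>; the potentials are the pairings of
    \<open>(V1, V2)\<close> with the basis vectors. In these coordinates the negated swap matrix of
    \<open>J\<close> becomes \<open>1 / (9 a)\<close> times the matrix with rows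
    \<open>(2, -1)\<close> and \<open>(-1, -4)\<close>, whence
    \<open>\<kappa> = q / 9\<close>.\<close>
  have zero: "1 / 3 * F1 x - Q / 3 * F2 x = 0 \<and> 1 / 3 * F1 x + 2 * Q / 3 * F2 x = 0" for x
  proof (rule no_unstable_mode[where \<mu> = \<mu> and \<kappa> = "q / 9" and x = x, OF _ _ _ _ _ _ _ _ _ _ _ _ \<mu> N gap])
    show "classical_H1 (\<lambda>x. 1 / 3 * F1 x - Q / 3 * F2 x) (\<lambda>x. 1 / 3 * F1' x - Q / 3 * F2' x)"
      "classical_H1 (\<lambda>x. 1 / 3 * F1' x - Q / 3 * F2' x) (\<lambda>x. 1 / 3 * F1'' x - Q / 3 * F2'' x)"
      "classical_H1 (\<lambda>x. 1 / 3 * F1 x + 2 * Q / 3 * F2 x) (\<lambda>x. 1 / 3 * F1' x + 2 * Q / 3 * F2' x)"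
      "classical_H1 (\<lambda>x. 1 / 3 * F1' x + 2 * Q / 3 * F2' x) (\<lambda>x. 1 / 3 * F1'' x + 2 * Q / 3 * F2'' x)"
      by (intro classical_H1_add classical_H1_diff classical_H1_scale F)+
    show "classical_H1 (\<lambda>x. 2 * V1 x - A * V2 x) (\<lambda>x. 2 * (- \<mu> * F2 x) - A * (- \<mu> * F1 x))"
      "classical_H1 (\<lambda>x. 2 * (- \<mu> * F2 x) - A * (- \<mu> * F1 x)) (\<lambda>x. 2 * (- \<mu> * F2' x) - A * (- \<mu> * F1' x))"
      "classical_H1 (\<lambda>x. V1 x + A * V2 x) (\<lambda>x. - \<mu> * F2 x + A * (- \<mu> * F1 x))"
      "classical_H1 (\<lambda>x. - \<mu> * F2 x + A * (- \<mu> * F1 x)) (\<lambda>x. - \<mu> * F2' x + A * (- \<mu> * F1' x))"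
      by (intro classical_H1_add classical_H1_diff classical_H1_scale V V')+
    fix x
    show "\<mu> * (1 / 3 * F1 x - Q / 3 * F2 x) =
        complex_of_real (q / 9) * (2 * (2 * (- \<mu> * F2 x) - A * (- \<mu> * F1 x)) - (- \<mu> * F2 x + A * (- \<mu> * F1 x)))"
      unfolding c\<kappa> using AQ by algebra
    show "\<mu> * (1 / 3 * F1 x + 2 * Q / 3 * F2 x) =
        complex_of_real (- (q / 9)) * ((2 * (- \<mu> * F2 x) - A * (- \<mu> * F1 x)) + 4 * (- \<mu> * F2 x + A * (- \<mu> * F1 x)))"
      unfolding of_real_minus c\<kappa> using AQ by algebra
    show "2 * V1 x - A * V2 x - b * (2 * (- \<mu> * F2' x) - A * (- \<mu> * F1' x)) =
        N1 * (1 / 3 * F1 x - Q / 3 * F2 x - b * (1 / 3 * F1'' x - Q / 3 * F2'' x)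
          + complex_of_real (c * S x) * (1 / 3 * F1 x - Q / 3 * F2 x))"
    proof -
      have "2 * V1 x - A * V2 x - b * (2 * (- \<mu> * F2' x) - A * (- \<mu> * F1' x)) =
          2 * (V1 x + b * \<mu> * F2' x) - A * (V2 x + b * \<mu> * F1' x)"
        by (simp add: algebra_simps)
      also have "\<dots> = (4 - A\<^sup>2) * ((F1 x - b * F1'' x) - Q * (F2 x - b * F2'' x)) + 3 * (A\<^sup>2 - 1) * S x * (F1 x - Q * F2 x)"
        by (rule simultaneous_diagonalization(1)[OF AQ D1 D2])
      also have "\<dots> = (3 * (4 - A\<^sup>2)) * (1 / 3 * F1 x - Q / 3 * F2 x - b * (1 / 3 * F1'' x - Q / 3 * F2'' x))
          + (9 * (A\<^sup>2 - 1)) * (S x * (1 / 3 * F1 x - Q / 3 * F2 x))"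
        by (simp add: field_simps)
      finally show ?thesis
        unfolding cN1[symmetric] cN1c[symmetric] by (simp add: algebra_simps)
    qed
    show "V1 x + A * V2 x - b * (- \<mu> * F2' x + A * (- \<mu> * F1' x)) =
        N2 * (1 / 3 * F1 x + 2 * Q / 3 * F2 x - b * (1 / 3 * F1'' x + 2 * Q / 3 * F2'' x)
          - complex_of_real (3 * S x) * (1 / 3 * F1 x + 2 * Q / 3 * F2 x))"
    proof -
      have "V1 x + A * V2 x - b * (- \<mu> * F2' x + A * (- \<mu> * F1' x)) =
          (V1 x + b * \<mu> * F2' x) + A * (V2 x + b * \<mu> * F1' x)"
        by (simp add: algebra_simps)
      also have "\<dots> = (A\<^sup>2 - 1) * ((F1 x - b * F1'' x) + 2 * Q * (F2 x - b * F2'' x)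
            - 3 * complex_of_real (S x) * (F1 x + 2 * Q * F2 x))"
        by (rule simultaneous_diagonalization(2)[OF AQ D1 D2])
      also have "\<dots> = (3 * (A\<^sup>2 - 1)) * (1 / 3 * F1 x + 2 * Q / 3 * F2 x - b * (1 / 3 * F1'' x + 2 * Q / 3 * F2'' x)
          - 3 * complex_of_real (S x) * (1 / 3 * F1 x + 2 * Q / 3 * F2 x))"
        by (simp add: field_simps)
      finally show ?thesis
        unfolding cN2[symmetric] by simp
    qed
  qed
  have "F1 x = 0" "F2 x = 0" for x
  proof -
    have "Q * F2 x = 0" using zero[of x] by algebra
    then show "F2 x = 0" using AQ by auto
    then show "F1 x = 0" using zero[of x] by simp
  qed
  then show False using nz by blast
qed

theorem theorem2:
  fixes a b c \<sigma> :: real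
  assumes "b > 0" and "a = - b" and "c = - b" and "\<sigma> = 1 \<or> \<sigma> = - 1"
  shows
    "(\<forall>\<eta>\<^sub>0. \<eta>\<^sub>0 > - 3 \<longrightarrow>
        traveling_wave_solution a b c (wave_phi b \<eta>\<^sub>0) (wave_psi \<sigma> b \<eta>\<^sub>0) (wave_speed \<sigma> \<eta>\<^sub>0)) \<and>
     (\<forall>\<eta>\<^sub>0. - 9 / 4 < \<eta>\<^sub>0 \<and> \<eta>\<^sub>0 < 0 \<longrightarrow>
        spectrally_stable a b c (wave_phi b \<eta>\<^sub>0) (wave_psi \<sigma> b \<eta>\<^sub>0) (wave_speed \<sigma> \<eta>\<^sub>0)) \<and>
     (\<forall>\<eta>\<^sub>0. \<eta>\<^sub>0 > - 3 \<and> \<eta>\<^sub>0 \<noteq> 0 \<longrightarrow>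
        (\<bar>wave_speed \<sigma> \<eta>\<^sub>0\<bar> < 1 \<longleftrightarrow> - 9 / 4 < \<eta>\<^sub>0 \<and> \<eta>\<^sub>0 < 0)) \<and>
     (\<forall>\<eta>\<^sub>0. \<eta>\<^sub>0 > - 3 \<and> \<eta>\<^sub>0 \<noteq> 0 \<and> \<bar>wave_speed \<sigma> \<eta>\<^sub>0\<bar> < 1 \<longrightarrow>
        spectrally_stable a b c (wave_phi b \<eta>\<^sub>0) (wave_psi \<sigma> b \<eta>\<^sub>0) (wave_speed \<sigma> \<eta>\<^sub>0))"
proof -
  interpret sech_profile b by unfold_locales (rule assms)
  have tw: "traveling_wave_solution a b c (wave_phi b \<eta>) (wave_psi \<sigma> b \<eta>) (wave_speed \<sigma> \<eta>)" if \<eta>: "\<eta> > - 3" for \<eta>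
  proof -
    obtain \<alpha> q where "\<alpha> * q = 1" "\<sigma> * \<eta> * sqrt (3 / (\<eta> + 3)) = 3 * (q - \<alpha>)" "\<eta> = 3 * (q\<^sup>2 - 1)"
      "wave_speed \<sigma> \<eta> = 2 * q - \<alpha>"
      by (rule wave_parameters[OF \<eta> assms(4)])
    then show ?thesis
      unfolding assms(2,3) wave_phi_eq wave_psi_eq by (intro traveling_wave; algebra)
  qed
  have st: "spectrally_stable a b c (wave_phi b \<eta>) (wave_psi \<sigma> b \<eta>) (wave_speed \<sigma> \<eta>)" if \<eta>: "- 9 / 4 < \<eta>" "\<eta> < 0" for \<eta>
  proof -
    have "\<eta> > - 3" using \<eta> by simp
    obtain \<alpha> q where *: "\<alpha> * q = 1" "\<sigma> * \<eta> * sqrt (3 / (\<eta> + 3)) = 3 * (q - \<alpha>)" "\<eta> = 3 * (q\<^sup>2 - 1)"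
      "wave_speed \<sigma> \<eta> = 2 * q - \<alpha>" "\<alpha>\<^sup>2 = 3 / (\<eta> + 3)"
      by (rule wave_parameters[OF \<open>\<eta> > - 3\<close> assms(4)])
    have "1 < \<alpha>\<^sup>2" "\<alpha>\<^sup>2 < 4"
      unfolding *(5) using \<eta> by (simp_all add: less_divide_eq divide_less_eq)
    moreover have "(wave_speed \<sigma> \<eta>)\<^sup>2 < 1"
      using wave_speed_less_1_iff[OF \<open>\<eta> > - 3\<close> _ assms(4)] \<eta> by (simp add: abs_square_less_1)
    ultimately show ?thesis
      unfolding assms(2,3) wave_phi_eq wave_psi_eq using * by (intro wave_stable)
  qed
  show ?thesis
    using tw st wave_speed_less_1_iff[OF _ _ assms(4)] by blast
qed

end
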